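(* The operators ($q$-difference Toda Hamiltonians) $$H_a(\Lambda)=\sum_{I\subset[1,N],\,|I|=a}\ \prod_{i\in I,\ i-1\notin I}\Big(1-\frac{\Lambda_i}{\Lambda_{i-1}}\Big)\prod_{i\in I}T_i,\qquad a=1,2,\dots,N$$ (with $\Lambda_0=\infty$, i.e. the factor for $i=1$ equals $1$) are algebraically independent conserved quantities of the opposite quantum Q-system of type $A_{N-1}^{(1)}$.
   Context: $q\in\mathbb C^*$, $|q|<1$, $[1,N]=\{1,\dots,N\}$. The quantum torus $\mathbb T_\Lambda$ is generated by invertible $\Lambda_i,T_i$ ($i\in[1,N]$), the $\Lambda$'s commuting, the $T$'s commuting, with $T_i\Lambda_j=q^{\delta_{ij}}\Lambda_jT_i$. The opposite quantum Q-system of type $A_{N-1}^{(1)}$ for $\bar D_{a;k}$ ($a\in[1,N]$, $k\in\mathbb Z$): $\bar D_{b;k+i}\bar D_{a;k}=q^{i\min(a,b)}\bar D_{a;k}\bar D_{b;k+i}$ for $|i|\le1$, and $q^a\bar D_{a;k-1}\bar D_{a;k+1}=\bar D_{a;k}^2-\bar D_{a+1;k}\bar D_{a-1;k}$, with $\bar D_{0;k}=1$, $\bar D_{N+1;k}=0$. Here $\bar D_{a;k}$ is the solution with initial data $\bar D_{a;0}=\Lambda_1\cdots\Lambda_a$, $\bar D_{a;1}=\Lambda_1\cdots\Lambda_aT_1\cdots T_a$. Its time translation $k\mapsto k+1$ is implemented by conjugation: $\bar D_{a;k}=q^{-ak/2}g^k\bar D_{a;0}g^{-k}$ with $$g=\Big(\prod_{a=1}^Ne^{\frac{(\log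 T_a)^2}{2\log q}}\Big)\prod_{a=1}^{N-1}\prod_{n\ge0}\Big(1-q^n\frac{\Lambda_{a+1}}{\Lambda_a}\Big)^{-1},$$ where $e^{(\log T_a)^2/(2\log q)}$ commutes with all $T_b$ and with $\Lambda_b$ ($b\ne a$) and conjugates $\Lambda_a$ to $q^{1/2}\Lambda_aT_a$. "Conserved quantity" means: the element commutes with $g$; equivalently, expressed as a Laurent polynomial in the initial data $(\bar D_{i;0},\bar D_{i;1})_{i\in[1,N]}$, it is invariant under every time translation $(\bar D_{i;0},\bar D_{i;1})\mapsto(\bar D_{i;n},\bar D_{i;n+1})$, $n\in\mathbb Z$. *)

theory Defs
  imports
    Complex_Main
    "HOL-Algebra.Module"
    "HOL-Library.Function_Algebras"
    "HOL-Library.Poly_Mapping"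
    "HOL-Computational_Algebra.Formal_Power_Series"
begin

text \<open>
  The element \<open>g\<close> is not in the quantum torus itself: it involves power series in the
  \<open>\<Lambda>\<^bsub>a+1\<^esub>/\<Lambda>\<^sub>a\<close> and the Gaussians \<open>G\<^sub>a = exp ((log T\<^sub>a)\<^sup>2 / (2 log q))\<close>.  We
  therefore work in the completed algebra of series in the ordered monomials
  \<open>\<Lambda>\<^sup>m T\<^sup>n G\<^sup>k\<close>, where \<open>m, n, k\<close> are integer exponent vectors indexed by \<open>{1..N}\<close>.
  The Gaussians are invertible symbols that commute with each other and with the \<open>T\<^sub>b\<close>, and
  satisfy \<open>G\<^sub>a \<Lambda>\<^sub>b = \<Lambda>\<^sub>b G\<^sub>a\<close> for \<open>a \<noteq> b\<close> and \<open>G\<^sub>a \<Lambda>\<^sub>a = s \<Lambda>\<^sub>a T\<^sub>a G\<^sub>a\<close>, with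
  \<open>s\<close> a square root of \<open>q\<close>.
\<close>

type_synonym expo = "nat \<Rightarrow> int"
type_synonym mon = "expo \<times> expo \<times> expo"

definition unit_expo :: "nat \<Rightarrow> expo" where
  "unit_expo i = (\<lambda>j. if j = i then 1 else 0)"

text \<open>
  \<open>G\<^sup>k \<Lambda>\<^sup>m = (\<Prod>\<^sub>i s\<^bsup>k i (m i)^2\<^esup>) \<Lambda>\<^sup>m T\<^bsup>k m\<^esup> G\<^sup>k\<close> and \<open>T\<^sup>n \<Lambda>\<^sup>m = (\<Prod>\<^sub>i q\<^bsup>n i m i\<^esup>) \<Lambda>\<^sup>m T\<^sup>n\<close>
  (products of exponent vectors are pointwise), hence the product of two ordered monomials is
  the monomial \<open>mon_mult\<close> times the scalar \<open>mon_cocycle\<close>.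
\<close>

fun mon_mult :: "mon \<Rightarrow> mon \<Rightarrow> mon" where
  "mon_mult (m, n, k) (m', n', k') = (m + m', n + n' + k * m', k + k')"

fun mon_cocycle :: "complex \<Rightarrow> complex \<Rightarrow> nat \<Rightarrow> mon \<Rightarrow> mon \<Rightarrow> complex" where
  "mon_cocycle q s N (m, n, k) (m', n', k') =
     q powi (\<Sum>i=1..N. n i * m' i) * s powi (\<Sum>i=1..N. k i * (m' i)\<^sup>2)"

definition supp :: "(mon \<Rightarrow> complex) \<Rightarrow> mon set" where
  "supp f = {x. f x \<noteq> 0}"

text \<open>The exponents of the products \<open>\<Prod>\<^bsub>a=1..N-1\<^esub> (\<Lambda>\<^bsub>a+1\<^esub>/\<Lambda>\<^sub>a)\<^bsup>c a\<^esup>\<close> with \<open>c a \<ge> 0\<close>.\<close>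

definition root_cone :: "nat \<Rightarrow> expo set" where
  "root_cone N =
     {\<lambda>i. \<Sum>a=1..<N. int (c a) * (unit_expo (a + 1) i - unit_expo a i) | c :: nat \<Rightarrow> nat. True}"

text \<open>
  Series whose \<open>\<Lambda>\<close>-exponents lie in finitely many translates of the cone, with a Laurent
  polynomial in the \<open>T\<^sub>i\<close>, \<open>G\<^sub>i\<close> as coefficient of each \<open>\<Lambda>\<^sup>m\<close>.  For two such series the sum
  in the product below is finite.
\<close>

definition series_carrier :: "nat \<Rightarrow> (mon \<Rightarrow> complex) set" where
  "series_carrier N = {f.
     (\<forall>(m, n, k)\<in>supp f. \<forall>i. i \<notin> {1..N} \<longrightarrow> m i = 0 \<and> n i = 0 \<and> k i = 0) \<and>
     (\<forall>m. finite {(n, k). (m, n, k) \<in> supp f}) \<and>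
     (\<exists>F. finite F \<and> (\<forall>(m, n, k)\<in>supp f. \<exists>m0\<in>F. \<exists>c\<in>root_cone N. m = m0 + c))}"

definition basis :: "mon \<Rightarrow> (mon \<Rightarrow> complex)" where
  "basis x = (\<lambda>y. if y = x then 1 else 0)"

definition series_alg :: "complex \<Rightarrow> complex \<Rightarrow> nat \<Rightarrow> (complex, mon \<Rightarrow> complex) module" where
  "series_alg q s N =
     \<lparr>carrier = series_carrier N,
      monoid.mult = (\<lambda>f h x. \<Sum>(y, z)\<in>{(y, z). y \<in> supp f \<and> z \<in> supp h \<and> mon_mult y z = x}.
                mon_cocycle q s N y z * f y * h z),
      monoid.one = basis (0, 0, 0),
      ring.zero = (\<lambda>_. 0),
      ring.add = (\<lambda>f h x. f x + h x),
      module.smult = (\<lambda>c f x. c * f x)\<rparr>"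

definition Lam :: "nat \<Rightarrow> (mon \<Rightarrow> complex)" where
  "Lam i = basis (unit_expo i, 0, 0)"

definition Tor :: "nat \<Rightarrow> (mon \<Rightarrow> complex)" where
  "Tor i = basis (0, unit_expo i, 0)"

definition Gau :: "nat \<Rightarrow> (mon \<Rightarrow> complex)" where
  "Gau i = basis (0, 0, unit_expo i)"

text \<open>
  The quantum torus generated by the \<open>\<Lambda>\<^sub>i\<close> and \<open>T\<^sub>i\<close>: finite linear combinations of the
  \<open>\<Lambda>\<^sup>m T\<^sup>n\<close>.
\<close>

definition quantum_torus :: "nat \<Rightarrow> (mon \<Rightarrow> complex) set" where
  "quantum_torus N =
     {f \<in> series_carrier N. finite (supp f) \<and> (\<forall>(m, n, k)\<in>supp f. k = 0)}"

definition ord_prod :: "('a, 'b) monoid_scheme \<Rightarrow> nat \<Rightarrow> (nat \<Rightarrow> 'a) \<Rightarrow> 'a" where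
  "ord_prod R n f = foldr (\<lambda>i P. f i \<otimes>\<^bsub>R\<^esub> P) [1..<Suc n] \<one>\<^bsub>R\<^esub>"

text \<open>
  The infinite product \<open>\<Prod>\<^bsub>n\<ge>0\<^esub> (1 - q\<^sup>n X)\<^bsup>-1\<^esup>\<close> as a formal power series: the coefficientwise
  limit of its partial products.  (It does not converge in the \<open>X\<close>-adic topology used by the
  library for formal power series.)
\<close>

definition qdilog :: "complex \<Rightarrow> complex fps" where
  "qdilog q = Abs_fps (\<lambda>j. lim (\<lambda>M.
     fps_nth (\<Prod>n<M. inverse (1 - fps_const (q ^ n) * fps_X)) j))"

text \<open>The substitution of \<open>\<Lambda>\<^bsub>a+1\<^esub>/\<Lambda>\<^sub>a\<close> for \<open>X\<close>.\<close>

definition subst_ratio :: "nat \<Rightarrow> complex fps \<Rightarrow> (mon \<Rightarrow> complex)" where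
  "subst_ratio a F = (\<lambda>(m, n, k).
     if n = 0 \<and> k = 0 \<and> (\<exists>j::nat. m = (\<lambda>i. int j * (unit_expo (a + 1) i - unit_expo a i)))
     then fps_nth F (nat (m (a + 1))) else 0)"

definition g_elem :: "complex \<Rightarrow> complex \<Rightarrow> nat \<Rightarrow> (mon \<Rightarrow> complex)" where
  "g_elem q s N =
     ord_prod (series_alg q s N) N Gau \<otimes>\<^bsub>series_alg q s N\<^esub>
     ord_prod (series_alg q s N) (N - 1) (\<lambda>a. subst_ratio a (qdilog q))"

definition opposite_Q_system ::
  "complex \<Rightarrow> nat \<Rightarrow> (complex, 'a, 'b) module_scheme \<Rightarrow> (nat \<Rightarrow> int \<Rightarrow> 'a) \<Rightarrow> bool" where
  "opposite_Q_system q N R D \<longleftrightarrow>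
     (\<forall>k. D 0 k = \<one>\<^bsub>R\<^esub>) \<and>
     (\<forall>a>N. \<forall>k. D a k = \<zero>\<^bsub>R\<^esub>) \<and>
     (\<forall>a\<in>{1..N}. \<forall>k. D a k \<in> Units R) \<and>
     (\<forall>a\<in>{1..N}. \<forall>b\<in>{1..N}. \<forall>k. \<forall>i. \<bar>i\<bar> \<le> 1 \<longrightarrow>
        D b (k + i) \<otimes>\<^bsub>R\<^esub> D a k =
        (q powi (i * int (min a b))) \<odot>\<^bsub>R\<^esub> (D a k \<otimes>\<^bsub>R\<^esub> D b (k + i))) \<and>
     (\<forall>a\<in>{1..N}. \<forall>k.
        (q ^ a) \<odot>\<^bsub>R\<^esub> (D a (k - 1) \<otimes>\<^bsub>R\<^esub> D a (k + 1)) =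
        (D a k \<otimes>\<^bsub>R\<^esub> D a k) \<ominus>\<^bsub>R\<^esub> (D (a + 1) k \<otimes>\<^bsub>R\<^esub> D (a - 1) k))"

text \<open>
  The initial data determine the solution uniquely, because the \<open>D a k\<close> are invertible.
\<close>

definition Dbar :: "complex \<Rightarrow> complex \<Rightarrow> nat \<Rightarrow> nat \<Rightarrow> int \<Rightarrow> (mon \<Rightarrow> complex)" where
  "Dbar q s N = (THE D.
     opposite_Q_system q N (series_alg q s N) D \<and>
     (\<forall>a\<in>{1..N}.
        D a 0 = ord_prod (series_alg q s N) a Lam \<and>
        D a 1 = ord_prod (series_alg q s N) a Lam \<otimes>\<^bsub>series_alg q s N\<^esub>
                ord_prod (series_alg q s N) a Tor))"

text \<open>
  The value of an ordered Laurent polynomial, with coefficient \<open>p (m, n)\<close> at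
  \<open>x\<^sub>1\<^bsup>m 1\<^esup>\<dots>x\<^sub>N\<^bsup>m N\<^esup> y\<^sub>1\<^bsup>n 1\<^esup>\<dots>y\<^sub>N\<^bsup>n N\<^esup>\<close>.
\<close>

definition laurent_eval ::
  "(complex, 'a, 'b) module_scheme \<Rightarrow> nat \<Rightarrow> (expo \<times> expo \<Rightarrow>\<^sub>0 complex) \<Rightarrow>
   (nat \<Rightarrow> 'a) \<Rightarrow> (nat \<Rightarrow> 'a) \<Rightarrow> 'a" where
  "laurent_eval R N p x y =
     (\<Oplus>\<^bsub>R\<^esub>e\<in>Poly_Mapping.keys p. Poly_Mapping.lookup p e \<odot>\<^bsub>R\<^esub>
        (ord_prod R N (\<lambda>i. x i [^]\<^bsub>R\<^esub> fst e i) \<otimes>\<^bsub>R\<^esub> ord_prod R N (\<lambda>i. y i [^]\<^bsub>R\<^esub> snd e i)))"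

text \<open>
  Both descriptions of conservation are required: commutation with \<open>g\<close>, and invariance of the
  expression in the initial data under all time translations.
\<close>

definition conserved_quantity :: "complex \<Rightarrow> complex \<Rightarrow> nat \<Rightarrow> (mon \<Rightarrow> complex) \<Rightarrow> bool" where
  "conserved_quantity q s N X \<longleftrightarrow>
     X \<in> quantum_torus N \<and>
     g_elem q s N \<otimes>\<^bsub>series_alg q s N\<^esub> X = X \<otimes>\<^bsub>series_alg q s N\<^esub> g_elem q s N \<and>
     (\<exists>p. X = laurent_eval (series_alg q s N) N p
                (\<lambda>i. Dbar q s N i 0) (\<lambda>i. Dbar q s N i 1) \<and>
          (\<forall>k. laurent_eval (series_alg q s N) N p
                (\<lambda>i. Dbar q s N i k) (\<lambda>i. Dbar q s N i (k + 1)) = X))"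

definition toda_H :: "complex \<Rightarrow> complex \<Rightarrow> nat \<Rightarrow> nat \<Rightarrow> (mon \<Rightarrow> complex)" where
  "toda_H q s N a = (let R = series_alg q s N in
     \<Oplus>\<^bsub>R\<^esub>I\<in>{I. I \<subseteq> {1..N} \<and> card I = a}.
       ord_prod R N (\<lambda>i. if i \<in> I \<and> i - 1 \<notin> I \<and> i \<noteq> 1
                          then \<one>\<^bsub>R\<^esub> \<ominus>\<^bsub>R\<^esub> (Lam i \<otimes>\<^bsub>R\<^esub> inv\<^bsub>R\<^esub> Lam (i - 1)) else \<one>\<^bsub>R\<^esub>) \<otimes>\<^bsub>R\<^esub>
       ord_prod R N (\<lambda>i. if i \<in> I then Tor i else \<one>\<^bsub>R\<^esub>))"

text \<open>
  In a noncommutative algebra, algebraic independence of \<open>x\<^sub>1, \<dots>, x\<^sub>N\<close> means that they commute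
  pairwise and that the evaluation homomorphism from the polynomial ring in \<open>N\<close> variables, here
  the \<open>p\<close> involving only the variables \<open>1..N\<close>, is injective.
\<close>

definition poly_eval ::
  "(complex, 'a, 'b) module_scheme \<Rightarrow> nat \<Rightarrow> ((nat \<Rightarrow>\<^sub>0 nat) \<Rightarrow>\<^sub>0 complex) \<Rightarrow> (nat \<Rightarrow> 'a) \<Rightarrow> 'a" where
  "poly_eval R N p x =
     (\<Oplus>\<^bsub>R\<^esub>e\<in>Poly_Mapping.keys p. Poly_Mapping.lookup p e \<odot>\<^bsub>R\<^esub>
        ord_prod R N (\<lambda>i. x i [^]\<^bsub>R\<^esub> Poly_Mapping.lookup e i))"

definition algebraically_independent ::
  "(complex, 'a, 'b) module_scheme \<Rightarrow> nat \<Rightarrow> (nat \<Rightarrow> 'a) \<Rightarrow> bool" where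
  "algebraically_independent R N x \<longleftrightarrow>
     (\<forall>a\<in>{1..N}. \<forall>b\<in>{1..N}. x a \<otimes>\<^bsub>R\<^esub> x b = x b \<otimes>\<^bsub>R\<^esub> x a) \<and>
     (\<forall>p. (\<forall>e\<in>Poly_Mapping.keys p. Poly_Mapping.keys e \<subseteq> {1..N}) \<longrightarrow>
          poly_eval R N p x = \<zero>\<^bsub>R\<^esub> \<longrightarrow> p = 0)"

end

(*
  The solution of the Q-system is D a k = s^(-ak) g^k (Lam_1 ... Lam_a) g^(-k): conjugation reduces
  the relations to k = 0, where they follow from the functional equation of the infinite product,
  and invertibility gives uniqueness.  Conjugating by g turns the products over the ascents of a
  subset I into products over its descents, and moving descents up by one matches the terms; hence
  g commutes with each Hamiltonian.  Time translation acts on elements of Lam-degree 0 as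
  conjugation by g.  The Hamiltonians commute because their commutators commute with g and vanish
  in Lam-degree zero of the root cone, while g has no nonzero commutant of this kind.  They are
  algebraically independent because their leading monomials T_1 ... T_a in the dominance order are.
*)

theory Submission
  imports Defs
begin

section \<open>Exponents and the root cone\<close>

text \<open>The obstacle is that g lies outside the quantum torus, so every identity needs
  convolutions of infinite series to be finite sums. This comes from the grading
  \<open>height\<close>, chosen so that each simple root has height 1: the cone is pointed and has
  finitely many points below any height.

  Write g = \<Gamma> \<Phi>, with the Gaussians in \<Gamma> and the infinite products in \<Phi>, and
  X_b = \<Lambda>_(b+1)/\<Lambda>_b. Then \<Phi> turns the ascent factors 1 - X_b of a Hamiltonian
  into descent factors 1 - X_b/q, because T_I rescales X_b by q at ascents and by 1/q at descents.
  \<Gamma> gives each monomial with K moved descents the scalar s^(2|K|) = q^|K|, which cancels the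
  powers of 1/q.

  Commutativity of the Hamiltonians needs no comparison of H_a H_b with H_b H_a term by term: at a
  \<Lambda>-exponent of lowest height only the constant term 1 of \<Phi> is visible, and \<Gamma>
  alone would force infinitely many T-exponents.\<close>

definition height :: "nat \<Rightarrow> expo \<Rightarrow> int" where
  "height N m = (\<Sum>i=1..N. int i * m i)"

lemma height_add: "height N (m + m') = height N m + height N m'"
  by (simp add: height_def distrib_left sum.distrib)

lemma height_zero [simp]: "height N 0 = 0"
  by (simp add: height_def)

text \<open>The exponent of \<Lambda>_(a+1)/\<Lambda>_a: a simple root of type A, up to sign. Those
  with a in [1,N-1] generate \<open>root_cone\<close>.\<close>

definition simple_root :: "nat \<Rightarrow> expo" where
  "simple_root a = unit_expo (a + 1) - unit_expo a"

lemma root_cone_eq: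
  "root_cone N = range (\<lambda>c i. \<Sum>a=1..<N. int (c a) * simple_root a i)"
  unfolding root_cone_def simple_root_def by (auto simp: fun_diff_def)

lemma height_simple_root:
  assumes "a \<in> {1..<N}"
  shows "height N (simple_root a) = 1"
proof -
  have "(\<Sum>i=1..N. int i * simple_root a i) =
      (\<Sum>i=1..N. (if i = a + 1 then int i else 0) - (if i = a then int i else 0))"
    by (intro sum.cong) (auto simp: simple_root_def unit_expo_def)
  also have "\<dots> = 1"
    using assms by (simp add: sum_subtractf)
  finally show ?thesis
    by (simp add: height_def)
qed

lemma height_root_combination:
  "height N (\<lambda>i. \<Sum>a=1..<N. int (c a) * simple_root a i) = (\<Sum>a=1..<N. int (c a))"
proof -
  have "height N (\<lambda>i. \<Sum>a=1..<N. int (c a) * simple_root a i) =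
      (\<Sum>a=1..<N. int (c a) * height N (simple_root a))"
    unfolding height_def sum_distrib_left
    by (subst sum.swap) (simp add: mult.left_commute)
  also have "\<dots> = (\<Sum>a=1..<N. int (c a))"
    by (intro sum.cong) (simp_all add: height_simple_root)
  finally show ?thesis .
qed

lemma root_cone_add:
  assumes "m \<in> root_cone N" "m' \<in> root_cone N"
  shows "m + m' \<in> root_cone N"
proof -
  obtain c c' where "m = (\<lambda>i. \<Sum>a=1..<N. int (c a) * simple_root a i)"
    "m' = (\<lambda>i. \<Sum>a=1..<N. int (c' a) * simple_root a i)"
    using assms unfolding root_cone_eq by blast
  then have "m + m' = (\<lambda>i. \<Sum>a=1..<N. int (c a + c' a) * simple_root a i)"
    unfolding plus_fun_def by (simp only: of_nat_add distrib_right sum.distrib)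
  then show ?thesis
    unfolding root_cone_eq by (intro image_eqI[where x = "\<lambda>a. c a + c' a"]) simp_all
qed

lemma root_cone_zero [simp]: "0 \<in> root_cone N"
  unfolding root_cone_eq by (rule image_eqI[of _ _ "\<lambda>_. 0"]) auto

lemma root_cone_multiple:
  assumes "a \<in> {1..<N}"
  shows "(\<lambda>i. int j * simple_root a i) \<in> root_cone N"
proof -
  have "(\<Sum>b=1..<N. int (if b = a then j else 0) * simple_root b i) = int j * simple_root a i" for i
    using assms by (subst sum.mono_neutral_right[of _ "{a}"]) auto
  then show ?thesis
    unfolding root_cone_eq by (intro image_eqI[of _ _ "\<lambda>b. if b = a then j else 0"]) auto
qed

lemma height_root_cone_nonneg: "m \<in> root_cone N \<Longrightarrow> 0 \<le> height N m"
  unfolding root_cone_eq by (elim rangeE) (simp only: height_root_combination sum_nonneg of_nat_0_le_iff)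

lemma height_root_cone_eq_0:
  assumes "m \<in> root_cone N" "height N m \<le> 0"
  shows "m = 0"
proof -
  obtain c where m: "m = (\<lambda>i. \<Sum>a=1..<N. int (c a) * simple_root a i)"
    using assms(1) unfolding root_cone_eq by blast
  then have "(\<Sum>a=1..<N. int (c a)) \<le> 0"
    using assms(2) height_root_combination by metis
  then have "(\<Sum>a=1..<N. int (c a)) = 0"
    by (simp add: sum_nonneg order_antisym)
  then have "\<forall>a\<in>{1..<N}. c a = 0"
    by (simp add: sum_nonneg_eq_0_iff)
  then show ?thesis
    unfolding m by (auto simp: fun_eq_iff)
qed

text \<open>Pointedness of the cone: heights are nonnegative on it and here add up to 0. It makes
  the \<Lambda>-free part of a product depend only on the \<Lambda>-free parts of the
  factors.\<close>

lemma root_cone_add_eq_0: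
  assumes "m \<in> root_cone N" "m' \<in> root_cone N" "m + m' = 0"
  shows "m = 0 \<and> m' = 0"
proof -
  have "height N m + height N m' = 0"
    using assms(3) height_add height_zero by metis
  then show ?thesis
    using height_root_cone_nonneg[OF assms(1)] height_root_cone_nonneg[OF assms(2)]
    by (intro conjI height_root_cone_eq_0[where N = N] assms) linarith+
qed

text \<open>The height of a combination of simple roots is the sum of its coefficients, so a bound
  on the height bounds each coefficient. All finiteness statements below rest on this.\<close>

lemma finite_root_cone_le: "finite {m \<in> root_cone N. height N m \<le> K}"
proof -
  define F where "F = (\<lambda>c::nat \<Rightarrow> nat. \<lambda>i. \<Sum>a=1..<N. int (c a) * simple_root a i)"
  have "{m \<in> root_cone N. height N m \<le> K} \<subseteq> F ` (PiE {1..<N} (\<lambda>_. {..nat K}))"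
  proof
    fix m assume "m \<in> {m \<in> root_cone N. height N m \<le> K}"
    then obtain c where m: "m = F c" and le: "height N m \<le> K"
      unfolding root_cone_eq F_def by blast
    have h: "(\<Sum>a=1..<N. int (c a)) \<le> K"
      using le unfolding m F_def height_root_combination .
    have "c a \<le> nat K" if "a \<in> {1..<N}" for a
    proof -
      have "int (c a) \<le> (\<Sum>a=1..<N. int (c a))"
        using that by (intro member_le_sum) auto
      with h show ?thesis by linarith
    qed
    \<comment> \<open>Coefficients outside the index range do not affect the combination; fixing
      them by restriction makes the parameter set finite.\<close>
    then have "restrict c {1..<N} \<in> PiE {1..<N} (\<lambda>_. {..nat K})"
      by auto
    moreover have "F (restrict c {1..<N}) = F c"
      unfolding F_def by (auto simp: fun_eq_iff intro!: sum.cong)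
    ultimately show "m \<in> F ` (PiE {1..<N} (\<lambda>_. {..nat K}))"
      unfolding m by (metis imageI)
  qed
  then show ?thesis
    by (rule finite_subset) (intro finite_imageI finite_PiE, auto)
qed

lemma root_cone_supported:
  assumes "m \<in> root_cone N" "i \<notin> {1..N}"
  shows "m i = 0"
  using assms unfolding root_cone_eq
  by (auto simp: simple_root_def unit_expo_def intro!: sum.neutral)

section \<open>Ordered monomials and finiteness of supports\<close>

lemma mon_mult_assoc: "mon_mult (mon_mult x y) z = mon_mult x (mon_mult y z)"
  by (cases x; cases y; cases z) (simp add: algebra_simps fun_eq_iff)

lemma mon_mult_zero [simp]: "mon_mult (0, 0, 0) x = x" "mon_mult x (0, 0, 0) = x"
  by (cases x; simp add: fun_eq_iff)+

lemma mon_mult_left_cancel [simp]: "mon_mult x y = mon_mult x z \<longleftrightarrow> y = z"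
  by (cases x; cases y; cases z) (auto simp: fun_eq_iff)

lemma mon_mult_right_cancel [simp]: "mon_mult y x = mon_mult z x \<longleftrightarrow> y = z"
  by (cases x; cases y; cases z) (auto simp: fun_eq_iff)

lemma fst_mon_mult: "fst (mon_mult x y) = fst x + fst y"
  by (cases x; cases y) simp

lemma supp_basis [simp]: "supp (basis x) = {x}"
  by (auto simp: supp_def basis_def)

definition supported_on :: "nat \<Rightarrow> mon \<Rightarrow> bool" where
  "supported_on N = (\<lambda>(m, n, k). \<forall>i. i \<notin> {1..N} \<longrightarrow> m i = 0 \<and> n i = 0 \<and> k i = 0)"

lemma supported_on_mult:
  "supported_on N x \<Longrightarrow> supported_on N y \<Longrightarrow> supported_on N (mon_mult x y)"
  by (cases x; cases y) (auto simp: supported_on_def)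

definition cone_bounded :: "nat \<Rightarrow> (mon \<Rightarrow> complex) \<Rightarrow> bool" where
  "cone_bounded N f \<longleftrightarrow>
     (\<exists>F. finite F \<and> (\<forall>x\<in>supp f. \<exists>m0\<in>F. \<exists>c\<in>root_cone N. fst x = m0 + c))"

lemma series_carrier_iff:
  "f \<in> series_carrier N \<longleftrightarrow>
     (\<forall>x\<in>supp f. supported_on N x) \<and> (\<forall>m. finite {x\<in>supp f. fst x = m}) \<and> cone_bounded N f"
proof -
  have "finite {(n, k). (m, n, k) \<in> supp f} \<longleftrightarrow> finite {x\<in>supp f. fst x = m}" for m
  proof -
    have "{x\<in>supp f. fst x = m} = Pair m ` {(n, k). (m, n, k) \<in> supp f}"
      by auto
    then show ?thesis
      by (simp add: finite_image_iff inj_on_def)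
  qed
  then show ?thesis
    unfolding series_carrier_def supported_on_def cone_bounded_def by (simp add: split_beta)
qed

lemma series_carrierI:
  assumes "\<And>x. x \<in> supp f \<Longrightarrow> supported_on N x"
    "\<And>m. finite {x\<in>supp f. fst x = m}" "cone_bounded N f"
  shows "f \<in> series_carrier N"
  using assms series_carrier_iff by blast

lemma series_carrier_finite:
  assumes "finite (supp f)" "\<And>x. x \<in> supp f \<Longrightarrow> supported_on N x"
  shows "f \<in> series_carrier N"
proof (rule series_carrierI)
  show "cone_bounded N f"
    unfolding cone_bounded_def using assms(1)
    by (intro exI[of _ "fst ` supp f"] conjI finite_imageI ballI bexI[of _ 0] bexI[OF _ imageI])
      (simp_all only: add_0_right root_cone_zero)
qed (use assms in auto)

lemma series_carrier_in_cone:
  assumes "\<And>x. x \<in> supp f \<Longrightarrow> supported_on N x \<and> fst x \<in> root_cone N"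
    "\<And>m. finite {x\<in>supp f. fst x = m}"
  shows "f \<in> series_carrier N"
proof (rule series_carrierI)
  show "cone_bounded N f"
    unfolding cone_bounded_def using assms(1)
    by (intro exI[of _ "{0}"]) auto
qed (use assms in auto)

text \<open>Each of the finitely many translates of the cone has finitely many points of bounded
  height, and over each such \<Lambda>-exponent there are only finitely many monomials.\<close>

lemma finite_supp_le:
  assumes "f \<in> series_carrier N"
  shows "finite {x \<in> supp f. height N (fst x) \<le> K}"
proof -
  obtain F where F: "finite F" "\<And>x. x\<in>supp f \<Longrightarrow> \<exists>m0\<in>F. \<exists>c\<in>root_cone N. fst x = m0 + c"
    using assms unfolding series_carrier_iff cone_bounded_def by blast
  define M where "M = (\<Union>m0\<in>F. (+) m0 ` {c \<in> root_cone N. height N c \<le> K - height N m0})"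
  have "finite M"
    unfolding M_def using F(1) by (intro finite_UN_I finite_imageI finite_root_cone_le)
  moreover have "{x \<in> supp f. height N (fst x) \<le> K} \<subseteq> (\<Union>m\<in>M. {x\<in>supp f. fst x = m})"
  proof
    fix x assume x: "x \<in> {x \<in> supp f. height N (fst x) \<le> K}"
    then obtain m0 c where "m0 \<in> F" "c \<in> root_cone N" "fst x = m0 + c"
      using F(2) by blast
    moreover from this have "height N c \<le> K - height N m0"
      using x by (simp add: height_add)
    ultimately have "fst x \<in> M"
      unfolding M_def by blast
    then show "x \<in> (\<Union>m\<in>M. {x\<in>supp f. fst x = m})"
      using x by auto
  qed
  ultimately show ?thesis
    using assms unfolding series_carrier_iff
    by (metis (no_types, lifting) finite_UN_I finite_subset)
qed

lemma supp_height_bounded_below: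
  assumes "f \<in> series_carrier N"
  obtains L where "\<And>x. x \<in> supp f \<Longrightarrow> L \<le> height N (fst x)"
proof -
  define S where "S = (\<lambda>x. height N (fst x)) ` {x \<in> supp f. height N (fst x) \<le> 0}"
  have "finite S"
    unfolding S_def by (intro finite_imageI finite_supp_le assms)
  \<comment> \<open>Inserting 0 keeps the minimum defined when no monomial has nonpositive height,
    and gives L \<le> 0, which settles the positive heights.\<close>
  define L where "L = Min (insert 0 S)"
  have "L \<le> height N (fst x)" if "x \<in> supp f" for x
  proof (cases "height N (fst x) \<le> 0")
    case True
    then show ?thesis
      unfolding L_def using that \<open>finite S\<close> by (intro Min_le) (auto simp: S_def)
  next
    case False
    moreover have "L \<le> 0"
      unfolding L_def using \<open>finite S\<close> by (intro Min_le) auto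
    ultimately show ?thesis by linarith
  qed
  then show ?thesis using that by blast
qed

text \<open>Heights add under multiplication and are bounded below on each support, so an upper
  bound on the product bounds each factor from above.\<close>

lemma finite_pairs_le:
  assumes "f \<in> series_carrier N" "h \<in> series_carrier N"
  shows "finite {(y, z). y \<in> supp f \<and> z \<in> supp h \<and> height N (fst (mon_mult y z)) \<le> K}"
proof -
  obtain L where L: "\<And>x. x \<in> supp f \<Longrightarrow> L \<le> height N (fst x)"
    using supp_height_bounded_below[OF assms(1)] by blast
  obtain L' where L': "\<And>x. x \<in> supp h \<Longrightarrow> L' \<le> height N (fst x)"
    using supp_height_bounded_below[OF assms(2)] by blast
  have "{(y, z). y \<in> supp f \<and> z \<in> supp h \<and> height N (fst (mon_mult y z)) \<le> K} \<subseteq>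
    {x \<in> supp f. height N (fst x) \<le> K - L'} \<times> {x \<in> supp h. height N (fst x) \<le> K - L}"
  proof (clarsimp simp del: mon_mult.simps)
    fix y1 y2 y3 z1 z2 z3
    define y :: mon where "y = (y1, y2, y3)"
    define z :: mon where "z = (z1, z2, z3)"
    assume "(y1, y2, y3) \<in> supp f" "(z1, z2, z3) \<in> supp h"
      "height N (fst (mon_mult (y1, y2, y3) (z1, z2, z3))) \<le> K"
    then have *: "y \<in> supp f" "z \<in> supp h" "height N (fst (mon_mult y z)) \<le> K"
      by (simp_all only: y_def z_def)
    then have "height N (fst y) + height N (fst z) \<le> K"
      by (simp add: fst_mon_mult height_add)
    then show "height N y1 \<le> K - L' \<and> height N z1 \<le> K - L"
      using L[OF *(1)] L'[OF *(2)] by (simp add: y_def z_def)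
  qed
  then show ?thesis
    by (rule finite_subset) (intro finite_cartesian_product finite_supp_le assms)
qed

lemma finite_pairs:
  assumes "f \<in> series_carrier N" "h \<in> series_carrier N"
  shows "finite {(y, z). y \<in> supp f \<and> z \<in> supp h \<and> mon_mult y z = x}"
  by (rule finite_subset[OF _ finite_pairs_le[OF assms, of "height N (fst x)"]]) auto

text \<open>These triples index both bracketings of a triple product. A lower bound for the last
  factor bounds the height of the product of the first two, which leaves finitely many pairs and
  then finitely many third entries.\<close>

lemma finite_triples:
  assumes "f \<in> series_carrier N" "h \<in> series_carrier N" "g \<in> series_carrier N"
  shows "finite {(y, z, w). y \<in> supp f \<and> z \<in> supp h \<and> w \<in> supp g \<and>
           mon_mult (mon_mult y z) w = x}"
proof -
  obtain L where L: "\<And>x. x \<in> supp g \<Longrightarrow> L \<le> height N (fst x)"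
    using supp_height_bounded_below[OF assms(3)] by blast
  define P where "P = {(y, z). y \<in> supp f \<and> z \<in> supp h \<and> height N (fst (mon_mult y z)) \<le> height N (fst x) - L}"
  define F where "F = (\<lambda>((y, z), w). (y, z, w)) `
     (SIGMA p:P. {w \<in> supp g. height N (fst w) \<le> height N (fst x) - height N (fst (mon_mult (fst p) (snd p)))})"
  have "finite F"
    unfolding F_def P_def
    by (intro finite_imageI finite_SigmaI finite_pairs_le finite_supp_le assms)
  moreover have "{(y, z, w). y \<in> supp f \<and> z \<in> supp h \<and> w \<in> supp g \<and>
           mon_mult (mon_mult y z) w = x} \<subseteq> F"
  proof clarify
    fix y z w assume *: "y \<in> supp f" "z \<in> supp h" "w \<in> supp g" "x = mon_mult (mon_mult y z) w"
    have "height N (fst x) = height N (fst (mon_mult y z)) + height N (fst w)"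
      by (simp add: *(4) fst_mon_mult height_add)
    then have "((y, z), w) \<in> (SIGMA p:P. {w \<in> supp g. height N (fst w) \<le> height N (fst x) - height N (fst (mon_mult (fst p) (snd p)))})"
      using * L[OF *(3)] by (auto simp: P_def)
    then show "(y, z, w) \<in> F" 
      unfolding F_def by (metis (no_types, lifting) case_prod_conv image_eqI *(4))
  qed
  ultimately show ?thesis
    by (rule rev_finite_subset)
qed

lemma mon_cocycle_nonzero: "q \<noteq> 0 \<Longrightarrow> s \<noteq> 0 \<Longrightarrow> mon_cocycle q s N x y \<noteq> 0"
  by (cases x; cases y) simp

lemma mon_cocycle_zero [simp]:
  "mon_cocycle q s N (0, 0, 0) x = 1" "mon_cocycle q s N x (0, n, k) = 1"
  by (cases x; simp)+

text \<open>The 2-cocycle identity behind associativity. With q = s^2 both sides are powers of s. On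
  the left, moving k past m' creates T^(k m'), which contributes 2E when it meets m''; on the right
  the same 2E is the cross term of (m' + m'')^2.\<close>

lemma mon_cocycle_assoc:
  assumes "q \<noteq> 0" "s\<^sup>2 = q"
  shows "mon_cocycle q s N x y * mon_cocycle q s N (mon_mult x y) z =
         mon_cocycle q s N y z * mon_cocycle q s N x (mon_mult y z)"
proof -
  obtain m n k where x: "x = (m, n, k)" by (cases x)
  obtain m' n' k' where y: "y = (m', n', k')" by (cases y)
  obtain m'' n'' k'' where z: "z = (m'', n'', k'')" by (cases z)
  have s0: "s \<noteq> 0" using assms by auto
  define A where "A = (\<Sum>i=1..N. n i * m' i)"
  define B where "B = (\<Sum>i=1..N. n i * m'' i)"
  define C where "C = (\<Sum>i=1..N. n' i * m'' i)"
  define E where "E = (\<Sum>i=1..N. k i * m' i * m'' i)"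
  define a where "a = (\<Sum>i=1..N. k i * (m' i)\<^sup>2)"
  define b where "b = (\<Sum>i=1..N. k i * (m'' i)\<^sup>2)"
  define c where "c = (\<Sum>i=1..N. k' i * (m'' i)\<^sup>2)"
  have q: "q powi t = s powi (2 * t)" for t
    using assms(2) by (metis power_int_mult power_int_numeral)
  have 1: "(\<Sum>i=1..N. (n + n' + k * m') i * m'' i) = B + C + E"
    by (simp add: A_def B_def C_def E_def sum.distrib algebra_simps)
  have 2: "(\<Sum>i=1..N. (k + k') i * (m'' i)\<^sup>2) = b + c"
    by (simp add: b_def c_def sum.distrib algebra_simps)
  have 3: "(\<Sum>i=1..N. n i * (m' + m'') i) = A + B"
    by (simp add: A_def B_def sum.distrib algebra_simps)
  have 4: "(\<Sum>i=1..N. k i * ((m' + m'') i)\<^sup>2) = a + b + 2 * E"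
    by (simp add: a_def b_def E_def sum.distrib sum_distrib_left algebra_simps power2_eq_square)
  have "mon_cocycle q s N x y * mon_cocycle q s N (mon_mult x y) z =
     s powi (2 * A) * s powi a * (s powi (2 * (B + C + E)) * s powi (b + c))"
    unfolding x y z mon_mult.simps mon_cocycle.simps 1 2 A_def[symmetric] a_def[symmetric] q ..
  also have "\<dots> = s powi (2 * A + a + (2 * (B + C + E) + (b + c)))"
    using s0 by (simp add: power_int_add)
  also have "\<dots> = s powi ((2 * C + c) + (2 * (A + B) + (a + b + 2 * E)))"
    by (simp add: algebra_simps)
  also have "\<dots> = s powi (2 * C) * s powi c * (s powi (2 * (A + B)) * s powi (a + b + 2 * E))"
    using s0 by (simp add: power_int_add)
  also have "\<dots> = mon_cocycle q s N y z * mon_cocycle q s N x (mon_mult y z)"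
    unfolding x y z mon_mult.simps mon_cocycle.simps 3 4 C_def[symmetric] c_def[symmetric] q ..
  finally show ?thesis .
qed

lemma series_carrier_subset:
  assumes "f \<in> series_carrier N" "h \<in> series_carrier N" "supp g \<subseteq> supp f \<union> supp h"
  shows "g \<in> series_carrier N"
proof (rule series_carrierI)
  show "supported_on N x" if "x \<in> supp g" for x
    using that assms unfolding series_carrier_iff by blast
  show "finite {x \<in> supp g. fst x = m}" for m
  proof (rule finite_subset)
    show "{x \<in> supp g. fst x = m} \<subseteq> {x \<in> supp f. fst x = m} \<union> {x \<in> supp h. fst x = m}"
      using assms(3) by auto
    show "finite ({x \<in> supp f. fst x = m} \<union> {x \<in> supp h. fst x = m})"
      using assms(1,2) unfolding series_carrier_iff by blast
  qed
  obtain F where F: "finite F" "\<And>x. x\<in>supp f \<Longrightarrow> \<exists>m0\<in>F. \<exists>c\<in>root_cone N. fst x = m0 + c"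
    using assms(1) unfolding series_carrier_iff cone_bounded_def by blast
  obtain F' where F': "finite F'" "\<And>x. x\<in>supp h \<Longrightarrow> \<exists>m0\<in>F'. \<exists>c\<in>root_cone N. fst x = m0 + c"
    using assms(2) unfolding series_carrier_iff cone_bounded_def by blast
  show "cone_bounded N g"
    unfolding cone_bounded_def using F F' assms(3)
    by (intro exI[of _ "F \<union> F'"]) blast
qed

section \<open>The completed algebra\<close>

locale toda =
  fixes q s :: complex and N :: nat and R (structure)
  assumes q_nonzero: "q \<noteq> 0" and norm_q: "norm q < 1" and s_square: "s\<^sup>2 = q"
  defines R_def: "R \<equiv> series_alg q s N"
begin

lemma s_nonzero: "s \<noteq> 0"
  using q_nonzero s_square by auto

lemma q_powi: "q powi t = s powi (2 * t)"
  using s_square by (metis power_int_mult power_int_numeral)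

abbreviation \<kappa> :: "mon \<Rightarrow> mon \<Rightarrow> complex" where "\<kappa> \<equiv> mon_cocycle q s N"

lemma carrier_eq: "carrier R = series_carrier N"
  by (simp add: R_def series_alg_def)

lemma mult_eq: "(f \<otimes> h) x =
    (\<Sum>(y, z)\<in>{(y, z). y \<in> supp f \<and> z \<in> supp h \<and> mon_mult y z = x}. \<kappa> y z * f y * h z)"
  by (simp add: R_def series_alg_def)

lemma one_eq: "\<one> = basis (0, 0, 0)"
  by (simp add: R_def series_alg_def)

lemma zero_eq: "\<zero> = (\<lambda>_. 0)"
  by (simp add: R_def series_alg_def)

lemma add_apply [simp]: "(f \<oplus> h) x = f x + h x"
  by (simp add: R_def series_alg_def)

lemma smult_apply [simp]: "(c \<odot> f) x = c * f x"
  by (simp add: R_def series_alg_def)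

lemma zero_apply [simp]: "\<zero> x = 0"
  by (simp add: zero_eq)

lemma supp_zero [simp]: "supp \<zero> = {}"
  by (simp add: supp_def)

lemma supp_one [simp]: "supp \<one> = {(0, 0, 0)}"
  by (simp add: one_eq)

text \<open>The convolution may be summed over any finite set of factorizations of x that contains
  the contributing ones, so that sums for different factors can share one index set.\<close>

lemma mult_eq_sum:
  assumes "finite P" "\<And>y z. y \<in> supp f \<Longrightarrow> z \<in> supp h \<Longrightarrow> mon_mult y z = x \<Longrightarrow> (y, z) \<in> P"
    "\<And>y z. (y, z) \<in> P \<Longrightarrow> mon_mult y z = x"
  shows "(f \<otimes> h) x = (\<Sum>(y, z)\<in>P. \<kappa> y z * f y * h z)"
  unfolding mult_eq
proof (rule sum.mono_neutral_left[OF assms(1)])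
  show "{(y, z). y \<in> supp f \<and> z \<in> supp h \<and> mon_mult y z = x} \<subseteq> P"
    using assms(2) by blast
  show "\<forall>p\<in>P - {(y, z). y \<in> supp f \<and> z \<in> supp h \<and> mon_mult y z = x}.
      (case p of (y, z) \<Rightarrow> \<kappa> y z * f y * h z) = 0"
    using assms(3) unfolding supp_def by (auto simp del: mon_mult.simps mon_cocycle.simps)
qed

text \<open>With a single factorization available inside the supports, the coefficient is a single
  product. This isolates extremal terms: lowest \<Lambda>-exponents for the commutant of g, leading
  T-exponents for algebraic independence.\<close>

lemma mult_single:
  assumes "\<And>y z. y \<in> supp f \<Longrightarrow> z \<in> supp h \<Longrightarrow> mon_mult y z = mon_mult y0 z0 \<Longrightarrow> y = y0 \<and> z = z0"
  shows "(f \<otimes> h) (mon_mult y0 z0) = \<kappa> y0 z0 * f y0 * h z0"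
  by (subst mult_eq_sum[of "{(y0, z0)}"]) (use assms in auto)

lemma basis_mult_left: "(basis x \<otimes> f) (mon_mult x z) = \<kappa> x z * f z"
proof -
  have "(basis x \<otimes> f) (mon_mult x z) = \<kappa> x z * basis x x * f z"
    by (rule mult_single) (simp_all only: supp_basis singleton_iff mon_mult_left_cancel)
  then show ?thesis by (simp add: basis_def)
qed

lemma basis_mult_right: "(f \<otimes> basis x) (mon_mult z x) = \<kappa> z x * f z"
proof -
  have "(f \<otimes> basis x) (mon_mult z x) = \<kappa> z x * f z * basis x x"
    by (rule mult_single) (simp_all only: supp_basis singleton_iff mon_mult_right_cancel)
  then show ?thesis by (simp add: basis_def)
qed

lemma supp_mult: "x \<in> supp (f \<otimes> h) \<Longrightarrow> \<exists>y\<in>supp f. \<exists>z\<in>supp h. x = mon_mult y z"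
  unfolding supp_def[of "f \<otimes> h"] mem_Collect_eq mult_eq
  by (erule sum.not_neutral_contains_not_neutral) blast

lemma basis_mult_basis: "basis x \<otimes> basis y = \<kappa> x y \<odot> basis (mon_mult x y)"
proof (rule ext)
  fix w
  show "(basis x \<otimes> basis y) w = (\<kappa> x y \<odot> basis (mon_mult x y)) w"
  proof (cases "w = mon_mult x y")
    case True
    then show ?thesis by (simp add: basis_mult_left) (simp add: basis_def)
  next
    case False
    then have "w \<notin> supp (basis x \<otimes> basis y)"
      using supp_mult by fastforce
    with False show ?thesis
      by (simp add: supp_def basis_def)
  qed
qed

lemma series_add_closed: "f \<in> series_carrier N \<Longrightarrow> h \<in> series_carrier N \<Longrightarrow> f \<oplus> h \<in> series_carrier N"
  by (rule series_carrier_subset[of f N h]) (auto simp: supp_def)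

lemma smult_closed [intro, simp]: "f \<in> carrier R \<Longrightarrow> c \<odot> f \<in> carrier R"
  unfolding carrier_eq by (rule series_carrier_subset[of f N f]) (auto simp: supp_def)

lemma basis_closed: "supported_on N x \<Longrightarrow> basis x \<in> carrier R"
  unfolding carrier_eq by (rule series_carrier_finite) auto

lemma series_mult_closed:
  assumes "f \<in> series_carrier N" "h \<in> series_carrier N"
  shows "f \<otimes> h \<in> series_carrier N"
proof (rule series_carrierI)
  show "supported_on N x" if "x \<in> supp (f \<otimes> h)" for x
    using supp_mult[OF that] assms supported_on_mult unfolding series_carrier_iff by blast
  show "finite {x \<in> supp (f \<otimes> h). fst x = m}" for m
  proof (rule finite_subset)
    show "{x \<in> supp (f \<otimes> h). fst x = m} \<subseteq> (\<lambda>(y, z). mon_mult y z) `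
        {(y, z). y \<in> supp f \<and> z \<in> supp h \<and> height N (fst (mon_mult y z)) \<le> height N m}"
    proof
      fix x assume x: "x \<in> {x \<in> supp (f \<otimes> h). fst x = m}"
      then obtain y z where "y \<in> supp f" "z \<in> supp h" "x = mon_mult y z"
        using supp_mult by blast
      then show "x \<in> (\<lambda>(y, z). mon_mult y z) `
        {(y, z). y \<in> supp f \<and> z \<in> supp h \<and> height N (fst (mon_mult y z)) \<le> height N m}"
        using x by (intro image_eqI[of _ _ "(y, z)"]) auto
    qed
    show "finite ((\<lambda>(y, z). mon_mult y z) `
        {(y, z). y \<in> supp f \<and> z \<in> supp h \<and> height N (fst (mon_mult y z)) \<le> height N m})"
      by (intro finite_imageI finite_pairs_le assms)
  qed
  obtain F where F: "finite F" "\<And>x. x\<in>supp f \<Longrightarrow> \<exists>m0\<in>F. \<exists>c\<in>root_cone N. fst x = m0 + c"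
    using assms(1) unfolding series_carrier_iff cone_bounded_def by blast
  obtain F' where F': "finite F'" "\<And>x. x\<in>supp h \<Longrightarrow> \<exists>m0\<in>F'. \<exists>c\<in>root_cone N. fst x = m0 + c"
    using assms(2) unfolding series_carrier_iff cone_bounded_def by blast
  have "\<exists>m0\<in>(\<lambda>(a, b). a + b) ` (F \<times> F'). \<exists>c\<in>root_cone N. fst x = m0 + c"
    if "x \<in> supp (f \<otimes> h)" for x
  proof -
    obtain y z where yz: "y \<in> supp f" "z \<in> supp h" "x = mon_mult y z"
      using supp_mult \<open>x \<in> supp (f \<otimes> h)\<close> by blast
    obtain m0 c where 1: "m0 \<in> F" "c \<in> root_cone N" "fst y = m0 + c"
      using F(2) yz(1) by blast
    obtain m0' c' where 2: "m0' \<in> F'" "c' \<in> root_cone N" "fst z = m0' + c'"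
      using F'(2) yz(2) by blast
    have "fst x = (m0 + m0') + (c + c')"
      unfolding yz(3) fst_mon_mult 1(3) 2(3) by (simp add: algebra_simps)
    moreover have "m0 + m0' \<in> (\<lambda>(a, b). a + b) ` (F \<times> F')"
      using 1(1) 2(1) by (intro image_eqI[of _ _ "(m0, m0')"]) auto
    ultimately show ?thesis
      using root_cone_add[OF 1(2) 2(2)] by blast
  qed
  then show "cone_bounded N (f \<otimes> h)"
    unfolding cone_bounded_def using F(1) F'(1)
    by (intro exI[of _ "(\<lambda>(a, b). a + b) ` (F \<times> F')"]) auto
qed

text \<open>Both bracketings become sums over the same set of triples, after which associativity is
  the cocycle identity in each term. Here the triples are grouped by the pair (yz, w): the fibre
  over (u, w) is the set of factorizations of u.\<close>

lemma mult_assoc_sum: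
  assumes "f \<in> series_carrier N" "h \<in> series_carrier N" "g \<in> series_carrier N"
  shows "((f \<otimes> h) \<otimes> g) x = (\<Sum>(y, z, w)\<in>{(y, z, w). y \<in> supp f \<and> z \<in> supp h \<and> w \<in> supp g \<and>
           mon_mult (mon_mult y z) w = x}. \<kappa> (mon_mult y z) w * (\<kappa> y z * f y * h z) * g w)"
    (is "_ = sum _ ?T")
proof -
  have fin: "finite ?T"
    by (rule finite_triples[OF assms])
  let ?p = "\<lambda>(y, z, w). (mon_mult y z, w)"
  have "((f \<otimes> h) \<otimes> g) x = (\<Sum>(u, w)\<in>?p ` ?T. \<kappa> u w * (f \<otimes> h) u * g w)"
  proof (rule mult_eq_sum)
    show "finite (?p ` ?T)"
      using fin by simp
    show "(u, w) \<in> ?p ` ?T" if "u \<in> supp (f \<otimes> h)" "w \<in> supp g" "mon_mult u w = x" for u w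
      using supp_mult[OF that(1)] that(2,3) by force
  qed auto
  also have "\<dots> = (\<Sum>v\<in>?p ` ?T. \<Sum>t\<in>{t\<in>?T. ?p t = v}.
      (case t of (y, z, w) \<Rightarrow> \<kappa> (mon_mult y z) w * (\<kappa> y z * f y * h z) * g w))"
  proof (rule sum.cong[OF refl])
    fix v assume v: "v \<in> ?p ` ?T"
    obtain u w where uw: "v = (u, w)" by (cases v)
    with v have w: "w \<in> supp g" "mon_mult u w = x" by auto
    have "(\<Sum>t\<in>{t\<in>?T. ?p t = v}.
        (case t of (y, z, w) \<Rightarrow> \<kappa> (mon_mult y z) w * (\<kappa> y z * f y * h z) * g w)) =
      (\<Sum>(y, z)\<in>{(y, z). y \<in> supp f \<and> z \<in> supp h \<and> mon_mult y z = u}.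
         \<kappa> u w * (\<kappa> y z * f y * h z) * g w)"
      by (rule sum.reindex_bij_witness[where i = "\<lambda>(y, z). (y, z, w)" and j = "\<lambda>(y, z, w). (y, z)"])
        (use w in \<open>auto simp: uw simp del: mon_mult.simps\<close>)
    also have "\<dots> = \<kappa> u w * (f \<otimes> h) u * g w"
      unfolding mult_eq by (simp add: sum_distrib_left sum_distrib_right split_beta)
    finally show "(case v of (u, w) \<Rightarrow> \<kappa> u w * (f \<otimes> h) u * g w) = (\<Sum>t\<in>{t\<in>?T. ?p t = v}.
        (case t of (y, z, w) \<Rightarrow> \<kappa> (mon_mult y z) w * (\<kappa> y z * f y * h z) * g w))"
      by (simp add: uw)
  qed
  also have "\<dots> = (\<Sum>(y, z, w)\<in>?T. \<kappa> (mon_mult y z) w * (\<kappa> y z * f y * h z) * g w)"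
    by (rule sum.image_gen[OF fin, symmetric])
  finally show ?thesis .
qed

lemma mult_assoc_sum_right:
  assumes "f \<in> series_carrier N" "h \<in> series_carrier N" "g \<in> series_carrier N"
  shows "(f \<otimes> (h \<otimes> g)) x = (\<Sum>(y, z, w)\<in>{(y, z, w). y \<in> supp f \<and> z \<in> supp h \<and> w \<in> supp g \<and>
           mon_mult (mon_mult y z) w = x}. \<kappa> y (mon_mult z w) * f y * (\<kappa> z w * h z * g w))"
    (is "_ = sum _ ?T")
proof -
  have fin: "finite ?T"
    by (rule finite_triples[OF assms])
  let ?p = "\<lambda>(y, z, w). (y, mon_mult z w)"
  have "(f \<otimes> (h \<otimes> g)) x = (\<Sum>(y, u)\<in>?p ` ?T. \<kappa> y u * f y * (h \<otimes> g) u)"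
  proof (rule mult_eq_sum)
    show "finite (?p ` ?T)"
      using fin by simp
    show "(y, u) \<in> ?p ` ?T" if "y \<in> supp f" "u \<in> supp (h \<otimes> g)" "mon_mult y u = x" for y u
      using supp_mult[OF that(2)] that(1,3) by (force simp: mon_mult_assoc simp del: mon_mult.simps)
  qed (auto simp: mon_mult_assoc simp del: mon_mult.simps)
  also have "\<dots> = (\<Sum>v\<in>?p ` ?T. \<Sum>t\<in>{t\<in>?T. ?p t = v}.
      (case t of (y, z, w) \<Rightarrow> \<kappa> y (mon_mult z w) * f y * (\<kappa> z w * h z * g w)))"
  proof (rule sum.cong[OF refl])
    fix v assume v: "v \<in> ?p ` ?T"
    obtain y u where uw: "v = (y, u)" by (cases v)
    with v have w: "y \<in> supp f" "mon_mult y u = x"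
      by (auto simp: mon_mult_assoc simp del: mon_mult.simps)
    have "(\<Sum>t\<in>{t\<in>?T. ?p t = v}.
        (case t of (y, z, w) \<Rightarrow> \<kappa> y (mon_mult z w) * f y * (\<kappa> z w * h z * g w))) =
      (\<Sum>(z, w)\<in>{(z, w). z \<in> supp h \<and> w \<in> supp g \<and> mon_mult z w = u}.
         \<kappa> y u * f y * (\<kappa> z w * h z * g w))"
      by (rule sum.reindex_bij_witness[where i = "\<lambda>(z, w). (y, z, w)" and j = "\<lambda>(y, z, w). (z, w)"])
        (use w in \<open>auto simp: uw mon_mult_assoc simp del: mon_mult.simps\<close>)
    also have "\<dots> = \<kappa> y u * f y * (h \<otimes> g) u"
      unfolding mult_eq by (simp add: sum_distrib_left sum_distrib_right split_beta)
    finally show "(case v of (y, u) \<Rightarrow> \<kappa> y u * f y * (h \<otimes> g) u) = (\<Sum>t\<in>{t\<in>?T. ?p t = v}.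
        (case t of (y, z, w) \<Rightarrow> \<kappa> y (mon_mult z w) * f y * (\<kappa> z w * h z * g w)))"
      by (simp add: uw)
  qed
  also have "\<dots> = (\<Sum>(y, z, w)\<in>?T. \<kappa> y (mon_mult z w) * f y * (\<kappa> z w * h z * g w))"
    by (rule sum.image_gen[OF fin, symmetric])
  finally show ?thesis .
qed

lemma series_mult_assoc:
  assumes "f \<in> series_carrier N" "h \<in> series_carrier N" "g \<in> series_carrier N"
  shows "(f \<otimes> h) \<otimes> g = f \<otimes> (h \<otimes> g)"
proof (rule ext)
  fix x
  have "\<kappa> (mon_mult y z) w * (\<kappa> y z * f y * h z) * g w = \<kappa> y (mon_mult z w) * f y * (\<kappa> z w * h z * g w)"
    for y z w
  proof -
    have "\<kappa> (mon_mult y z) w * (\<kappa> y z * f y * h z) * g w = (\<kappa> y z * \<kappa> (mon_mult y z) w) * (f y * h z * g w)"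
      by (simp only: mult.commute mult.left_commute mult.assoc)
    also have "\<dots> = \<kappa> y (mon_mult z w) * f y * (\<kappa> z w * h z * g w)"
      unfolding mon_cocycle_assoc[OF q_nonzero s_square] by (simp only: mult.commute mult.left_commute mult.assoc)
    finally show ?thesis .
  qed
  then show "((f \<otimes> h) \<otimes> g) x = (f \<otimes> (h \<otimes> g)) x"
    unfolding mult_assoc_sum[OF assms] mult_assoc_sum_right[OF assms] by (simp only:)
qed

lemma distr_left:
  assumes "f \<in> series_carrier N" "g \<in> series_carrier N" "h \<in> series_carrier N"
  shows "(f \<oplus> g) \<otimes> h = f \<otimes> h \<oplus> g \<otimes> h"
proof (rule ext)
  fix x
  let ?P = "{(y, z). y \<in> supp f \<and> z \<in> supp h \<and> mon_mult y z = x} \<union>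
    {(y, z). y \<in> supp g \<and> z \<in> supp h \<and> mon_mult y z = x}"
  have fin: "finite ?P"
    by (intro finite_UnI finite_pairs[OF assms(1,3)] finite_pairs[OF assms(2,3)])
  have "((f \<oplus> g) \<otimes> h) x = (\<Sum>(y, z)\<in>?P. \<kappa> y z * (f \<oplus> g) y * h z)"
    by (intro mult_eq_sum fin) (auto simp: supp_def simp del: mon_mult.simps)
  moreover have "(f \<otimes> h) x = (\<Sum>(y, z)\<in>?P. \<kappa> y z * f y * h z)"
    by (intro mult_eq_sum fin) auto
  moreover have "(g \<otimes> h) x = (\<Sum>(y, z)\<in>?P. \<kappa> y z * g y * h z)"
    by (intro mult_eq_sum fin) auto
  ultimately show "((f \<oplus> g) \<otimes> h) x = (f \<otimes> h \<oplus> g \<otimes> h) x"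
    by (simp add: sum.distrib[symmetric] split_beta algebra_simps del: mon_mult.simps)
qed

lemma distr_right:
  assumes "f \<in> series_carrier N" "g \<in> series_carrier N" "h \<in> series_carrier N"
  shows "h \<otimes> (f \<oplus> g) = h \<otimes> f \<oplus> h \<otimes> g"
proof (rule ext)
  fix x
  let ?P = "{(y, z). y \<in> supp h \<and> z \<in> supp f \<and> mon_mult y z = x} \<union>
    {(y, z). y \<in> supp h \<and> z \<in> supp g \<and> mon_mult y z = x}"
  have fin: "finite ?P"
    by (intro finite_UnI finite_pairs[OF assms(3,1)] finite_pairs[OF assms(3,2)])
  have "(h \<otimes> (f \<oplus> g)) x = (\<Sum>(y, z)\<in>?P. \<kappa> y z * h y * (f \<oplus> g) z)"
    by (intro mult_eq_sum fin) (auto simp: supp_def simp del: mon_mult.simps)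
  moreover have "(h \<otimes> f) x = (\<Sum>(y, z)\<in>?P. \<kappa> y z * h y * f z)"
    by (intro mult_eq_sum fin) auto
  moreover have "(h \<otimes> g) x = (\<Sum>(y, z)\<in>?P. \<kappa> y z * h y * g z)"
    by (intro mult_eq_sum fin) auto
  ultimately show "(h \<otimes> (f \<oplus> g)) x = (h \<otimes> f \<oplus> h \<otimes> g) x"
    by (simp add: sum.distrib[symmetric] split_beta algebra_simps del: mon_mult.simps)
qed

lemma one_mult_left: "\<one> \<otimes> f = f"
proof (rule ext)
  show "(\<one> \<otimes> f) x = f x" for x
    using basis_mult_left[of "(0, 0, 0)" f x] by (simp add: one_eq)
qed

lemma one_mult_right: "f \<otimes> \<one> = f"
proof (rule ext)
  show "(f \<otimes> \<one>) x = f x" for x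
    using basis_mult_right[of f "(0, 0, 0)" x] by (simp add: one_eq)
qed

lemma series_zero_closed: "\<zero> \<in> series_carrier N"
  by (rule series_carrier_finite) auto

lemma series_one_closed: "\<one> \<in> series_carrier N"
  using basis_closed[of "(0, 0, 0)"] by (simp add: one_eq carrier_eq supported_on_def)

lemma ring_R: "ring R"
proof (rule ringI)
  show "abelian_group R"
  proof (rule abelian_groupI, unfold carrier_eq)
    show "\<exists>g\<in>series_carrier N. g \<oplus> f = \<zero>" if "f \<in> series_carrier N" for f
      using smult_closed[of f "-1"] that
      by (intro bexI[of _ "(-1) \<odot> f"]) (auto simp: fun_eq_iff carrier_eq)
  qed (auto simp: series_add_closed series_zero_closed fun_eq_iff)
  show "monoid R"
    by (rule monoidI)
      (auto simp: carrier_eq series_mult_closed series_one_closed series_mult_assoc one_mult_left one_mult_right)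
qed (auto simp: carrier_eq distr_left distr_right)

end

sublocale toda \<subseteq> ring R
  by (rule ring_R)

context toda begin

text \<open>Ring subtraction is defined through the abstract additive inverse; its values follow
  from (f - h) + h = f.\<close>

lemma diff_series_apply:
  assumes "f \<in> carrier R" "h \<in> carrier R"
  shows "(f \<ominus> h) x = f x - h x"
proof -
  have "(f \<ominus> h) \<oplus> h = f"
    using assms by (simp add: a_minus_def a_assoc l_neg)
  then have "((f \<ominus> h) \<oplus> h) x = f x"
    by simp
  then show ?thesis by (simp add: eq_diff_eq)
qed

lemma smult_mult_left:
  assumes "f \<in> carrier R" "h \<in> carrier R"
  shows "(c \<odot> f) \<otimes> h = c \<odot> (f \<otimes> h)"
proof (rule ext)
  fix x
  have fin: "finite {(y, z). y \<in> supp f \<and> z \<in> supp h \<and> mon_mult y z = x}"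
    using finite_pairs assms unfolding carrier_eq .
  show "((c \<odot> f) \<otimes> h) x = (c \<odot> (f \<otimes> h)) x"
    by (subst mult_eq_sum[OF fin])
      (auto simp: supp_def mult_eq sum_distrib_left split_beta mult_ac simp del: mon_mult.simps)
qed

lemma smult_mult_right:
  assumes "f \<in> carrier R" "h \<in> carrier R"
  shows "f \<otimes> (c \<odot> h) = c \<odot> (f \<otimes> h)"
proof (rule ext)
  fix x
  have fin: "finite {(y, z). y \<in> supp f \<and> z \<in> supp h \<and> mon_mult y z = x}"
    using finite_pairs assms unfolding carrier_eq .
  show "(f \<otimes> (c \<odot> h)) x = (c \<odot> (f \<otimes> h)) x"
    by (subst mult_eq_sum[OF fin])
      (auto simp: supp_def mult_eq sum_distrib_left split_beta mult_ac simp del: mon_mult.simps)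
qed

lemma smult_smult [simp]: "c \<odot> (d \<odot> f) = (c * d) \<odot> f"
  by (simp add: fun_eq_iff)

lemma smult_1 [simp]: "1 \<odot> f = f"
  by (simp add: fun_eq_iff)

lemma smult_minus:
  "f \<in> carrier R \<Longrightarrow> h \<in> carrier R \<Longrightarrow> c \<odot> (f \<ominus> h) = c \<odot> f \<ominus> c \<odot> h"
  by (simp add: fun_eq_iff diff_series_apply right_diff_distrib)

lemma finsum_apply:
  assumes "\<And>a. a \<in> A \<Longrightarrow> f a \<in> carrier R"
  shows "finsum R f A x = (\<Sum>a\<in>A. f a x)"
  using assms
proof (induction A rule: infinite_finite_induct)
  case (insert a A)
  then show ?case by (subst finsum_insert) auto
qed auto

end

section \<open>Ordered products and the quantum dilogarithm\<close>

lemma (in monoid) ord_prod_0 [simp]: "ord_prod G 0 f = \<one>"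
  by (simp add: ord_prod_def)

lemma (in monoid) foldr_mult:
  assumes "\<And>i. i \<in> set xs \<Longrightarrow> f i \<in> carrier G" "z \<in> carrier G"
  shows "foldr (\<lambda>i P. f i \<otimes> P) xs z = foldr (\<lambda>i P. f i \<otimes> P) xs \<one> \<otimes> z \<and>
    foldr (\<lambda>i P. f i \<otimes> P) xs \<one> \<in> carrier G"
  using assms(1) by (induction xs) (use assms(2) in \<open>auto simp: m_assoc\<close>)

lemma (in monoid) ord_prod_closed [intro, simp]:
  "(\<And>i. i \<in> {1..n} \<Longrightarrow> f i \<in> carrier G) \<Longrightarrow> ord_prod G n f \<in> carrier G"
  unfolding ord_prod_def using foldr_mult[of "[1..<Suc n]" f \<one>] by (simp del: upt_Suc)

lemma (in monoid) ord_prod_Suc: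
  assumes "\<And>i. i \<in> {1..Suc n} \<Longrightarrow> f i \<in> carrier G"
  shows "ord_prod G (Suc n) f = ord_prod G n f \<otimes> f (Suc n)"
proof -
  have "ord_prod G (Suc n) f = foldr (\<lambda>i P. f i \<otimes> P) [1..<Suc n] (f (Suc n))"
    using assms by (simp add: ord_prod_def)
  also have "\<dots> = foldr (\<lambda>i P. f i \<otimes> P) [1..<Suc n] \<one> \<otimes> f (Suc n)"
    using assms by (intro foldr_mult[THEN conjunct1]) auto
  finally show ?thesis
    by (simp only: ord_prod_def)
qed

lemma ord_prod_cong:
  "(\<And>i. i \<in> {1..n} \<Longrightarrow> f i = g i) \<Longrightarrow> ord_prod G n f = ord_prod G n g"
  unfolding ord_prod_def by (intro foldr_cong) auto

text \<open>Index i of the Hamiltonian belongs to the ratio \<Lambda>_i/\<Lambda>_(i-1), which is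
  numbered i - 1 among the ratios; splitting off the factor i = 1 aligns the two numberings.\<close>

lemma ord_prod_shift:
  "ord_prod G (Suc n) f = f 1 \<otimes>\<^bsub>G\<^esub> ord_prod G n (\<lambda>i. f (Suc i))"
proof -
  have *: "[1..<Suc (Suc n)] = 1 # map Suc [1..<Suc n]"
    by (simp only: map_Suc_upt) (simp add: upt_conv_Cons)
  show ?thesis
    unfolding ord_prod_def * by (simp add: foldr_map o_def del: upt_Suc)
qed

text \<open>Substitution of cX for X. This is what happens to a series in
  \<Lambda>_(a+1)/\<Lambda>_a when a monomial in the T's moves past it.\<close>

definition fps_scale :: "complex \<Rightarrow> complex fps \<Rightarrow> complex fps" where
  "fps_scale c F = Abs_fps (\<lambda>j. c ^ j * fps_nth F j)"

lemma fps_nth_mult_linear: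
  "fps_nth (F * (1 - fps_const c * fps_X)) j =
     fps_nth F j - (if j = 0 then 0 else c * fps_nth F (j - 1))" for F :: "complex fps"
proof -
  have "F * (1 - fps_const c * fps_X) = F - fps_const c * (fps_X * F)"
    by (simp add: algebra_simps)
  then show ?thesis by simp
qed

text \<open>The q-binomial theorem: the coefficients are (q^M; q)_j / (q; q)_j, with the denominator
  cleared. The product for M is the one for M + 1 times 1 - q^M X, and an inner induction on j
  solves this relation for the longer product.\<close>

lemma qdilog_partial_product:
  fixes q :: complex
  assumes "norm q < 1"
  shows "fps_nth (\<Prod>n<M. inverse (1 - fps_const (q ^ n) * fps_X)) j * (\<Prod>i=1..j. 1 - q ^ i) =
         (\<Prod>i<j. 1 - q ^ (M + i))"
proof (induction M arbitrary: j)
  case 0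
  show ?case
  proof (cases j)
    case (Suc i)
    \<comment> \<open>For M = 0 and j > 0 the factor i = 0 on the right is 1 - q^0 = 0.\<close>
    then have "0 \<in> {..<j}" by simp
    then have "(\<Prod>i<j. 1 - q ^ (0 + i)) = 0"
      by (metis (no_types, lifting) add_0 diff_self finite_lessThan power_0 prod_zero)
    with Suc show ?thesis by simp
  qed simp
next
  case (Suc M)
  define P where "P = (\<lambda>M. \<Prod>n<M. inverse (1 - fps_const (q ^ n) * fps_X))"
  have P_eq: "(\<Prod>n<M. inverse (1 - fps_const (q ^ n) * fps_X)) = P M" for M
    by (simp add: P_def)
  have "P (Suc M) * (1 - fps_const (q ^ M) * fps_X) =
     P M * (inverse (1 - fps_const (q ^ M) * fps_X) * (1 - fps_const (q ^ M) * fps_X))"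
    by (simp add: P_def mult.assoc)
  also have "\<dots> = P M"
    by (subst inverse_mult_eq_1) auto
  finally have rec: "P M = P (Suc M) * (1 - fps_const (q ^ M) * fps_X)" ..
  show ?case
    unfolding P_eq
  proof (induction j)
    case 0
    have "fps_nth (P M) 0 = 1"
      using Suc.IH[of 0] by (simp add: P_def)
    moreover have "fps_nth (P M) 0 = fps_nth (P (Suc M)) 0"
      by (subst rec, subst fps_nth_mult_linear) simp
    ultimately show ?case by simp
  next
    case (Suc j)
    have PM: "fps_nth (P M) (Suc j) = fps_nth (P (Suc M)) (Suc j) - q ^ M * fps_nth (P (Suc M)) j"
      by (subst rec, subst fps_nth_mult_linear) simp
    have "fps_nth (P (Suc M)) (Suc j) * (\<Prod>i=1..Suc j. 1 - q ^ i) =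
        fps_nth (P M) (Suc j) * (\<Prod>i=1..Suc j. 1 - q ^ i) +
        q ^ M * (1 - q ^ Suc j) * (fps_nth (P (Suc M)) j * (\<Prod>i=1..j. 1 - q ^ i))"
      unfolding PM by (simp add: algebra_simps)
    also have "\<dots> = (\<Prod>i<Suc j. 1 - q ^ (M + i)) +
        q ^ M * (1 - q ^ Suc j) * (\<Prod>i<j. 1 - q ^ (Suc M + i))"
      using Suc.IH \<open>\<And>j. fps_nth _ j * _ = _\<close>[of "Suc j"] by (simp only: P_def)
    also have "(\<Prod>i<Suc j. 1 - q ^ (M + i)) = (1 - q ^ M) * (\<Prod>i<j. 1 - q ^ (Suc M + i))"
      by (subst prod.lessThan_Suc_shift) simp
    \<comment> \<open>Here (1 - q^M) + q^M (1 - q^(j+1)) = 1 - q^(M+j+1).\<close>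
    also have "(1 - q ^ M) * (\<Prod>i<j. 1 - q ^ (Suc M + i)) + q ^ M * (1 - q ^ Suc j) * (\<Prod>i<j. 1 - q ^ (Suc M + i)) =
      (\<Prod>i<j. 1 - q ^ (Suc M + i)) * (1 - q ^ (Suc M + j))"
      by (simp add: algebra_simps power_add)
    finally show ?case
      by simp
  qed
qed

lemma power_norm_less_1:
  fixes q :: complex
  assumes "norm q < 1" "0 < i"
  shows "1 - q ^ i \<noteq> 0"
proof
  assume "1 - q ^ i = 0"
  then have "norm q ^ i = 1"
    by (metis eq_iff_diff_eq_0 norm_one norm_power)
  moreover have "norm q ^ i < 1"
    using assms by (simp add: power_less_one_iff)
  ultimately show False by simp
qed

text \<open>Euler's expansion of 1/(X; q)_\<infinity>: since |q| < 1, the numerators (q^M; q)_j tend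
  to 1 and the denominators do not vanish.\<close>

lemma qdilog_nth:
  fixes q :: complex
  assumes "norm q < 1"
  shows "fps_nth (qdilog q) j = inverse (\<Prod>i=1..j. 1 - q ^ i)"
proof -
  have nz: "(\<Prod>i=1..j. 1 - q ^ i) \<noteq> 0"
    using power_norm_less_1[OF assms] by simp
  have "(\<lambda>M. \<Prod>i<j. 1 - q ^ (M + i)) \<longlonglongrightarrow> (\<Prod>i<j. 1 - 0)"
  proof (intro tendsto_prod tendsto_diff tendsto_const)
    show "(\<lambda>M. q ^ (M + i)) \<longlonglongrightarrow> 0" for i
      using LIMSEQ_power_zero[OF assms] by (rule LIMSEQ_ignore_initial_segment)
  qed
  then have "(\<lambda>M. (\<Prod>i<j. 1 - q ^ (M + i)) * inverse (\<Prod>i=1..j. 1 - q ^ i)) \<longlonglongrightarrow>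
      1 * inverse (\<Prod>i=1..j. 1 - q ^ i)"
    by (intro tendsto_mult tendsto_const) simp
  moreover have "fps_nth (\<Prod>n<M. inverse (1 - fps_const (q ^ n) * fps_X)) j =
      (\<Prod>i<j. 1 - q ^ (M + i)) * inverse (\<Prod>i=1..j. 1 - q ^ i)" for M
    unfolding qdilog_partial_product[OF assms, of M j, symmetric] using nz by simp
  ultimately show ?thesis
    unfolding qdilog_def by (simp add: limI)
qed

lemma qdilog_nth_Suc:
  fixes q :: complex
  assumes "norm q < 1"
  shows "fps_nth (qdilog q) (Suc j) * (1 - q ^ Suc j) = fps_nth (qdilog q) j"
  using power_norm_less_1[OF assms, of "Suc j"] by (simp add: qdilog_nth[OF assms])

lemma qdilog_0 [simp]: "norm q < 1 \<Longrightarrow> fps_nth (qdilog q) 0 = 1"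
  by (simp add: qdilog_nth)

text \<open>Replacing X by qX removes the factor n = 0 of the infinite product, that is, multiplies
  by 1 - X. On coefficients this reads c_j - c_(j-1) = q^j c_j.\<close>

lemma qdilog_scale:
  assumes "norm q < 1"
  shows "qdilog q * (1 - fps_X) = fps_scale q (qdilog q)"
proof (rule fps_ext)
  fix j
  show "fps_nth (qdilog q * (1 - fps_X)) j = fps_nth (fps_scale q (qdilog q)) j"
    using fps_nth_mult_linear[of "qdilog q" 1 j] qdilog_nth_Suc[OF assms, of "j - 1"]
    by (cases j) (auto simp: fps_scale_def algebra_simps)
qed

text \<open>The same functional equation, taken at X/q.\<close>

lemma qdilog_scale_inverse:
  assumes "norm q < 1" "q \<noteq> 0"
  shows "(1 - fps_const (inverse q) * fps_X) * fps_scale (inverse q) (qdilog q) = qdilog q"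
proof (rule fps_ext)
  fix j
  have "fps_nth (fps_scale (inverse q) (qdilog q) * (1 - fps_const (inverse q) * fps_X)) j = fps_nth (qdilog q) j"
    using qdilog_nth_Suc[OF assms(1), of "j - 1"] assms(2)
    by (cases j) (auto simp: fps_nth_mult_linear fps_scale_def field_simps)
  then show "fps_nth ((1 - fps_const (inverse q) * fps_X) * fps_scale (inverse q) (qdilog q)) j = fps_nth (qdilog q) j"
    by (simp only: mult.commute)
qed

text \<open>The fundamental weights: exponents of \<Lambda>_1...\<Lambda>_a and of T_1...T_a and,
  for a = N, of the product of all Gaussians.\<close>

definition ones :: "nat \<Rightarrow> expo" where
  "ones a = (\<lambda>i. if i \<in> {1..a} then 1 else 0)"

lemma ones_Suc: "ones (Suc n) = ones n + unit_expo (Suc n)"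
  by (auto simp: fun_eq_iff ones_def unit_expo_def)

lemma ones_0 [simp]: "ones 0 = 0"
  by (auto simp: fun_eq_iff ones_def)

definition root_mon :: "nat \<Rightarrow> nat \<Rightarrow> mon" where
  "root_mon a j = ((\<lambda>i. int j * simple_root a i), 0, 0)"

lemma root_mon_mult: "mon_mult (root_mon a i) (root_mon a j) = root_mon a (i + j)"
  by (auto simp: root_mon_def fun_eq_iff distrib_right)

lemma root_mon_inject [simp]: "root_mon a i = root_mon a j \<longleftrightarrow> i = j"
proof
  assume "root_mon a i = root_mon a j"
  then have "fst (root_mon a i) (a + 1) = fst (root_mon a j) (a + 1)"
    by simp
  then show "i = j"
    by (simp add: root_mon_def simple_root_def unit_expo_def)
qed simp

lemma root_mon_0: "root_mon a 0 = (0, 0, 0)"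
  by (simp add: root_mon_def fun_eq_iff)

lemma root_mon_1: "root_mon a 1 = (simple_root a, 0, 0)"
  by (simp add: root_mon_def)

lemma subst_ratio_root_mon [simp]: "subst_ratio a F (root_mon a j) = fps_nth F j"
proof -
  have "\<exists>j'::nat. (\<lambda>i. int j * simple_root a i) = (\<lambda>i. int j' * (unit_expo (a + 1) i - unit_expo a i))"
    by (intro exI[of _ j]) (simp add: simple_root_def)
  moreover have "nat (int j * simple_root a (a + 1)) = j"
    by (simp add: simple_root_def unit_expo_def)
  ultimately show ?thesis
    unfolding subst_ratio_def root_mon_def by simp
qed

lemma subst_ratio_outside:
  assumes "x \<notin> range (root_mon a)"
  shows "subst_ratio a F x = 0"
proof -
  obtain m n k where x: "x = (m, n, k)" by (cases x)
  have "\<not> (n = 0 \<and> k = 0 \<and> (\<exists>j::nat. m = (\<lambda>i. int j * (unit_expo (a + 1) i - unit_expo a i))))"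
    using assms unfolding x root_mon_def simple_root_def by auto
  then show ?thesis
    unfolding x subst_ratio_def by auto
qed

lemma supp_subst_ratio: "supp (subst_ratio a F) \<subseteq> range (root_mon a)"
  unfolding supp_def by (rule subsetI, rule ccontr) (simp add: subst_ratio_outside)

section \<open>Series in the \<Lambda>'s alone, and moving the T's past them\<close>

context toda begin

lemma mon_cocycle_lam [simp]: "\<kappa> (m, 0, 0) y = 1"
  by (cases y) simp

text \<open>A commutative subalgebra that contains the infinite products of g and the
  \<Lambda>-dependent factors of the Hamiltonians. The cone condition makes constant terms
  multiplicative.\<close>

definition lam_only :: "(mon \<Rightarrow> complex) \<Rightarrow> bool" where
  "lam_only f \<longleftrightarrow> f \<in> carrier R \<and> (\<forall>x\<in>supp f. snd x = (0, 0) \<and> fst x \<in> root_cone N)"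

lemma lam_onlyD: "lam_only f \<Longrightarrow> x \<in> supp f \<Longrightarrow> \<exists>m\<in>root_cone N. x = (m, 0, 0)"
  by (cases x) (auto simp: lam_only_def)

lemma lam_only_closed [simp]: "lam_only f \<Longrightarrow> f \<in> carrier R"
  by (simp add: lam_only_def)

lemma lam_only_mult: "lam_only f \<Longrightarrow> lam_only h \<Longrightarrow> lam_only (f \<otimes> h)"
  unfolding lam_only_def
  by (force dest!: supp_mult intro!: root_cone_add)

lemma lam_only_one: "lam_only \<one>"
  by (simp add: lam_only_def)

lemma lam_only_commute:
  assumes "lam_only f" "lam_only h"
  shows "f \<otimes> h = h \<otimes> f"
proof (rule ext)
  fix x
  show "(f \<otimes> h) x = (h \<otimes> f) x"
    unfolding mult_eq
  proof (rule sum.reindex_bij_witness[where i = prod.swap and j = prod.swap])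
    fix p assume "p \<in> {(y, z). y \<in> supp f \<and> z \<in> supp h \<and> mon_mult y z = x}"
    then obtain m m' where "p = ((m, 0, 0), (m', 0, 0))" "(m, 0, 0) \<in> supp f" "(m', 0, 0) \<in> supp h"
      "mon_mult (m, 0, 0) (m', 0, 0) = x"
      using lam_onlyD[OF assms(1)] lam_onlyD[OF assms(2)] by blast
    then show "prod.swap p \<in> {(y, z). y \<in> supp h \<and> z \<in> supp f \<and> mon_mult y z = x}"
      "(case prod.swap p of (y, z) \<Rightarrow> \<kappa> y z * h y * f z) = (case p of (y, z) \<Rightarrow> \<kappa> y z * f y * h z)"
      by (auto simp: add.commute)
  next
    fix p assume "p \<in> {(y, z). y \<in> supp h \<and> z \<in> supp f \<and> mon_mult y z = x}"
    then obtain m m' where "p = ((m, 0, 0), (m', 0, 0))" "(m, 0, 0) \<in> supp h" "(m', 0, 0) \<in> supp f"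
      "mon_mult (m, 0, 0) (m', 0, 0) = x"
      using lam_onlyD[OF assms(1)] lam_onlyD[OF assms(2)] by blast
    then show "prod.swap p \<in> {(y, z). y \<in> supp f \<and> z \<in> supp h \<and> mon_mult y z = x}"
      by (auto simp: add.commute)
  qed auto
qed

lemma lam_only_ord_prod:
  "(\<And>i. i \<in> {1..n} \<Longrightarrow> lam_only (f i)) \<Longrightarrow> lam_only (ord_prod R n f)"
proof (induction n)
  case (Suc n)
  have "ord_prod R (Suc n) f = ord_prod R n f \<otimes> f (Suc n)"
    using Suc.prems by (intro ord_prod_Suc lam_only_closed)
  moreover have "lam_only (ord_prod R n f)" "lam_only (f (Suc n))"
    using Suc by auto
  ultimately show ?case
    by (simp add: lam_only_mult)
qed (simp add: lam_only_one)

lemma lam_only_subst_ratio: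
  assumes "a \<in> {1..<N}"
  shows "lam_only (subst_ratio a F)"
proof -
  have "(supported_on N x \<and> fst x \<in> root_cone N) \<and> snd x = (0, 0)" if x: "x \<in> supp (subst_ratio a F)" for x
  proof -
    obtain j where "x = root_mon a j"
      using subsetD[OF supp_subst_ratio x] by blast
    moreover have "int j * simple_root a i = 0" if "i \<notin> {1..N}" for i
      using root_cone_supported[OF root_cone_multiple[OF assms, of j] that] .
    ultimately show ?thesis
      using root_cone_multiple[OF assms, of j] by (simp add: root_mon_def supported_on_def)
  qed
  moreover have "finite {x \<in> supp (subst_ratio a F). fst x = m}" for m
    by (rule finite_subset[of _ "{(m, 0, 0)}"]) (auto dest!: subsetD[OF supp_subst_ratio] simp: root_mon_def)
  ultimately show ?thesis
    unfolding lam_only_def carrier_eq by (auto intro!: series_carrier_in_cone)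
qed

lemma subst_ratio_closed [simp]: "a \<in> {1..<N} \<Longrightarrow> subst_ratio a F \<in> carrier R"
  using lam_only_subst_ratio lam_only_closed by blast

lemma subst_ratio_one: "subst_ratio a 1 = \<one>"
proof (rule ext)
  fix x
  show "subst_ratio a 1 x = \<one> x"
  proof (cases "x \<in> range (root_mon a)")
    case True
    then show ?thesis
      by (auto simp: one_eq basis_def root_mon_0[of a, symmetric] simp del: root_mon_0)
  next
    case False
    then have "x \<noteq> (0, 0, 0)" using root_mon_0[of a] by (metis rangeI)
    with False show ?thesis
      by (simp add: subst_ratio_outside one_eq basis_def)
  qed
qed

text \<open>Powers of one ratio multiply without scalars, so substitution is multiplicative;
  functional equations of one-variable series thereby become identities in the algebra.\<close>

lemma subst_ratio_mult: "subst_ratio a F \<otimes> subst_ratio a H = subst_ratio a (F * H)"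
proof (rule ext)
  fix x
  show "(subst_ratio a F \<otimes> subst_ratio a H) x = subst_ratio a (F * H) x"
  proof (cases "x \<in> range (root_mon a)")
    case True
    then obtain j where x: "x = root_mon a j" by blast
    let ?p = "\<lambda>i. (root_mon a i, root_mon a (j - i))"
    have "(subst_ratio a F \<otimes> subst_ratio a H) x =
        (\<Sum>(y, z)\<in>?p ` {0..j}. \<kappa> y z * subst_ratio a F y * subst_ratio a H z)"
    proof (rule mult_eq_sum)
      show "(y, z) \<in> ?p ` {0..j}"
        if y: "y \<in> supp (subst_ratio a F)" and z: "z \<in> supp (subst_ratio a H)"
          and yz: "mon_mult y z = x" for y z
      proof -
        obtain i i' where "y = root_mon a i" "z = root_mon a i'"
          using subsetD[OF supp_subst_ratio y] subsetD[OF supp_subst_ratio z] by blast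
        then show ?thesis
          using yz unfolding x by (intro image_eqI[of _ _ i]) (auto simp: root_mon_mult)
      qed
    qed (auto simp: x root_mon_mult)
    also have "\<dots> = (\<Sum>i=0..j. fps_nth F i * fps_nth H (j - i))"
    proof (subst sum.reindex)
      have "\<kappa> (root_mon a i) y = 1" for i y
        by (simp add: root_mon_def)
      then show "sum ((\<lambda>(y, z). \<kappa> y z * subst_ratio a F y * subst_ratio a H z) \<circ> ?p) {0..j} =
          (\<Sum>i=0..j. fps_nth F i * fps_nth H (j - i))"
        by simp
    qed (auto simp: inj_on_def)
    finally show ?thesis
      by (simp add: x fps_mult_nth)
  next
    case False
    have "x \<notin> supp (subst_ratio a F \<otimes> subst_ratio a H)"
    proof
      assume "x \<in> supp (subst_ratio a F \<otimes> subst_ratio a H)"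
      then obtain i i' where "x = mon_mult (root_mon a i) (root_mon a i')"
        using supp_mult subsetD[OF supp_subst_ratio] by blast
      with False show False by (simp add: root_mon_mult)
    qed
    with False show ?thesis
      by (simp add: supp_def subst_ratio_outside)
  qed
qed

lemma subst_ratio_linear:
  assumes "a \<in> {1..<N}"
  shows "subst_ratio a (1 - fps_const c * fps_X) = \<one> \<ominus> c \<odot> basis (simple_root a, 0, 0)"
proof -
  have "supported_on N (simple_root a, 0, 0)"
    using assms by (auto simp: supported_on_def simple_root_def unit_expo_def)
  then have cl: "c \<odot> basis (simple_root a, 0, 0) \<in> carrier R"
    by (intro smult_closed basis_closed)
  show ?thesis
  proof (rule ext)
    fix x
    show "subst_ratio a (1 - fps_const c * fps_X) x = (\<one> \<ominus> c \<odot> basis (simple_root a, 0, 0)) x"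
    proof (cases "x \<in> range (root_mon a)")
      case True
      then obtain j where j: "x = root_mon a j" by blast
      show ?thesis
        unfolding j diff_series_apply[OF one_closed cl] subst_ratio_root_mon
        by (auto simp: one_eq basis_def root_mon_0[of a, symmetric] root_mon_1[of a, symmetric])
    next
      case False
      then have "x \<noteq> (0, 0, 0)" "x \<noteq> (simple_root a, 0, 0)"
        using root_mon_0[of a] root_mon_1[of a] by (metis rangeI)+
      with False show ?thesis
        unfolding diff_series_apply[OF one_closed cl] by (simp add: subst_ratio_outside one_eq basis_def)
    qed
  qed
qed

lemma tor_left: "(basis (0, n, 0) \<otimes> f) (m, n', k) = q powi (\<Sum>i=1..N. n i * m i) * f (m, n' - n, k)"
  using basis_mult_left[of "(0, n, 0)" f "(m, n' - n, k)"] by (simp add: times_fun_def plus_fun_def fun_diff_def)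

lemma tor_right: "(f \<otimes> basis (0, n, 0)) (m, n', k) = f (m, n' - n, k)"
  using basis_mult_right[of f "(0, n, 0)" "(m, n' - n, k)"] by (simp add: times_fun_def plus_fun_def fun_diff_def)

text \<open>Exchanging T^n and \<Lambda>^m costs q to the pairing of n with m, and n pairs with j
  times the simple root to j (n_(a+1) - n_a).\<close>

lemma tor_subst_ratio:
  assumes "a \<in> {1..<N}"
  shows "basis (0, n, 0) \<otimes> subst_ratio a F =
    subst_ratio a (fps_scale (q powi (n (a + 1) - n a)) F) \<otimes> basis (0, n, 0)"
proof (rule ext)
  fix x :: mon
  obtain m n' k where x: "x = (m, n', k)" by (cases x)
  show "(basis (0, n, 0) \<otimes> subst_ratio a F) x =
    (subst_ratio a (fps_scale (q powi (n (a + 1) - n a)) F) \<otimes> basis (0, n, 0)) x"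
  proof (cases "(m, n' - n, k) \<in> range (root_mon a)")
    case True
    then obtain j where j: "(m, n' - n, k) = root_mon a j" by blast
    then have m: "m = (\<lambda>i. int j * simple_root a i)"
      by (simp add: root_mon_def)
    have "(\<Sum>i=1..N. n i * m i) = (\<Sum>i=1..N. (if i = a + 1 then int j * n i else 0) - (if i = a then int j * n i else 0))"
      by (intro sum.cong) (auto simp: m simple_root_def unit_expo_def)
    also have "\<dots> = (n (a + 1) - n a) * int j"
      using assms by (simp add: sum_subtractf algebra_simps)
    finally have "q powi (\<Sum>i=1..N. n i * m i) = (q powi (n (a + 1) - n a)) ^ j"
      by (simp add: power_int_mult)
    then show ?thesis
      unfolding x tor_left tor_right j by (simp add: fps_scale_def)
  next
    case False
    then show ?thesis
      unfolding x tor_left tor_right by (simp add: subst_ratio_outside)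
  qed
qed

text \<open>A common shape for the infinite products in g and the factors of the Hamiltonians:
  products, inverses and moving T's past them all act separately on the N - 1 one-variable
  series.\<close>

definition ratio_prod :: "(nat \<Rightarrow> complex fps) \<Rightarrow> (mon \<Rightarrow> complex)" where
  "ratio_prod F = ord_prod R (N - 1) (\<lambda>a. subst_ratio a (F a))"

lemma mem_ratio_index: "a \<in> {1..n} \<Longrightarrow> n \<le> N - 1 \<Longrightarrow> a \<in> {1..<N}"
  by auto

lemma ratio_prod_mult: "ratio_prod F \<otimes> ratio_prod H = ratio_prod (\<lambda>a. F a * H a)"
proof -
  have "ord_prod R n (\<lambda>a. subst_ratio a (F a)) \<otimes> ord_prod R n (\<lambda>a. subst_ratio a (H a)) =
      ord_prod R n (\<lambda>a. subst_ratio a (F a * H a))" if "n \<le> N - 1" for n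
    using that
  proof (induction n)
    case (Suc n)
    note mem = mem_ratio_index[OF _ Suc.prems]
    have mem': "a \<in> {1..n} \<Longrightarrow> a \<in> {1..<N}" for a
      using mem by auto
    have l: "Suc n \<in> {1..<N}" using mem by auto
    let ?A = "ord_prod R n (\<lambda>a. subst_ratio a (F a))" and ?B = "ord_prod R n (\<lambda>a. subst_ratio a (H a))"
    let ?a = "subst_ratio (Suc n) (F (Suc n))" and ?b = "subst_ratio (Suc n) (H (Suc n))"
    have [simp]: "?A \<in> carrier R" "?B \<in> carrier R" "?a \<in> carrier R" "?b \<in> carrier R"
      using mem' l by (auto intro!: ord_prod_closed subst_ratio_closed)
    have "lam_only ?B"
      using mem' by (intro lam_only_ord_prod lam_only_subst_ratio)
    then have comm: "?a \<otimes> ?B = ?B \<otimes> ?a"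
      using lam_only_subst_ratio[OF l] by (intro lam_only_commute)
    have "ord_prod R (Suc n) (\<lambda>a. subst_ratio a (F a)) \<otimes> ord_prod R (Suc n) (\<lambda>a. subst_ratio a (H a)) =
      (?A \<otimes> ?a) \<otimes> (?B \<otimes> ?b)"
      using mem by (subst (1 2) ord_prod_Suc) auto
    also have "\<dots> = ?A \<otimes> (?a \<otimes> ?B) \<otimes> ?b"
      by (simp add: m_assoc)
    also have "\<dots> = (?A \<otimes> ?B) \<otimes> (?a \<otimes> ?b)"
      unfolding comm by (simp add: m_assoc)
    also have "\<dots> = ord_prod R (Suc n) (\<lambda>a. subst_ratio a (F a * H a))"
      using Suc mem by (subst ord_prod_Suc) (auto simp: subst_ratio_mult)
    finally show ?case .
  qed simp
  then show ?thesis
    unfolding ratio_prod_def by blast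
qed

lemma lam_only_ratio_prod: "lam_only (ratio_prod F)"
  unfolding ratio_prod_def by (intro lam_only_ord_prod lam_only_subst_ratio) auto

lemma ratio_prod_closed [simp]: "ratio_prod F \<in> carrier R"
  using lam_only_ratio_prod by simp

lemma ratio_prod_one: "ratio_prod (\<lambda>_. 1) = \<one>"
proof -
  have "ord_prod R n (\<lambda>a. \<one>) = \<one>" for n
    by (induction n) (auto simp: ord_prod_Suc)
  then show ?thesis
    unfolding ratio_prod_def subst_ratio_one by blast
qed

lemma ratio_prod_cong: "(\<And>a. a \<in> {1..<N} \<Longrightarrow> F a = H a) \<Longrightarrow> ratio_prod F = ratio_prod H"
  unfolding ratio_prod_def by (intro ord_prod_cong) auto

lemma tor_closed: "(\<And>i. i \<notin> {1..N} \<Longrightarrow> n i = 0) \<Longrightarrow> basis (0, n, 0) \<in> carrier R"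
  by (intro basis_closed) (auto simp: supported_on_def)

lemma tor_ratio_prod:
  assumes "\<And>i. i \<notin> {1..N} \<Longrightarrow> n i = 0"
  shows "basis (0, n, 0) \<otimes> ratio_prod F =
    ratio_prod (\<lambda>a. fps_scale (q powi (n (a + 1) - n a)) (F a)) \<otimes> basis (0, n, 0)"
proof -
  let ?t = "basis (0, n, 0)"
  define H where "H = (\<lambda>a. fps_scale (q powi (n (a + 1) - n a)) (F a))"
  have [simp]: "?t \<in> carrier R"
    using tor_closed assms by blast
  have "?t \<otimes> ord_prod R l (\<lambda>a. subst_ratio a (F a)) = ord_prod R l (\<lambda>a. subst_ratio a (H a)) \<otimes> ?t"
    if "l \<le> N - 1" for l
    using that
  proof (induction l)
    case (Suc l)
    note mem = mem_ratio_index[OF _ Suc.prems]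
    have l: "Suc l \<in> {1..<N}" using mem by auto
    let ?A = "ord_prod R l (\<lambda>a. subst_ratio a (F a))" and ?B = "ord_prod R l (\<lambda>a. subst_ratio a (H a))"
    have [simp]: "?A \<in> carrier R" "?B \<in> carrier R"
      using mem by (auto intro!: ord_prod_closed subst_ratio_closed)
    note [simp] = subst_ratio_closed[OF l]
    have IH: "?t \<otimes> ?A = ?B \<otimes> ?t"
      using Suc.IH Suc.prems by linarith
    have "?t \<otimes> ord_prod R (Suc l) (\<lambda>a. subst_ratio a (F a)) = (?t \<otimes> ?A) \<otimes> subst_ratio (Suc l) (F (Suc l))"
      using mem by (subst ord_prod_Suc) (auto simp: m_assoc)
    also have "\<dots> = ?B \<otimes> (?t \<otimes> subst_ratio (Suc l) (F (Suc l)))"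
      unfolding IH by (intro m_assoc) simp_all
    also have "\<dots> = ?B \<otimes> subst_ratio (Suc l) (H (Suc l)) \<otimes> ?t"
    proof -
      have "?t \<otimes> subst_ratio (Suc l) (F (Suc l)) = subst_ratio (Suc l) (H (Suc l)) \<otimes> ?t"
        unfolding H_def by (rule tor_subst_ratio[OF l])
      then show ?thesis by (simp add: m_assoc)
    qed
    also have "\<dots> = ord_prod R (Suc l) (\<lambda>a. subst_ratio a (H a)) \<otimes> ?t"
      using mem by (subst ord_prod_Suc) auto
    finally show ?case .
  qed simp
  then show ?thesis
    unfolding ratio_prod_def H_def by blast
qed

end

section \<open>Conjugation by g and the Q-system\<close>

lemmas pointwise = zero_fun_apply one_fun_apply plus_fun_apply times_fun_apply minus_apply uminus_apply

context monoid begin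

text \<open>Transfers the laws of integer powers from the group of units to powers taken in the
  monoid.\<close>

lemma Units_int_pow_eq:
  assumes "x \<in> Units G"
  shows "x [^]\<^bsub>units_of G\<^esub> (k::int) = x [^] k"
proof -
  have nat: "x [^]\<^bsub>units_of G\<^esub> (n::nat) = x [^] n" for n
    by (induction n) (simp_all add: units_of_mult units_of_one)
  have "x [^] (n::nat) \<in> Units G" for n
    by (induction n) (auto simp: assms)
  then have inv: "inv\<^bsub>units_of G\<^esub> (x [^] n) = inv (x [^] n)" for n :: nat
    by (rule units_of_inv)
  show ?thesis
    unfolding int_pow_def2 nat inv ..
qed

lemma Units_int_pow_Units:
  assumes "x \<in> Units G"
  shows "x [^] (k::int) \<in> Units G"
  using group.int_pow_closed[OF units_group, of x k] assms
  by (simp add: units_of_carrier Units_int_pow_eq)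

lemma Units_int_pow_add:
  assumes "x \<in> Units G"
  shows "x [^] (j + k) = x [^] (j::int) \<otimes> x [^] (k::int)"
  using group.int_pow_mult[OF units_group, of x j k] assms
  by (simp add: units_of_carrier units_of_mult Units_int_pow_eq)

lemma Units_int_pow_1: "x \<in> Units G \<Longrightarrow> x [^] (1::int) = x"
  by (simp add: int_pow_def2 Units_closed)

lemma Units_right_cancel:
  assumes "x \<otimes> u = y \<otimes> u" "u \<in> Units G" "x \<in> carrier G" "y \<in> carrier G"
  shows "x = y"
proof -
  have "x \<otimes> u \<otimes> inv u = y \<otimes> u \<otimes> inv u"
    using assms(1) by simp
  then show ?thesis
    using assms(2-4) by (simp add: m_assoc Units_closed)
qed

lemma ord_prod_single:
  assumes "\<And>i. i \<in> {1..n} \<Longrightarrow> f i = (if i = a then x else \<one>)" "x \<in> carrier G"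
  shows "ord_prod G n f = (if a \<in> {1..n} then x else \<one>)"
proof -
  have "ord_prod G n (\<lambda>i. if i = a then x else \<one>) = (if a \<in> {1..n} then x else \<one>)"
  proof (induction n)
    case (Suc n)
    then show ?case
      using assms(2) by (subst ord_prod_Suc) auto
  qed simp
  moreover have "ord_prod G n f = ord_prod G n (\<lambda>i. if i = a then x else \<one>)"
    by (rule ord_prod_cong) (rule assms(1))
  ultimately show ?thesis by simp
qed

end

context toda begin

declare add_apply [simp del] smult_apply [simp del] zero_apply [simp del]

abbreviation g :: "mon \<Rightarrow> complex" where "g \<equiv> g_elem q s N"

abbreviation \<Phi> :: "mon \<Rightarrow> complex" where "\<Phi> \<equiv> ratio_prod (\<lambda>_. qdilog q)"

abbreviation \<Gamma> :: "mon \<Rightarrow> complex" where "\<Gamma> \<equiv> basis (0, 0, ones N)"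

abbreviation L :: "nat \<Rightarrow> mon \<Rightarrow> complex" where "L a \<equiv> basis (ones a, 0, 0)"

lemma ord_prod_Lam: "a \<le> N \<Longrightarrow> ord_prod R a Lam = L a"
proof (induction a)
  case (Suc a)
  have "Lam i \<in> carrier R" if "i \<in> {1..Suc a}" for i
    unfolding Lam_def using that Suc.prems
    by (intro basis_closed) (auto simp: supported_on_def unit_expo_def)
  then have "ord_prod R (Suc a) Lam = ord_prod R a Lam \<otimes> Lam (Suc a)"
    by (rule ord_prod_Suc)
  with Suc show ?case
    by (simp add: Lam_def[of "Suc a"] basis_mult_basis ones_Suc del: pointwise mon_cocycle.simps)
qed (simp add: one_eq)

lemma ord_prod_Tor: "a \<le> N \<Longrightarrow> ord_prod R a Tor = basis (0, ones a, 0)"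
proof (induction a)
  case (Suc a)
  have "Tor i \<in> carrier R" if "i \<in> {1..Suc a}" for i
    unfolding Tor_def using that Suc.prems
    by (intro basis_closed) (auto simp: supported_on_def unit_expo_def)
  then have "ord_prod R (Suc a) Tor = ord_prod R a Tor \<otimes> Tor (Suc a)"
    by (rule ord_prod_Suc)
  with Suc show ?case
    by (simp add: Tor_def[of "Suc a"] basis_mult_basis ones_Suc del: pointwise)
qed (simp add: one_eq)

lemma ord_prod_Gau: "a \<le> N \<Longrightarrow> ord_prod R a Gau = basis (0, 0, ones a)"
proof (induction a)
  case (Suc a)
  have "Gau i \<in> carrier R" if "i \<in> {1..Suc a}" for i
    unfolding Gau_def using that Suc.prems
    by (intro basis_closed) (auto simp: supported_on_def unit_expo_def)
  then have "ord_prod R (Suc a) Gau = ord_prod R a Gau \<otimes> Gau (Suc a)"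
    by (rule ord_prod_Suc)
  with Suc show ?case
    by (simp add: Gau_def[of "Suc a"] basis_mult_basis ones_Suc del: pointwise)
qed (simp add: one_eq)

lemma g_eq: "g = \<Gamma> \<otimes> \<Phi>"
  using ord_prod_Gau[of N] unfolding g_elem_def R_def[symmetric] by (simp add: ratio_prod_def)

lemma \<Gamma>_closed [simp]: "\<Gamma> \<in> carrier R"
  by (intro basis_closed) (auto simp: supported_on_def ones_def)

lemma L_closed [simp]: "a \<le> N \<Longrightarrow> L a \<in> carrier R"
  by (intro basis_closed) (auto simp: supported_on_def ones_def)

section \<open>Units and conjugation by powers of g\<close>

lemma UnitsI: "x \<in> carrier R \<Longrightarrow> y \<in> carrier R \<Longrightarrow> x \<otimes> y = \<one> \<Longrightarrow> y \<otimes> x = \<one> \<Longrightarrow> x \<in> Units R"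
  unfolding Units_def by blast

lemma supported_on_0 [simp]: "supported_on N (0, 0, 0)"
  by (simp add: supported_on_def)

lemma basis_Units:
  assumes "supported_on N x"
  shows "basis x \<in> Units R"
proof -
  obtain m n k where x: "x = (m, n, k)" by (cases x)
  \<comment> \<open>The inverse exponents: the term k m compensates the T's that appear when the
    Gaussians move past \<Lambda>^(-m).\<close>
  define y :: mon where "y = (- m, - n + k * m, - k)"
  have y: "supported_on N y"
    using assms by (auto simp: supported_on_def x y_def)
  have xy: "mon_mult x y = (0, 0, 0)" "mon_mult y x = (0, 0, 0)"
    by (auto simp: x y_def fun_eq_iff pointwise)
  have nz: "\<kappa> x y \<noteq> 0" "\<kappa> y x \<noteq> 0"
    by (simp_all add: mon_cocycle_nonzero q_nonzero s_nonzero)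
  have *: "basis x \<otimes> (c \<odot> basis y) = (c * \<kappa> x y) \<odot> \<one>" "(c \<odot> basis y) \<otimes> basis x = (c * \<kappa> y x) \<odot> \<one>" for c
    using assms y
    by (simp_all add: smult_mult_left smult_mult_right basis_closed basis_mult_basis xy one_eq)
  have "basis y \<in> carrier R" "basis x \<in> carrier R"
    using assms y basis_closed by auto
  have r: "basis x \<otimes> (inverse (\<kappa> x y) \<odot> basis y) = \<one>" and l: "(inverse (\<kappa> y x) \<odot> basis y) \<otimes> basis x = \<one>"
    using nz by (simp_all add: *)
  \<comment> \<open>The right and left inverses carry scalars from different cocycle values;
    uniqueness of inverses identifies them.\<close>
  moreover have "inverse (\<kappa> x y) \<odot> basis y = inverse (\<kappa> y x) \<odot> basis y"
    using inv_unique[OF l r] \<open>basis y \<in> carrier R\<close> \<open>basis x \<in> carrier R\<close> by simp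
  ultimately show ?thesis
    using \<open>basis y \<in> carrier R\<close> \<open>basis x \<in> carrier R\<close>
    by (intro UnitsI[of _ "inverse (\<kappa> x y) \<odot> basis y"]) auto
qed

lemma ratio_prod_Units:
  assumes "\<And>a. fps_nth (F a) 0 \<noteq> 0"
  shows "ratio_prod F \<in> Units R"
proof (rule UnitsI)
  have 1: "inverse (F a) * F a = 1" "F a * inverse (F a) = 1" for a
    using inverse_mult_eq_1[OF assms[of a]] by (simp_all add: mult.commute)
  show "ratio_prod F \<otimes> ratio_prod (\<lambda>a. inverse (F a)) = \<one>"
    "ratio_prod (\<lambda>a. inverse (F a)) \<otimes> ratio_prod F = \<one>"
    by (simp_all add: ratio_prod_mult 1 ratio_prod_one)
qed simp_all

lemma g_Units [simp]: "g \<in> Units R"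
proof -
  have "\<Gamma> \<in> Units R"
    by (rule basis_Units) (auto simp: supported_on_def ones_def)
  then show ?thesis
    unfolding g_eq by (intro Units_m_closed ratio_prod_Units) (auto simp: norm_q)
qed

lemma g_closed [simp]: "g \<in> carrier R"
  by (simp add: Units_closed)

abbreviation gp :: "int \<Rightarrow> mon \<Rightarrow> complex" where "gp k \<equiv> g [^] k"

definition g_conj :: "int \<Rightarrow> (mon \<Rightarrow> complex) \<Rightarrow> (mon \<Rightarrow> complex)" where
  "g_conj k X = gp k \<otimes> X \<otimes> gp (- k)"

lemma gp_Units [simp]: "gp k \<in> Units R"
  by (simp add: Units_int_pow_Units)

lemma gp_closed [simp]: "gp k \<in> carrier R"
  using gp_Units Units_closed by blast

lemma gp_add: "gp (j + k) = gp j \<otimes> gp k"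
  by (simp add: Units_int_pow_add)

lemma gp_neg [simp]: "gp k \<otimes> gp (- k) = \<one>" "gp (- k) \<otimes> gp k = \<one>"
  using gp_add[of k "- k"] gp_add[of "- k" k] by simp_all

lemma gp_1: "gp 1 = g"
  by (simp add: Units_int_pow_1)

lemma g_conj_closed [simp]: "X \<in> carrier R \<Longrightarrow> g_conj k X \<in> carrier R"
  by (simp add: g_conj_def)

lemma g_conj_one [simp]: "g_conj k \<one> = \<one>"
  by (simp add: g_conj_def)

lemma g_conj_zero [simp]: "g_conj k \<zero> = \<zero>"
  by (simp add: g_conj_def)

lemma g_conj_0 [simp]: "X \<in> carrier R \<Longrightarrow> g_conj 0 X = X"
  by (simp add: g_conj_def)

lemma g_conj_mult:
  assumes "X \<in> carrier R" "Y \<in> carrier R"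
  shows "g_conj k (X \<otimes> Y) = g_conj k X \<otimes> g_conj k Y"
proof -
  have "g_conj k X \<otimes> g_conj k Y = gp k \<otimes> X \<otimes> (gp (- k) \<otimes> gp k) \<otimes> Y \<otimes> gp (- k)"
    using assms by (simp add: g_conj_def m_assoc del: gp_neg)
  then show ?thesis
    using assms by (simp add: g_conj_def m_assoc)
qed

lemma g_conj_smult: "X \<in> carrier R \<Longrightarrow> g_conj k (c \<odot> X) = c \<odot> g_conj k X"
  by (simp add: g_conj_def smult_mult_left smult_mult_right)

lemma g_conj_minus:
  "X \<in> carrier R \<Longrightarrow> Y \<in> carrier R \<Longrightarrow> g_conj k (X \<ominus> Y) = g_conj k X \<ominus> g_conj k Y"
  by (simp add: g_conj_def a_minus_def l_distr r_distr l_minus r_minus)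

lemma g_conj_conj:
  assumes "X \<in> carrier R"
  shows "g_conj j (g_conj k X) = g_conj (j + k) X"
proof -
  have "- (j + k) = - k + - j" by simp
  then show ?thesis
    using assms unfolding g_conj_def by (simp only: gp_add) (simp add: m_assoc)
qed

lemma g_conj_Units:
  assumes "X \<in> Units R"
  shows "g_conj k X \<in> Units R"
  using assms unfolding g_conj_def by (intro Units_m_closed) auto

text \<open>Reads conjugation in both directions off an intertwining relation, so that the inverse
  of g never has to be expanded as a series.\<close>

lemma g_conj_eqI:
  assumes "X \<in> carrier R" "Y \<in> carrier R" "g \<otimes> X = Y \<otimes> g"
  shows "g_conj 1 X = Y" "g_conj (- 1) Y = X"
proof -
  have "g \<otimes> gp (- 1) = \<one>" "gp (- 1) \<otimes> g = \<one>"
    using gp_neg[of 1] by (simp_all add: gp_1)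
  then have "Y \<otimes> g \<otimes> gp (- 1) = Y" "gp (- 1) \<otimes> (g \<otimes> X) = X"
    using assms(1,2) by (simp_all add: m_assoc) (simp add: m_assoc[symmetric])
  then show "g_conj 1 X = Y" "g_conj (- 1) Y = X"
    using assms by (simp_all add: g_conj_def gp_1 m_assoc)
qed

lemma g_conj_fixed:
  assumes "X \<in> carrier R" "g \<otimes> X = X \<otimes> g"
  shows "g_conj k X = X"
proof (induction k rule: int_induct[where k = 0])
  case base
  then show ?case using assms by simp
next
  case (step1 i)
  then show ?case
    using g_conj_conj[OF assms(1), of 1 i] g_conj_eqI(1)[OF assms(1,1,2)] by (simp add: add.commute)
next
  case (step2 i)
  then show ?case
    using g_conj_conj[OF assms(1), of "-1" i] g_conj_eqI(2)[OF assms(1,1,2)] by (simp add: add.commute)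
qed

lemma smult_Units:
  assumes "X \<in> Units R" "c \<noteq> 0"
  shows "c \<odot> X \<in> Units R"
  using assms
  by (intro UnitsI[of _ "inverse c \<odot> inv X"]) (auto simp: smult_mult_left smult_mult_right Units_closed)

section \<open>The explicit solution of the Q-system\<close>

lemma smult_zero: "c \<odot> \<zero> = \<zero>"
  by (simp add: zero_eq fun_eq_iff smult_apply)

text \<open>The scalar is q^(-ak/2), with s as the chosen square root of q. The value \<zero> beyond
  N is the boundary condition of the Q-system.\<close>

definition D :: "nat \<Rightarrow> int \<Rightarrow> (mon \<Rightarrow> complex)" where
  "D a k = (if a \<le> N then s powi (- (int a * k)) \<odot> g_conj k (L a) else \<zero>)"

lemma L_0: "L 0 = \<one>"
  by (simp add: one_eq)

lemma D_0: "D 0 k = \<one>"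
  unfolding D_def L_0 by simp

lemma D_closed [simp]: "D a k \<in> carrier R"
  by (simp add: D_def)

lemma D_Units: "a \<le> N \<Longrightarrow> D a k \<in> Units R"
  by (auto simp: D_def s_nonzero supported_on_def ones_def intro!: smult_Units g_conj_Units basis_Units)

lemma D_at_0: "a \<le> N \<Longrightarrow> D a 0 = L a"
  by (simp add: D_def)

text \<open>Up to a scalar, shifting time is the automorphism \<open>g_conj\<close>. Relations at
  time k thus reduce to time 0 once the scalars on both sides agree.\<close>

lemma D_shift: "D a (k + j) = s powi (- (int a * k)) \<odot> g_conj k (D a j)"
proof (cases "a \<le> N")
  case True
  have "s powi (- (int a * (k + j))) = s powi (- (int a * k)) * s powi (- (int a * j))"
    using s_nonzero by (simp add: power_int_add[symmetric] algebra_simps)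
  with True show ?thesis
    by (simp add: D_def g_conj_smult g_conj_conj)
qed (simp add: D_def smult_zero)

lemma sum_ones_mult:
  assumes "a \<le> N" "b \<le> N"
  shows "(\<Sum>i=1..N. ones a i * ones b i) = int (min a b)"
proof -
  have "(\<Sum>i=1..N. ones a i * ones b i) = (\<Sum>i\<in>{1..min a b}. 1)"
    using assms by (intro sum.mono_neutral_cong_right) (auto simp: ones_def)
  then show ?thesis by simp
qed

lemma sum_ones_sq: "a \<le> N \<Longrightarrow> (\<Sum>i=1..N. ones N i * (ones a i)\<^sup>2) = int a"
  using sum_ones_mult[of a a] by (auto simp: ones_def power2_eq_square cong: sum.cong_simp intro!: trans[OF sum.cong])

lemma ones_N_mult: "a \<le> N \<Longrightarrow> ones N * ones a = ones a"
  by (auto simp: fun_eq_iff pointwise ones_def)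

text \<open>The Gaussians add the \<Lambda>-exponent to the T-exponent, and the power of s is the
  squared length of \<open>ones a\<close>, which is a.\<close>

lemma \<Gamma>_mult_basis:
  assumes "a \<le> N"
  shows "\<Gamma> \<otimes> basis (ones a, n, 0) = s powi int a \<odot> (basis (ones a, n + ones a, 0) \<otimes> \<Gamma>)"
  using sum_ones_sq[OF assms] by (simp add: basis_mult_basis ones_N_mult[OF assms])

text \<open>Both factors involve only \<Lambda>'s, but the exponent \<open>ones a\<close> has
  coordinate sum a, whereas the cone has coordinate sum 0; for a \<ge> 1
  \<open>lam_only_commute\<close> does not apply and coefficients are compared directly.\<close>

lemma ratio_prod_L_commute: "ratio_prod F \<otimes> L a = L a \<otimes> ratio_prod F"
proof (rule ext)
  fix x :: mon
  obtain m n k where x: "x = (m, n, k)" by (cases x)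
  show "(ratio_prod F \<otimes> L a) x = (L a \<otimes> ratio_prod F) x"
  proof (cases "(n, k) = (0, 0)")
    case True
    have "mon_mult (m - ones a, 0, 0) (ones a, 0, 0) = x" "mon_mult (ones a, 0, 0) (m - ones a, 0, 0) = x"
      using True by (simp_all add: x)
    then show ?thesis
      using basis_mult_left[of "(ones a, 0, 0)" "ratio_prod F" "(m - ones a, 0, 0)"]
        basis_mult_right[of "ratio_prod F" "(ones a, 0, 0)" "(m - ones a, 0, 0)"] by simp
  next
    case False
    then have "x \<notin> supp (ratio_prod F \<otimes> L a)" "x \<notin> supp (L a \<otimes> ratio_prod F)"
      using lam_onlyD[OF lam_only_ratio_prod] by (force simp: x dest!: supp_mult)+
    then show ?thesis
      by (simp add: supp_def)
  qed
qed

text \<open>Since \<Phi> commutes with \<open>L a\<close>, only the Gaussians act, and their scalar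
  s^a cancels the normalization s^(-a).\<close>

lemma D_at_1:
  assumes "a \<le> N"
  shows "D a 1 = basis (ones a, ones a, 0)"
proof -
  let ?W = "basis (ones a, ones a, 0)"
  have W [simp]: "?W \<in> carrier R"
    using assms by (intro basis_closed) (auto simp: supported_on_def ones_def)
  note [simp] = L_closed[OF assms]
  have "g \<otimes> L a = \<Gamma> \<otimes> L a \<otimes> \<Phi>"
    unfolding g_eq by (simp add: m_assoc ratio_prod_L_commute)
  also have "\<dots> = (s powi int a \<odot> ?W) \<otimes> g"
    unfolding g_eq \<Gamma>_mult_basis[OF assms, of 0] by (simp add: smult_mult_left m_assoc)
  finally have "g_conj 1 (L a) = s powi int a \<odot> ?W"
    by (intro g_conj_eqI(1)) simp_all
  then show ?thesis
    using assms s_nonzero by (simp add: D_def power_int_minus)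
qed

text \<open>The factor by which \<open>D a (- 1)\<close> differs from a monomial. For 1 \<le> a < N
  it is 1 - \<Lambda>_(a+1)/\<Lambda>_a; for a = N no ratio has index a and it is 1, in accordance
  with the vanishing of \<open>D (N + 1)\<close>.\<close>

definition defect :: "nat \<Rightarrow> (mon \<Rightarrow> complex)" where
  "defect a = ratio_prod (\<lambda>b. if b = a then 1 - fps_X else 1)"

lemma defect_closed [simp]: "defect a \<in> carrier R"
  by (simp add: defect_def)

lemma fps_scale_1 [simp]: "fps_scale 1 F = F"
  by (simp add: fps_scale_def fps_eq_iff)

text \<open>The negative of \<open>ones a\<close> pairs to 1 with the simple root of index a and to
  0 with the others, so only that one series is rescaled by q, and the functional equation turns the
  rescaling into a factor 1 - X.\<close>

lemma tor_\<Phi>: "basis (0, - ones a, 0) \<otimes> \<Phi> = \<Phi> \<otimes> defect a \<otimes> basis (0, - ones a, 0)" if "a \<le> N" "1 \<le> a"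
proof -
  have "ratio_prod (\<lambda>b. fps_scale (q powi ((- ones a) (b + 1) - (- ones a) b)) (qdilog q)) =
      ratio_prod (\<lambda>b. qdilog q * (if b = a then 1 - fps_X else 1))"
    using that by (intro ratio_prod_cong) (auto simp: ones_def qdilog_scale norm_q)
  also have "\<dots> = \<Phi> \<otimes> defect a"
    unfolding defect_def ratio_prod_mult ..
  finally show ?thesis
    using that by (subst tor_ratio_prod) (auto simp: ones_def)
qed

text \<open>Verified by multiplying the right side by g from the left: moving the inverse T's to the
  left of \<Phi> absorbs \<open>defect a\<close>, and the Gaussians then cancel these T's and leave
  the scalar s^a.\<close>

lemma D_at_minus_1:
  assumes "a \<le> N" "1 \<le> a"
  shows "D a (- 1) = L a \<otimes> defect a \<otimes> basis (0, - ones a, 0)"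
proof -
  let ?t = "basis (0, - ones a, 0)"
  have t [simp]: "?t \<in> carrier R"
    using assms by (intro basis_closed) (auto simp: supported_on_def ones_def)
  note [simp] = L_closed[OF assms(1)]
  have "g \<otimes> (L a \<otimes> defect a \<otimes> ?t) = \<Gamma> \<otimes> (\<Phi> \<otimes> L a) \<otimes> defect a \<otimes> ?t"
    unfolding g_eq by (simp add: m_assoc)
  also have "\<dots> = \<Gamma> \<otimes> L a \<otimes> (\<Phi> \<otimes> defect a \<otimes> ?t)"
    unfolding ratio_prod_L_commute by (simp add: m_assoc)
  also have "\<dots> = \<Gamma> \<otimes> L a \<otimes> (?t \<otimes> \<Phi>)"
    by (simp only: tor_\<Phi>[OF assms])
  also have "\<dots> = \<Gamma> \<otimes> (L a \<otimes> ?t) \<otimes> \<Phi>"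
    by (simp add: m_assoc)
  also have "L a \<otimes> ?t = basis (ones a, - ones a, 0)"
    by (simp add: basis_mult_basis)
  also have "\<Gamma> \<otimes> basis (ones a, - ones a, 0) = s powi int a \<odot> (L a \<otimes> \<Gamma>)"
    by (simp add: \<Gamma>_mult_basis[OF assms(1)])
  also have "s powi int a \<odot> (L a \<otimes> \<Gamma>) \<otimes> \<Phi> = (s powi int a \<odot> L a) \<otimes> g"
    unfolding g_eq by (simp add: smult_mult_left m_assoc)
  finally have "g_conj (- 1) (s powi int a \<odot> L a) = L a \<otimes> defect a \<otimes> ?t"
    by (intro g_conj_eqI(2)) (simp_all del: pointwise)
  then show ?thesis
    using assms by (simp add: D_def g_conj_smult)
qed

lemma defect_eq:
  assumes "a \<le> N" "1 \<le> a"
  shows "defect a = (if a < N then \<one> \<ominus> basis (simple_root a, 0, 0) else \<one>)"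
proof (cases "a < N")
  case True
  then have a: "a \<in> {1..<N}" using assms by simp
  have "defect a = subst_ratio a (1 - fps_X)"
    unfolding defect_def ratio_prod_def
    using assms True by (subst ord_prod_single[of _ _ a "subst_ratio a (1 - fps_X)"]) (auto simp: subst_ratio_one)
  also have "\<dots> = \<one> \<ominus> basis (simple_root a, 0, 0)"
    using subst_ratio_linear[OF a, of 1] by simp
  finally show ?thesis using True by simp
next
  case False
  then show ?thesis
    unfolding defect_def using assms ratio_prod_one
    by (subst ratio_prod_cong[of _ "\<lambda>_. 1"]) auto
qed

text \<open>Moving the T's of \<open>D a (- 1)\<close> past the \<Lambda>'s of \<open>D a 1\<close>
  produces q^(-a), which the prefactor cancels. What remains is the square of \<open>L a\<close>
  times \<open>defect a\<close>.\<close>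

lemma D_exchange_0:
  assumes "a \<le> N" "1 \<le> a"
  shows "q ^ a \<odot> (D a (- 1) \<otimes> D a 1) = (D a 0 \<otimes> D a 0) \<ominus> (D (a + 1) 0 \<otimes> D (a - 1) 0)"
proof -
  let ?t = "basis (0, - ones a, 0)" and ?W = "basis (ones a, ones a, 0)"
  have [simp]: "?t \<in> carrier R" "?W \<in> carrier R"
    using assms by (auto intro!: basis_closed simp: supported_on_def ones_def)
  note [simp] = L_closed[OF assms(1)]
  have "(\<Sum>i=1..N. (- ones a) i * ones a i) = - int a"
    using sum_ones_mult[OF assms(1,1)] by (simp add: sum_negf pointwise)
  then have tW: "?t \<otimes> ?W = q powi (- int a) \<odot> L a"
    by (simp add: basis_mult_basis)
  have "D a (- 1) \<otimes> D a 1 = L a \<otimes> defect a \<otimes> (?t \<otimes> ?W)"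
    by (simp add: D_at_minus_1[OF assms] D_at_1[OF assms(1)] m_assoc)
  also have "\<dots> = q powi (- int a) \<odot> (L a \<otimes> (defect a \<otimes> L a))"
    unfolding tW by (simp add: smult_mult_right m_assoc)
  also have "defect a \<otimes> L a = L a \<otimes> defect a"
    unfolding defect_def by (rule ratio_prod_L_commute)
  finally have "q ^ a \<odot> (D a (- 1) \<otimes> D a 1) = L a \<otimes> L a \<otimes> defect a"
    using q_nonzero by (simp add: power_int_minus m_assoc del: pointwise)
  also have "\<dots> = (D a 0 \<otimes> D a 0) \<ominus> (D (a + 1) 0 \<otimes> D (a - 1) 0)"
  proof (cases "a < N")
    case True
    have b [simp]: "basis (simple_root a, 0, 0) \<in> carrier R"
      using assms True by (intro basis_closed) (auto simp: supported_on_def simple_root_def unit_expo_def)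
    \<comment> \<open>The relation between consecutive fundamental weights and a simple root; it
      identifies the subtracted term with the product of the two neighbours.\<close>
    have e: "ones a + ones a + simple_root a = ones (a + 1) + ones (a - 1)"
      using assms by (auto simp: fun_eq_iff pointwise ones_def simple_root_def unit_expo_def)
    have "L a \<otimes> L a \<otimes> basis (simple_root a, 0, 0) = L (a + 1) \<otimes> L (a - 1)"
      by (simp add: basis_mult_basis e[simplified])
    then show ?thesis
      using True assms unfolding defect_eq[OF assms]
      by (simp add: D_at_0 a_minus_def r_distr r_minus)
  next
    case False
    moreover have "D (Suc N) 0 = \<zero>"
      by (simp add: D_def)
    ultimately show ?thesis
      using assms by (simp add: defect_eq D_at_0 a_minus_def)
  qed
  finally show ?thesis .
qed

text \<open>All three products acquire the same scalar s^(-2ak) under the time shift, because a + a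
  = (a + 1) + (a - 1).\<close>

lemma D_exchange:
  assumes "a \<in> {1..N}"
  shows "q ^ a \<odot> (D a (k - 1) \<otimes> D a (k + 1)) = (D a k \<otimes> D a k) \<ominus> (D (a + 1) k \<otimes> D (a - 1) k)"
proof -
  define c where "c = s powi (- (2 * int a * k))"
  have s2: "s powi (- (int a * k)) * s powi (- (int a * k)) = c"
    using s_nonzero by (simp add: c_def power_int_add[symmetric] algebra_simps)
  have "s powi (- (int (a + 1) * k)) * s powi (- (int (a - 1) * k)) = c"
    using s_nonzero assms by (simp add: c_def power_int_add[symmetric] of_nat_diff algebra_simps)
  then have e: "D (a + 1) k \<otimes> D (a - 1) k = c \<odot> g_conj k (D (a + 1) 0 \<otimes> D (a - 1) 0)"
    using D_shift[of "a + 1" k 0] D_shift[of "a - 1" k 0]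
    by (simp add: smult_mult_left smult_mult_right g_conj_mult mult.commute)
  have d: "D a k \<otimes> D a k = c \<odot> g_conj k (D a 0 \<otimes> D a 0)"
    using D_shift[of a k 0] by (simp add: smult_mult_left smult_mult_right g_conj_mult s2)
  have "D a (k - 1) \<otimes> D a (k + 1) = c \<odot> g_conj k (D a (- 1) \<otimes> D a 1)"
    using D_shift[of a k 1] D_shift[of a k "- 1"]
    by (simp add: smult_mult_left smult_mult_right g_conj_mult s2)
  then have "q ^ a \<odot> (D a (k - 1) \<otimes> D a (k + 1)) = c \<odot> g_conj k (q ^ a \<odot> (D a (- 1) \<otimes> D a 1))"
    by (simp add: g_conj_smult mult.commute)
  also have "\<dots> = D a k \<otimes> D a k \<ominus> D (a + 1) k \<otimes> D (a - 1) k"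
    using assms unfolding d e by (subst D_exchange_0) (auto simp: g_conj_minus smult_minus)
  finally show ?thesis .
qed

lemma D_commute_1:
  assumes "a \<le> N" "b \<le> N"
  shows "D b (k + 1) \<otimes> D a k = q powi int (min a b) \<odot> (D a k \<otimes> D b (k + 1))"
proof -
  let ?W = "basis (ones b, ones b, 0)"
  have [simp]: "?W \<in> carrier R"
    using assms by (auto intro!: basis_closed simp: supported_on_def ones_def)
  note [simp] = L_closed[OF assms(1)]
  have "?W \<otimes> L a = q powi int (min a b) \<odot> (L a \<otimes> ?W)"
    using sum_ones_mult[OF assms(2,1)] by (simp add: basis_mult_basis add.commute min.commute)
  then have "g_conj k (D b 1 \<otimes> D a 0) = q powi int (min a b) \<odot> g_conj k (D a 0 \<otimes> D b 1)"
    using assms by (simp add: D_at_0 D_at_1 g_conj_smult[symmetric])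
  then show ?thesis
    using D_shift[of b k 1] D_shift[of a k 0]
    by (simp add: smult_mult_left smult_mult_right g_conj_mult[symmetric] mult_ac)
qed

lemma D_commute_0:
  assumes "a \<le> N" "b \<le> N"
  shows "D b k \<otimes> D a k = D a k \<otimes> D b k"
proof -
  have "L b \<otimes> L a = L a \<otimes> L b"
    by (simp add: basis_mult_basis add.commute)
  then have "g_conj k (D b 0 \<otimes> D a 0) = g_conj k (D a 0 \<otimes> D b 0)"
    using assms by (simp add: D_at_0)
  then show ?thesis
    using D_shift[of b k 0] D_shift[of a k 0]
    by (simp add: smult_mult_left smult_mult_right g_conj_mult[symmetric] mult_ac)
qed

lemma D_commute:
  assumes "a \<le> N" "b \<le> N" "\<bar>i\<bar> \<le> 1"
  shows "D b (k + i) \<otimes> D a k = q powi (i * int (min a b)) \<odot> (D a k \<otimes> D b (k + i))"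
proof -
  consider "i = 0" | "i = 1" | "i = -1" using assms(3) by linarith
  then show ?thesis
  proof cases
    case 3
    \<comment> \<open>The case i = -1 is the case i = 1 at time k - 1 with a and b
      exchanged.\<close>
    have "D a k \<otimes> D b (k - 1) = q powi int (min a b) \<odot> (D b (k - 1) \<otimes> D a k)"
      using D_commute_1[OF assms(2,1), of "k - 1"] by (simp add: min.commute)
    then show ?thesis
      using 3 q_nonzero by (simp add: power_int_minus)
  qed (use assms D_commute_0 D_commute_1 in auto)
qed

lemma opposite_Q_system_D: "opposite_Q_system q N R D"
  unfolding opposite_Q_system_def
  using D_exchange D_commute D_Units D_0 by (auto simp: D_def[of "_::nat"] intro: D_commute)

lemma Q_system_step:
  assumes E: "opposite_Q_system q N R E" and F: "opposite_Q_system q N R F"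
    and k: "\<And>a. E a k = F a k" and "a \<in> {1..N}"
  shows "E a (k - 1) \<otimes> E a (k + 1) = F a (k - 1) \<otimes> F a (k + 1)"
proof -
  have 1: "q ^ a \<odot> (E a (k - 1) \<otimes> E a (k + 1)) = (E a k \<otimes> E a k) \<ominus> (E (a + 1) k \<otimes> E (a - 1) k)"
    using E \<open>a \<in> {1..N}\<close> unfolding opposite_Q_system_def by blast
  have 2: "q ^ a \<odot> (F a (k - 1) \<otimes> F a (k + 1)) = (F a k \<otimes> F a k) \<ominus> (F (a + 1) k \<otimes> F (a - 1) k)"
    using F \<open>a \<in> {1..N}\<close> unfolding opposite_Q_system_def by blast
  have "q ^ a \<odot> (E a (k - 1) \<otimes> E a (k + 1)) = q ^ a \<odot> (F a (k - 1) \<otimes> F a (k + 1))"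
    unfolding 1 2 k ..
  then have "inverse (q ^ a) \<odot> (q ^ a \<odot> (E a (k - 1) \<otimes> E a (k + 1))) =
      inverse (q ^ a) \<odot> (q ^ a \<odot> (F a (k - 1) \<otimes> F a (k + 1)))"
    by simp
  then show ?thesis
    using q_nonzero by simp
qed

text \<open>Agreement at two consecutive times propagates both ways. The exchange relation
  determines the product of the entries at times k - 1 and k + 1; the known one is a unit and is
  cancelled on the left going forward, on the right going backward. Indices outside [1,N] are fixed
  by the boundary values.\<close>

lemma Q_system_unique:
  assumes E: "opposite_Q_system q N R E" and F: "opposite_Q_system q N R F"
    and init: "\<And>a. a \<in> {1..N} \<Longrightarrow> E a 0 = F a 0 \<and> E a 1 = F a 1"
  shows "E = F"
proof -
  have out: "E a k = F a k" if "a \<notin> {1..N}" for a k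
  proof (cases "a = 0")
    case True
    then show ?thesis using E F unfolding opposite_Q_system_def by metis
  next
    case False
    then have "a > N" using that by auto
    then show ?thesis using E F unfolding opposite_Q_system_def by metis
  qed
  have U: "E a k \<in> Units R" "F a k \<in> Units R" if "a \<in> {1..N}" for a k
    using E F that unfolding opposite_Q_system_def by blast+
  have "(\<forall>a. E a k = F a k) \<and> (\<forall>a. E a (k + 1) = F a (k + 1))" for k
  proof (induction k rule: int_induct[where k = 0])
    case base
    show ?case
      using init out by (metis add_0)
  next
    case (step1 i)
    have "E a (i + 1 + 1) = F a (i + 1 + 1)" if a: "a \<in> {1..N}" for a
    proof -
      have "E a (i + 1 - 1) \<otimes> E a (i + 1 + 1) = F a (i + 1 - 1) \<otimes> F a (i + 1 + 1)"
        by (rule Q_system_step[OF E F _ a]) (use step1 in blast)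
      then have "E a i \<otimes> E a (i + 1 + 1) = E a i \<otimes> F a (i + 1 + 1)"
        using step1 by simp
      then show ?thesis
        using U[OF a] by (simp only: Units_l_cancel Units_closed)
    qed
    then show ?case
      using step1 out by blast
  next
    case (step2 i)
    have "E a (i - 1) = F a (i - 1)" if a: "a \<in> {1..N}" for a
    proof -
      have "E a (i - 1) \<otimes> E a (i + 1) = F a (i - 1) \<otimes> F a (i + 1)"
        by (rule Q_system_step[OF E F _ a]) (use step2 in blast)
      then have "E a (i - 1) \<otimes> E a (i + 1) = F a (i - 1) \<otimes> E a (i + 1)"
        using step2 by simp
      then show ?thesis
        by (rule Units_right_cancel) (simp_all only: U[OF a] Units_closed)
    qed
    then have "\<forall>a. E a (i - 1) = F a (i - 1)"
      using out by blast
    then show ?case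
      unfolding diff_add_cancel using step2 by blast
  qed
  then have "E a k = F a k" for a k
    by blast
  then show "E = F"
    by (intro ext[of E F] ext[of "E _" "F _"]) (simp only:)
qed

lemma Dbar_eq: "Dbar q s N = D"
  unfolding Dbar_def R_def[symmetric]
proof (rule the_equality)
  have init: "D a 0 = ord_prod R a Lam \<and> D a 1 = ord_prod R a Lam \<otimes> ord_prod R a Tor" if "a \<in> {1..N}" for a
    using that by (simp add: D_at_0 D_at_1 ord_prod_Lam ord_prod_Tor basis_mult_basis)
  then show "opposite_Q_system q N R D \<and> (\<forall>a\<in>{1..N}. D a 0 = ord_prod R a Lam \<and>
      D a 1 = ord_prod R a Lam \<otimes> ord_prod R a Tor)"
    using opposite_Q_system_D by blast
  show "E = D" if "opposite_Q_system q N R E \<and> (\<forall>a\<in>{1..N}. E a 0 = ord_prod R a Lam \<and>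
      E a 1 = ord_prod R a Lam \<otimes> ord_prod R a Tor)" for E
    using that init by (intro Q_system_unique[OF _ opposite_Q_system_D]) auto
qed

end

section \<open>The Toda Hamiltonians commute with g\<close>

definition indic :: "nat set \<Rightarrow> expo" where
  "indic I = (\<lambda>i. if i \<in> I then 1 else 0)"

text \<open>The exponent of the product of \<Lambda>_(b+1)/\<Lambda>_b over b in K; where K has
  consecutive elements the two indicators cancel.\<close>

definition root_sum :: "nat set \<Rightarrow> expo" where
  "root_sum K = indic (Suc ` K) - indic K"

lemma root_sum_empty [simp]: "root_sum {} = 0"
  by (auto simp: root_sum_def indic_def fun_eq_iff)

lemma root_sum_insert: "b \<notin> K \<Longrightarrow> root_sum (insert b K) = root_sum K + simple_root b"
  by (auto simp: root_sum_def indic_def simple_root_def unit_expo_def fun_eq_iff)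

lemma indic_supported: "I \<subseteq> {1..N} \<Longrightarrow> i \<notin> {1..N} \<Longrightarrow> indic I i = 0"
  by (auto simp: indic_def)

lemma root_sum_in_cone:
  assumes "K \<subseteq> {1..<N}"
  shows "root_sum K \<in> root_cone N"
proof -
  have "finite K" using assms finite_subset by blast
  then show ?thesis
    using assms
  proof (induction K)
    case (insert b K)
    have "simple_root b \<in> root_cone N"
      using root_cone_multiple[of b N 1] insert.prems by simp
    moreover have "root_sum K \<in> root_cone N"
      using insert by simp
    ultimately show ?case
      unfolding root_sum_insert[OF insert.hyps(2)] by (intro root_cone_add)
  qed (simp only: root_sum_empty root_cone_zero)
qed

lemma sum_indic: "I \<subseteq> {1..N} \<Longrightarrow> (\<Sum>i=1..N. indic I i) = int (card I)"
proof -
  assume I: "I \<subseteq> {1..N}"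
  have "(\<Sum>i=1..N. indic I i) = (\<Sum>i\<in>I. 1)"
    using I by (intro sum.mono_neutral_cong_right) (auto simp: indic_def)
  then show ?thesis by simp
qed

lemma card_Suc_image [simp]: "card (Suc ` K) = card K"
  by (simp add: card_image)

lemma sum_root_sum:
  assumes "K \<subseteq> {1..<N}"
  shows "(\<Sum>i=1..N. root_sum K i) = 0"
proof -
  have "Suc ` K \<subseteq> {1..N}" "K \<subseteq> {1..N}" using assms by auto
  then show ?thesis
    by (simp only: root_sum_def fun_diff_def sum_subtractf sum_indic card_Suc_image)
qed

text \<open>Without consecutive elements in K the simple roots involved are orthogonal, each of
  squared length 2. This is the source of s^(2|K|) = q^|K| in the conjugation by the
  Gaussians.\<close>

lemma sum_root_sum_sq:
  assumes "K \<subseteq> {1..<N}" "K \<inter> Suc ` K = {}"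
  shows "(\<Sum>i=1..N. (root_sum K i)\<^sup>2) = 2 * int (card K)"
proof -
  have sub: "K \<union> Suc ` K \<subseteq> {1..N}" and fin: "finite K"
    using assms(1) finite_subset[OF assms(1)] by auto
  have "(\<Sum>i=1..N. (root_sum K i)\<^sup>2) = (\<Sum>i=1..N. indic (K \<union> Suc ` K) i)"
    using assms(2) by (intro sum.cong) (auto simp: root_sum_def indic_def)
  also have "\<dots> = int (card (K \<union> Suc ` K))"
    by (rule sum_indic[OF sub])
  also have "\<dots> = 2 * int (card K)"
    using fin assms(2) by (simp add: card_Un_disjoint)
  finally show ?thesis .
qed

section \<open>Ascents, descents and the expansion of the Hamiltonians into monomials\<close>

context toda begin

text \<open>Indexed by the lower position: b stands for the ratio \<Lambda>_(b+1)/\<Lambda>_b, so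
  the index i in the Hamiltonian is b + 1, and i = 1 corresponds to no b.\<close>

definition ascents :: "nat set \<Rightarrow> nat set" where
  "ascents I = {b \<in> {1..<N}. b \<notin> I \<and> Suc b \<in> I}"

definition descents :: "nat set \<Rightarrow> nat set" where
  "descents I = {b \<in> {1..<N}. b \<in> I \<and> Suc b \<notin> I}"

abbreviation T :: "nat set \<Rightarrow> mon \<Rightarrow> complex" where "T I \<equiv> basis (0, indic I, 0)"

abbreviation subsets :: "nat \<Rightarrow> nat set set" where "subsets a \<equiv> {I. I \<subseteq> {1..N} \<and> card I = a}"

definition linear_prod :: "complex \<Rightarrow> nat set \<Rightarrow> (mon \<Rightarrow> complex)" where
  "linear_prod c P = ratio_prod (\<lambda>b. if b \<in> P then 1 - fps_const c * fps_X else 1)"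

lemma linear_prod_closed [simp]: "linear_prod c P \<in> carrier R"
  by (simp add: linear_prod_def)

lemma T_closed: "I \<subseteq> {1..N} \<Longrightarrow> T I \<in> carrier R"
  by (rule tor_closed) (rule indic_supported)

lemma finite_subsets [simp]: "finite (subsets a)"
  by (rule finite_subset[of _ "Pow {1..N}"]) auto

lemma simple_root_closed: "b \<in> {1..<N} \<Longrightarrow> basis (simple_root b, 0, 0) \<in> carrier R"
  by (intro basis_closed) (auto simp: supported_on_def simple_root_def unit_expo_def)

lemma mult_root_apply:
  "(f \<otimes> basis (r, 0, 0)) (m, 0, 0) = f (m - r, 0, 0)"
  using basis_mult_right[of f "(r, 0, 0)" "(m - r, 0, 0)"] by simp

lemma lam_only_apply: "lam_only f \<Longrightarrow> (n, k) \<noteq> (0, 0) \<Longrightarrow> f (m, n, k) = 0"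
  using lam_onlyD[of f "(m, n, k)"] by (auto simp: supp_def)

text \<open>Multiplying out binomials: K collects the factors from which the term with -c is taken.
  The induction adds one factor at a time.\<close>

lemma linear_prod_apply:
  "linear_prod c P x =
     (\<Sum>K\<in>Pow (P \<inter> {1..<N}). (- c) ^ card K * basis (root_sum K, 0, 0) x)"
proof -
  define F where "F = (\<lambda>b. if b \<in> P then 1 - fps_const c * fps_X else 1 :: complex fps)"
  let ?A = "\<lambda>l. ord_prod R l (\<lambda>b. subst_ratio b (F b))"
  have "?A l x = (\<Sum>K\<in>Pow (P \<inter> {1..l}). (- c) ^ card K * basis (root_sum K, 0, 0) x)"
    if "l \<le> N - 1" for l x
    using that
  proof (induction l arbitrary: x)
    case 0
    have "{K. K \<subseteq> P \<inter> {1..0::nat}} = {{}}" by auto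
    then show ?case by (simp add: one_eq del: pointwise)
  next
    case (Suc l)
    have l: "Suc l \<in> {1..<N}" using Suc.prems by auto
    have mem: "b \<in> {1..<N}" if "b \<in> {1..Suc l}" for b using that Suc.prems by auto
    have lam: "lam_only (?A l)" "lam_only (?A (Suc l))"
      using mem by (auto intro!: lam_only_ord_prod lam_only_subst_ratio)
    have step: "?A (Suc l) = ?A l \<otimes> subst_ratio (Suc l) (F (Suc l))"
      using mem by (intro ord_prod_Suc subst_ratio_closed)
    show ?case
    proof (cases "Suc l \<in> P")
      case False
      have "P \<inter> {1..Suc l} = P \<inter> {1..l}"
        using False by (auto simp: le_Suc_eq)
      with False Suc show ?thesis
        unfolding step using lam by (simp add: F_def subst_ratio_one)
    next
      case True
      let ?r = "simple_root (Suc l)"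
      note [simp] = lam(1)[THEN lam_only_closed] simple_root_closed[OF l]
      have "?A (Suc l) = ?A l \<ominus> c \<odot> (?A l \<otimes> basis (?r, 0, 0))"
      proof -
        have "subst_ratio (Suc l) (F (Suc l)) = \<one> \<ominus> c \<odot> basis (?r, 0, 0)"
          using True by (simp add: F_def subst_ratio_linear[OF l])
        then show ?thesis
          unfolding step by (simp add: a_minus_def r_distr r_minus smult_mult_right)
      qed
      then have A: "?A (Suc l) x = ?A l x - c * (?A l \<otimes> basis (?r, 0, 0)) x"
        by (simp add: diff_series_apply smult_apply)
      have shift: "(?A l \<otimes> basis (?r, 0, 0)) x =
          (\<Sum>K\<in>Pow (P \<inter> {1..l}). (- c) ^ card K * basis (root_sum K + ?r, 0, 0) x)"
      proof -
        obtain m n k where x: "x = (m, n, k)" by (cases x)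
        show ?thesis
        proof (cases "(n, k) = (0, 0)")
          case True
          have "(\<Sum>K\<in>Pow (P \<inter> {1..l}). (- c) ^ card K * basis (root_sum K, 0, 0) (m - ?r, 0, 0)) =
              (\<Sum>K\<in>Pow (P \<inter> {1..l}). (- c) ^ card K * basis (root_sum K + ?r, 0, 0) x)"
            using True by (intro sum.cong) (auto simp: x basis_def diff_eq_eq simp del: pointwise)
          then show ?thesis
            using Suc True by (simp add: x mult_root_apply del: pointwise)
        next
          case False
          have "lam_only (basis (?r, 0, 0))"
            unfolding lam_only_def using root_cone_multiple[OF l, of 1] by simp
          then have "lam_only (?A l \<otimes> basis (?r, 0, 0))"
            by (intro lam_only_mult lam)
          then have "(?A l \<otimes> basis (?r, 0, 0)) x = 0"
            unfolding x using False by (rule lam_only_apply)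
          moreover have "(\<Sum>K\<in>Pow (P \<inter> {1..l}). (- c) ^ card K * basis (root_sum K + ?r, 0, 0) x) = 0"
            using False by (intro sum.neutral) (auto simp: x basis_def simp del: pointwise)
          ultimately show ?thesis by simp
        qed
      qed
      have P: "P \<inter> {1..Suc l} = insert (Suc l) (P \<inter> {1..l})"
        using True by (auto simp: le_Suc_eq)
      let ?f = "\<lambda>K. (- c) ^ card K * basis (root_sum K, 0, 0) x"
      \<comment> \<open>Subsets without the new index give the old sum; those containing it give the
        sum shifted by the new simple root, with one more factor -c.\<close>
      have "(\<Sum>K\<in>Pow (P \<inter> {1..Suc l}). ?f K) =
          (\<Sum>K\<in>Pow (P \<inter> {1..l}). ?f K) + (\<Sum>K\<in>insert (Suc l) ` Pow (P \<inter> {1..l}). ?f K)"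
        unfolding P Pow_insert by (rule sum.union_disjoint) auto
      also have "(\<Sum>K\<in>insert (Suc l) ` Pow (P \<inter> {1..l}). ?f K) =
          (\<Sum>K\<in>Pow (P \<inter> {1..l}). ?f (insert (Suc l) K))"
      proof (subst sum.reindex)
        show "inj_on (insert (Suc l)) (Pow (P \<inter> {1..l}))"
          by (rule inj_on_inverseI[where g = "\<lambda>K. K - {Suc l}"]) auto
      qed simp
      also have "\<dots> = (\<Sum>K\<in>Pow (P \<inter> {1..l}). - c * ((- c) ^ card K * basis (root_sum K + ?r, 0, 0) x))"
      proof (rule sum.cong[OF refl])
        fix K assume K: "K \<in> Pow (P \<inter> {1..l})"
        then have "finite K" "Suc l \<notin> K"
          by (auto intro: finite_subset)
        then show "?f (insert (Suc l) K) = - c * ((- c) ^ card K * basis (root_sum K + ?r, 0, 0) x)"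
          by (simp add: root_sum_insert del: pointwise)
      qed
      finally show ?thesis
        using Suc unfolding A shift by (simp add: sum_distrib_left sum_negf)
    qed
  qed
  moreover have "{1..N - 1} = {1..<N}" by auto
  ultimately show ?thesis
    unfolding linear_prod_def ratio_prod_def F_def by simp
qed

lemma ord_prod_Tor_subset:
  assumes "I \<subseteq> {1..N}"
  shows "ord_prod R N (\<lambda>i. if i \<in> I then Tor i else \<one>) = T I"
proof -
  have "ord_prod R l (\<lambda>i. if i \<in> I then Tor i else \<one>) = T (I \<inter> {1..l})" if "l \<le> N" for l
    using that
  proof (induction l)
    case 0
    have "indic (I \<inter> {1..0}) = 0" by (auto simp: indic_def fun_eq_iff)
    then show ?case by (simp only: ord_prod_0 one_eq)
  next
    case (Suc l)
    have cl: "(if i \<in> I then Tor i else \<one>) \<in> carrier R" if "i \<in> {1..Suc l}" for i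
      using that Suc.prems unfolding Tor_def
      by (auto intro!: basis_closed simp: supported_on_def unit_expo_def)
    have "ord_prod R (Suc l) (\<lambda>i. if i \<in> I then Tor i else \<one>) =
        T (I \<inter> {1..l}) \<otimes> (if Suc l \<in> I then Tor (Suc l) else \<one>)"
      using Suc cl by (subst ord_prod_Suc) (simp_all del: pointwise)
    also have "\<dots> = T (I \<inter> {1..Suc l})"
    proof (cases "Suc l \<in> I")
      case True
      have "indic (I \<inter> {1..Suc l}) = indic (I \<inter> {1..l}) + unit_expo (Suc l)"
        using True by (auto simp: indic_def unit_expo_def fun_eq_iff)
      with True show ?thesis
        by (simp add: Tor_def basis_mult_basis)
    next
      case False
      then have "I \<inter> {1..Suc l} = I \<inter> {1..l}"
        by (auto simp: le_Suc_eq)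
      with False show ?thesis
        by (simp only: if_False one_mult_right)
    qed
    finally show ?case .
  qed
  from this[of N] show ?thesis
    using assms by (simp add: Int_absorb2)
qed

lemma Lam_ratio:
  assumes "b \<in> {1..<N}"
  shows "Lam (Suc b) \<otimes> inv Lam b = basis (simple_root b, 0, 0)"
proof -
  have cl: "basis (unit_expo b, 0, 0) \<in> carrier R" "basis (- unit_expo b, 0, 0) \<in> carrier R"
    using assms by (auto intro!: basis_closed simp: supported_on_def unit_expo_def)
  have "basis (- unit_expo b, 0, 0) = inv Lam b"
    unfolding Lam_def by (rule inv_unique') (simp_all add: cl basis_mult_basis one_eq del: pointwise mon_cocycle.simps)
  moreover have "unit_expo (Suc b) + - unit_expo b = simple_root b"
    by (simp add: simple_root_def)
  ultimately show ?thesis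
    by (simp add: Lam_def[of "Suc b"] basis_mult_basis flip: \<open>_ = inv Lam b\<close> del: pointwise mon_cocycle.simps)
qed

lemma toda_factor:
  assumes "1 \<le> N"
  shows "ord_prod R N (\<lambda>i. if i \<in> I \<and> i - 1 \<notin> I \<and> i \<noteq> 1
      then \<one> \<ominus> (Lam i \<otimes> inv Lam (i - 1)) else \<one>) = linear_prod 1 (ascents I)" (is "ord_prod R N ?f = _")
proof -
  obtain l where N: "N = Suc l" using assms by (cases N) auto
  have f: "?f (Suc b) = subst_ratio b (if b \<in> ascents I then 1 - fps_const 1 * fps_X else 1)"
    if "b \<in> {1..l}" for b
  proof -
    have b: "b \<in> {1..<N}" using that N by auto
    have "b \<in> ascents I \<longleftrightarrow> Suc b \<in> I \<and> b \<notin> I \<and> Suc b \<noteq> 1"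
      using b by (auto simp: ascents_def)
    then show ?thesis
      using subst_ratio_linear[OF b, of 1] by (simp add: Lam_ratio[OF b] subst_ratio_one)
  qed
  then have "ord_prod R l (\<lambda>b. ?f (Suc b)) = linear_prod 1 (ascents I)"
    unfolding linear_prod_def ratio_prod_def by (simp only: N diff_Suc_1) (rule ord_prod_cong)
  moreover have "ord_prod R N ?f = ?f 1 \<otimes> ord_prod R l (\<lambda>b. ?f (Suc b))"
    unfolding N by (rule ord_prod_shift)
  ultimately show ?thesis by simp
qed

lemma toda_H_eq:
  assumes "1 \<le> N"
  shows "toda_H q s N a = finsum R (\<lambda>I. linear_prod 1 (ascents I) \<otimes> T I) (subsets a)"
  unfolding toda_H_def R_def[symmetric] Let_def toda_factor[OF assms]
  by (intro finsum_cong') (auto simp: ord_prod_Tor_subset T_closed)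

text \<open>The Hamiltonian after conjugation by \<Phi>. The inverse of q comes from the functional
  equation at X/q, which governs descents.\<close>

definition toda_H' :: "nat \<Rightarrow> (mon \<Rightarrow> complex)" where
  "toda_H' a = finsum R (\<lambda>I. linear_prod (inverse q) (descents I) \<otimes> T I) (subsets a)"

lemma linear_prod_T_apply:
  assumes "P \<subseteq> {1..<N}"
  shows "(linear_prod c P \<otimes> basis (0, n, 0)) x =
    (\<Sum>K\<in>Pow P. (- c) ^ card K * basis (root_sum K, n, 0) x)"
proof -
  obtain m n' k where x: "x = (m, n', k)" by (cases x)
  have "P \<inter> {1..<N} = P" using assms by auto
  moreover have "basis (root_sum K, 0, 0) (m, n' - n, k) = basis (root_sum K, n, 0) (m, n', k)" for K
    by (auto simp: basis_def simp del: pointwise)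
  ultimately show ?thesis
    unfolding x tor_right linear_prod_apply by simp
qed

lemma ascents_subset: "ascents I \<subseteq> {1..<N}" and descents_subset: "descents I \<subseteq> {1..<N}"
  by (auto simp: ascents_def descents_def)

lemma toda_H_apply:
  assumes "1 \<le> N"
  shows "toda_H q s N a x =
    (\<Sum>(I, K)\<in>Sigma (subsets a) (\<lambda>I. Pow (ascents I)). (- 1) ^ card K * basis (root_sum K, indic I, 0) x)"
proof -
  have "toda_H q s N a x = (\<Sum>I\<in>subsets a. (linear_prod 1 (ascents I) \<otimes> T I) x)"
    unfolding toda_H_eq[OF assms] by (rule finsum_apply) (auto simp: T_closed)
  also have "\<dots> = (\<Sum>I\<in>subsets a. \<Sum>K\<in>Pow (ascents I). (- 1) ^ card K * basis (root_sum K, indic I, 0) x)"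
    by (simp only: linear_prod_T_apply[OF ascents_subset])
  also have "\<dots> = (\<Sum>(I, K)\<in>Sigma (subsets a) (\<lambda>I. Pow (ascents I)). (- 1) ^ card K * basis (root_sum K, indic I, 0) x)"
    by (rule sum.Sigma) (auto intro: finite_subset[OF ascents_subset])
  finally show ?thesis .
qed

lemma toda_H'_apply:
  "toda_H' a x =
    (\<Sum>(I, K)\<in>Sigma (subsets a) (\<lambda>I. Pow (descents I)).
       (- inverse q) ^ card K * basis (root_sum K, indic I, 0) x)"
proof -
  have "toda_H' a x = (\<Sum>I\<in>subsets a. (linear_prod (inverse q) (descents I) \<otimes> T I) x)"
    unfolding toda_H'_def by (rule finsum_apply) (auto simp: T_closed)
  also have "\<dots> = (\<Sum>I\<in>subsets a. \<Sum>K\<in>Pow (descents I). (- inverse q) ^ card K * basis (root_sum K, indic I, 0) x)"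
    by (simp only: linear_prod_T_apply[OF descents_subset])
  also have "\<dots> = (\<Sum>(I, K)\<in>Sigma (subsets a) (\<lambda>I. Pow (descents I)). (- inverse q) ^ card K * basis (root_sum K, indic I, 0) x)"
    by (rule sum.Sigma) (auto intro: finite_subset[OF descents_subset])
  finally show ?thesis .
qed

lemma toda_H_closed [simp]: "1 \<le> N \<Longrightarrow> toda_H q s N a \<in> carrier R"
  unfolding toda_H_eq by (intro finsum_closed) (auto simp: T_closed)

lemma toda_H'_closed [simp]: "toda_H' a \<in> carrier R"
  unfolding toda_H'_def by (intro finsum_closed) (auto simp: T_closed)

section \<open>Conjugation of the Hamiltonians by the two factors of g\<close>

lemma gau_left:
  "(\<Gamma> \<otimes> f) (m, n, k) = s powi (\<Sum>i=1..N. (m i)\<^sup>2) * f (m, n - ones N * m, k - ones N)"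
proof -
  have "(\<Sum>i=1..N. ones N i * (m i)\<^sup>2) = (\<Sum>i=1..N. (m i)\<^sup>2)"
    by (intro sum.cong) (auto simp: ones_def)
  then show ?thesis
    using basis_mult_left[of "(0, 0, ones N)" f "(m, n - ones N * m, k - ones N)"]
    by (simp add: plus_fun_def times_fun_def fun_diff_def)
qed

lemma gau_right: "(f \<otimes> \<Gamma>) (m, n, k) = f (m, n, k - ones N)"
  using basis_mult_right[of f "(0, 0, ones N)" "(m, n, k - ones N)"]
  by (simp add: plus_fun_def times_fun_def fun_diff_def)

lemma ones_N_root_sum:
  assumes "K \<subseteq> {1..<N}"
  shows "ones N * root_sum K = root_sum K"
proof
  fix i
  show "(ones N * root_sum K) i = root_sum K i"
    using root_cone_supported[OF root_sum_in_cone[OF assms], of i] by (auto simp: ones_def)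
qed

text \<open>The Gaussians add the \<Lambda>-exponent to the T-exponent; for descents K of I the
  result is again an indicator, because K lies in I and the successors of K do not.\<close>

lemma indic_move:
  assumes "K \<subseteq> descents I"
  shows "indic I + root_sum K = indic (I - K \<union> Suc ` K)"
proof
  fix i
  have "i \<in> K \<Longrightarrow> i \<in> I" "i \<in> Suc ` K \<Longrightarrow> i \<notin> I"
    using assms by (auto simp: descents_def)
  moreover from this have "i \<in> K \<Longrightarrow> i \<notin> Suc ` K" by blast
  ultimately show "(indic I + root_sum K) i = indic (I - K \<union> Suc ` K) i"
    by (auto simp: root_sum_def indic_def)
qed

text \<open>
  Moving the subset \<open>K\<close> of descents of \<open>I\<close> up by one turns them into ascents; this matches
  the terms of \<open>H\<close> with those of \<open>H'\<close>.
\<close>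

lemma gau_toda_H':
  assumes "1 \<le> N"
  shows "\<Gamma> \<otimes> toda_H' a = toda_H q s N a \<otimes> \<Gamma>"
proof (rule ext)
  fix x :: mon
  obtain m n k where x: "x = (m, n, k)" by (cases x)
  have term_eq: "s powi (\<Sum>i=1..N. (m i)\<^sup>2) * ((- inverse q) ^ card K *
        basis (root_sum K, indic I, 0) (m, n - ones N * m, k - ones N)) =
      (- 1) ^ card K * basis (root_sum K, indic (I - K \<union> Suc ` K), 0) (m, n, k - ones N)"
    if K: "K \<subseteq> descents I" for I K
  proof (cases "m = root_sum K")
    case True
    have KN: "K \<subseteq> {1..<N}" using K descents_subset by blast
    have "K \<inter> Suc ` K = {}" using K by (auto simp: descents_def)
    \<comment> \<open>The squared length 2|K| gives s^(2|K|) = q^|K|, which cancels the |K| factors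
      1/q and leaves only the sign.\<close>
    then have "s powi (\<Sum>i=1..N. (m i)\<^sup>2) = q ^ card K"
      unfolding True sum_root_sum_sq[OF KN \<open>K \<inter> Suc ` K = {}\<close>] q_powi[symmetric] by simp
    then have "s powi (\<Sum>i=1..N. (m i)\<^sup>2) * (- inverse q) ^ card K = (- 1) ^ card K"
      using q_nonzero by (simp add: power_mult_distrib[symmetric])
    moreover have "basis (root_sum K, indic I, 0) (m, n - ones N * m, k - ones N) =
        basis (root_sum K, indic (I - K \<union> Suc ` K), 0) (m, n, k - ones N)"
      unfolding True ones_N_root_sum[OF KN] indic_move[OF K, symmetric]
      by (auto simp: basis_def diff_eq_eq simp del: pointwise)
    ultimately show ?thesis by (simp only: mult.assoc[symmetric])
  next
    case False
    then show ?thesis by (simp add: basis_def)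
  qed
  have "(\<Gamma> \<otimes> toda_H' a) x = (\<Sum>(I, K)\<in>Sigma (subsets a) (\<lambda>I. Pow (descents I)).
      s powi (\<Sum>i=1..N. (m i)\<^sup>2) * ((- inverse q) ^ card K *
        basis (root_sum K, indic I, 0) (m, n - ones N * m, k - ones N)))"
    unfolding x gau_left toda_H'_apply sum_distrib_left by (simp only: split_def)
  also have "\<dots> = (\<Sum>(I, K)\<in>Sigma (subsets a) (\<lambda>I. Pow (descents I)).
      (- 1) ^ card K * basis (root_sum K, indic (I - K \<union> Suc ` K), 0) (m, n, k - ones N))"
    by (intro sum.cong refl) (auto simp only: mem_Sigma_iff term_eq PowD split: prod.splits)
  also have "\<dots> = (\<Sum>(I, K)\<in>Sigma (subsets a) (\<lambda>I. Pow (ascents I)).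
      (- 1) ^ card K * basis (root_sum K, indic I, 0) (m, n, k - ones N))"
  \<comment> \<open>K is kept, so signs and \<Lambda>-exponents agree, and the inverse map moves the
    successors of K back to K. Sizes are preserved because the target positions are free.\<close>
  proof (rule sum.reindex_bij_witness[where j = "\<lambda>(I, K). (I - K \<union> Suc ` K, K)"
        and i = "\<lambda>(I, K). (I - Suc ` K \<union> K, K)"])
    fix p assume "p \<in> Sigma (subsets a) (\<lambda>I. Pow (descents I))"
    then obtain I K where p: "p = (I, K)" and I: "I \<subseteq> {1..N}" "card I = a" and K: "K \<subseteq> descents I"
      by auto
    have KI: "K \<subseteq> I" "Suc ` K \<inter> I = {}" "Suc ` K \<subseteq> {1..N}" "K \<inter> Suc ` K = {}"
      using K by (auto simp: descents_def)
    have fin: "finite I"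
      using I(1) by (rule finite_subset) simp
    have fin: "finite I" "finite K"
      using fin KI(1) by (auto intro: finite_subset)
    have "card (I - K \<union> Suc ` K) = card (I - K) + card K"
      using fin KI(2) by (subst card_Un_disjoint) auto
    then have "card (I - K \<union> Suc ` K) = a"
      using fin KI(1) I(2) card_mono[OF fin(1) KI(1)] by (simp add: card_Diff_subset)
    moreover have "K \<subseteq> ascents (I - K \<union> Suc ` K)"
      using K KI by (auto simp: descents_def ascents_def)
    ultimately show "(case p of (I, K) \<Rightarrow> (I - K \<union> Suc ` K, K)) \<in> Sigma (subsets a) (\<lambda>I. Pow (ascents I))"
      using I KI by (auto simp: p)
    show "(case case p of (I, K) \<Rightarrow> (I - K \<union> Suc ` K, K) of (I, K) \<Rightarrow> (I - Suc ` K \<union> K, K)) = p"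
      using KI by (auto simp: p)
  next
    fix p assume "p \<in> Sigma (subsets a) (\<lambda>I. Pow (ascents I))"
    then obtain I K where p: "p = (I, K)" and I: "I \<subseteq> {1..N}" "card I = a" and K: "K \<subseteq> ascents I"
      by auto
    have KI: "Suc ` K \<subseteq> I" "K \<inter> I = {}" "K \<subseteq> {1..N}" "K \<inter> Suc ` K = {}"
      using K by (auto simp: ascents_def)
    have fin: "finite I"
      using I(1) by (rule finite_subset) simp
    have fin: "finite I" "finite K"
      using fin K by (auto intro: finite_subset[OF _ finite_subset[OF ascents_subset]])
    have "card (I - Suc ` K \<union> K) = card (I - Suc ` K) + card K"
      using fin KI(2) by (subst card_Un_disjoint) auto
    then have "card (I - Suc ` K \<union> K) = a"
      using fin KI(1) I(2) card_mono[OF fin(1) KI(1)] by (simp add: card_Diff_subset)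
    moreover have "K \<subseteq> descents (I - Suc ` K \<union> K)"
      using K KI by (auto simp: descents_def ascents_def)
    ultimately show "(case p of (I, K) \<Rightarrow> (I - Suc ` K \<union> K, K)) \<in> Sigma (subsets a) (\<lambda>I. Pow (descents I))"
      using I KI by (auto simp: p)
    show "(case case p of (I, K) \<Rightarrow> (I - Suc ` K \<union> K, K) of (I, K) \<Rightarrow> (I - K \<union> Suc ` K, K)) = p"
      using KI by (auto simp: p)
  qed auto
  also have "\<dots> = (toda_H q s N a \<otimes> \<Gamma>) x"
    unfolding x gau_right toda_H_apply[OF assms] ..
  finally show "(\<Gamma> \<otimes> toda_H' a) x = (toda_H q s N a \<otimes> \<Gamma>) x" .
qed

text \<open>T_I rescales the ratio of index b by q at an ascent, by 1/q at a descent and not at all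
  otherwise; the two functional equations of the dilogarithm convert these rescalings into the
  linear factors.\<close>

lemma \<Phi>_linear_prod:
  assumes "I \<subseteq> {1..N}"
  shows "\<Phi> \<otimes> (linear_prod 1 (ascents I) \<otimes> T I) = (linear_prod (inverse q) (descents I) \<otimes> T I) \<otimes> \<Phi>"
proof -
  note [simp] = T_closed[OF assms]
  have eq: "qdilog q * (if b \<in> ascents I then 1 - fps_const 1 * fps_X else 1) =
      (if b \<in> descents I then 1 - fps_const (inverse q) * fps_X else 1) *
        fps_scale (q powi (indic I (b + 1) - indic I b)) (qdilog q)" if "b \<in> {1..<N}" for b
    using that qdilog_scale[OF norm_q] qdilog_scale_inverse[OF norm_q q_nonzero]
    by (auto simp: ascents_def descents_def indic_def power_int_minus)
  have "(linear_prod (inverse q) (descents I) \<otimes> T I) \<otimes> \<Phi> = linear_prod (inverse q) (descents I) \<otimes>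
      ratio_prod (\<lambda>b. fps_scale (q powi (indic I (b + 1) - indic I b)) (qdilog q)) \<otimes> T I"
    using tor_ratio_prod[of "indic I" "\<lambda>_. qdilog q"] indic_supported[OF assms] by (simp add: m_assoc)
  also have "\<dots> = \<Phi> \<otimes> linear_prod 1 (ascents I) \<otimes> T I"
    unfolding linear_prod_def ratio_prod_mult
    by (intro arg_cong[where f = "\<lambda>f. f \<otimes> T I"] ratio_prod_cong) (simp only: eq)
  finally show ?thesis
    by (simp add: m_assoc)
qed

lemma \<Phi>_toda_H:
  assumes "1 \<le> N"
  shows "\<Phi> \<otimes> toda_H q s N a = toda_H' a \<otimes> \<Phi>"
proof -
  have "\<Phi> \<otimes> toda_H q s N a = finsum R (\<lambda>I. \<Phi> \<otimes> (linear_prod 1 (ascents I) \<otimes> T I)) (subsets a)"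
    unfolding toda_H_eq[OF assms] by (rule finsum_rdistr) (auto simp: T_closed)
  also have "\<dots> = finsum R (\<lambda>I. (linear_prod (inverse q) (descents I) \<otimes> T I) \<otimes> \<Phi>) (subsets a)"
    by (rule finsum_cong') (auto simp: T_closed \<Phi>_linear_prod)
  also have "\<dots> = toda_H' a \<otimes> \<Phi>"
    unfolding toda_H'_def by (rule finsum_ldistr[symmetric]) (auto simp: T_closed)
  finally show ?thesis .
qed

lemma g_toda_H:
  assumes "1 \<le> N"
  shows "g \<otimes> toda_H q s N a = toda_H q s N a \<otimes> g"
proof -
  have "g \<otimes> toda_H q s N a = \<Gamma> \<otimes> (\<Phi> \<otimes> toda_H q s N a)"
    unfolding g_eq using assms by (simp add: m_assoc)
  also have "\<dots> = \<Gamma> \<otimes> toda_H' a \<otimes> \<Phi>"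
    unfolding \<Phi>_toda_H[OF assms] by (simp add: m_assoc)
  also have "\<dots> = toda_H q s N a \<otimes> g"
    unfolding gau_toda_H'[OF assms] g_eq using assms by (simp add: m_assoc)
  finally show ?thesis .
qed

lemma supp_toda_H:
  assumes "1 \<le> N" "x \<in> supp (toda_H q s N a)"
  obtains I K where "I \<subseteq> {1..N}" "card I = a" "K \<subseteq> {1..<N}" "x = (root_sum K, indic I, 0)"
proof -
  have "(\<Sum>(I, K)\<in>Sigma (subsets a) (\<lambda>I. Pow (ascents I)). (- 1) ^ card K * basis (root_sum K, indic I, 0) x) \<noteq> 0"
    using assms(2) unfolding supp_def toda_H_apply[OF assms(1)] by simp
  then obtain I K where "I \<in> subsets a" "K \<in> Pow (ascents I)" "basis (root_sum K, indic I, 0) x \<noteq> 0"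
    by (elim sum.not_neutral_contains_not_neutral) auto
  then show ?thesis
    using that[of I K] ascents_subset by (auto simp: basis_def split: if_splits)
qed

subsection \<open>The commutant of g\<close>

text \<open>The class to which the Hamiltonians and their products belong: no Gaussians, and
  \<Lambda>-exponents in the cone itself rather than in translates of it.\<close>

definition cone_series :: "(mon \<Rightarrow> complex) \<Rightarrow> bool" where
  "cone_series f \<longleftrightarrow> f \<in> carrier R \<and> (\<forall>x\<in>supp f. fst x \<in> root_cone N \<and> snd (snd x) = 0)"

lemma cone_series_closed [simp]: "cone_series f \<Longrightarrow> f \<in> carrier R"
  by (simp add: cone_series_def)

lemma cone_seriesD:
  assumes "cone_series f" "x \<in> supp f"
  obtains m n where "x = (m, n, 0)" "m \<in> root_cone N"
  using assms by (cases x) (auto simp: cone_series_def)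

lemma cone_series_mult: "cone_series f \<Longrightarrow> cone_series h \<Longrightarrow> cone_series (f \<otimes> h)"
  unfolding cone_series_def by (force dest!: supp_mult intro!: root_cone_add)

lemma cone_series_toda_H:
  assumes "1 \<le> N"
  shows "cone_series (toda_H q s N a)"
proof -
  have "fst x \<in> root_cone N \<and> snd (snd x) = 0" if x: "x \<in> supp (toda_H q s N a)" for x
    by (rule supp_toda_H[OF assms x]) (simp add: root_sum_in_cone)
  then show ?thesis
    using assms by (simp add: cone_series_def)
qed

text \<open>By pointedness of the cone only the \<Lambda>-free parts contribute, and these are
  Laurent polynomials in the commuting T's.\<close>

lemma cone_series_commute_at_0:
  assumes "cone_series f" "cone_series h"
  shows "(f \<otimes> h) (0, n, k) = (h \<otimes> f) (0, n, k)"
  unfolding mult_eq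
proof (rule sum.reindex_bij_witness[where i = prod.swap and j = prod.swap])
  fix p assume "p \<in> {(y, z). y \<in> supp f \<and> z \<in> supp h \<and> mon_mult y z = (0, n, k)}"
  then obtain y z where p: "p = (y, z)" and yz: "y \<in> supp f" "z \<in> supp h" "mon_mult y z = (0, n, k)"
    by auto
  obtain m1 n1 where y: "y = (m1, n1, 0)" "m1 \<in> root_cone N"
    using cone_seriesD[OF assms(1) yz(1)] .
  obtain m2 n2 where z: "z = (m2, n2, 0)" "m2 \<in> root_cone N"
    using cone_seriesD[OF assms(2) yz(2)] .
  have "m1 + m2 = 0"
    using yz(3) y z by (simp del: pointwise)
  then have "m1 = 0" "m2 = 0"
    using root_cone_add_eq_0 y z by blast+
  then show "prod.swap p \<in> {(y, z). y \<in> supp h \<and> z \<in> supp f \<and> mon_mult y z = (0, n, k)}"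
    "(case prod.swap p of (y, z) \<Rightarrow> \<kappa> y z * h y * f z) = (case p of (y, z) \<Rightarrow> \<kappa> y z * f y * h z)"
    using yz y z p by (auto simp: add.commute simp del: pointwise mon_cocycle.simps)
next
  fix p assume "p \<in> {(y, z). y \<in> supp h \<and> z \<in> supp f \<and> mon_mult y z = (0, n, k)}"
  then obtain y z where p: "p = (y, z)" and yz: "y \<in> supp h" "z \<in> supp f" "mon_mult y z = (0, n, k)"
    by auto
  obtain m1 n1 where y: "y = (m1, n1, 0)" "m1 \<in> root_cone N"
    using cone_seriesD[OF assms(2) yz(1)] .
  obtain m2 n2 where z: "z = (m2, n2, 0)" "m2 \<in> root_cone N"
    using cone_seriesD[OF assms(1) yz(2)] .
  have "m1 + m2 = 0"
    using yz(3) y z by (simp del: pointwise)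
  then have "m1 = 0" "m2 = 0"
    using root_cone_add_eq_0 y z by blast+
  then show "prod.swap p \<in> {(y, z). y \<in> supp f \<and> z \<in> supp h \<and> mon_mult y z = (0, n, k)}"
    using yz y z p by (auto simp: add.commute simp del: pointwise)
qed auto

lemma lam_only_mult_at_0:
  assumes "lam_only f" "lam_only h"
  shows "(f \<otimes> h) (0, 0, 0) = f (0, 0, 0) * h (0, 0, 0)"
proof -
  have "(f \<otimes> h) (mon_mult (0, 0, 0) (0, 0, 0)) = \<kappa> (0, 0, 0) (0, 0, 0) * f (0, 0, 0) * h (0, 0, 0)"
  proof (rule mult_single)
    fix y z assume "y \<in> supp f" "z \<in> supp h" and e: "mon_mult y z = mon_mult (0, 0, 0) (0, 0, 0)"
    then obtain m m' where yz: "y = (m, 0, 0)" "z = (m', 0, 0)" "m \<in> root_cone N" "m' \<in> root_cone N"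
      using lam_onlyD assms by metis
    have "m + m' = 0"
      using e unfolding yz by (simp del: pointwise)
    then have "m = 0" "m' = 0"
      using root_cone_add_eq_0 yz by blast+
    then show "y = (0, 0, 0) \<and> z = (0, 0, 0)"
      using yz by simp
  qed
  then show ?thesis by simp
qed

lemma subst_ratio_at_0 [simp]: "subst_ratio a F (0, 0, 0) = fps_nth F 0"
  unfolding root_mon_0[of a, symmetric] by simp

lemma \<Phi>_at_0: "\<Phi> (0, 0, 0) = 1"
proof -
  have "ord_prod R l (\<lambda>a. subst_ratio a (qdilog q)) (0, 0, 0) = 1" if "l \<le> N - 1" for l
    using that
  proof (induction l)
    case (Suc l)
    have mem: "b \<in> {1..<N}" if "b \<in> {1..Suc l}" for b using that Suc.prems by auto
    have "ord_prod R (Suc l) (\<lambda>a. subst_ratio a (qdilog q)) =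
        ord_prod R l (\<lambda>a. subst_ratio a (qdilog q)) \<otimes> subst_ratio (Suc l) (qdilog q)"
      using mem by (intro ord_prod_Suc subst_ratio_closed)
    moreover have "lam_only (ord_prod R l (\<lambda>a. subst_ratio a (qdilog q)))" "lam_only (subst_ratio (Suc l) (qdilog q))"
      using mem by (auto intro!: lam_only_ord_prod lam_only_subst_ratio)
    ultimately show ?case
      using Suc by (simp add: lam_only_mult_at_0 norm_q del: pointwise)
  qed (simp add: one_eq basis_def)
  then show ?thesis
    unfolding ratio_prod_def by blast
qed

text \<open>
  At a minimal \<open>\<Lambda>\<close>-exponent \<open>m\<close> of \<open>X\<close>, commutation with \<open>g\<close> says that the coefficient
  \<open>P(T)\<close> of \<open>\<Lambda>\<^sup>m\<close> equals a multiple of \<open>T\<^bsup>-m\<^esup> P(T)\<close>; for a Laurent polynomial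
  this forces \<open>m = 0\<close>.
\<close>

lemma commutant_eq_zero:
  assumes X: "X \<in> carrier R" and cone: "\<And>x. x \<in> supp X \<Longrightarrow> fst x \<in> root_cone N"
    and zero: "\<And>n k. X (0, n, k) = 0" and comm: "g \<otimes> X = X \<otimes> g"
  shows "X = \<zero>"
proof (rule ccontr)
  assume "X \<noteq> \<zero>"
  then obtain x where "x \<in> supp X"
    by (auto simp: supp_def zero_eq fun_eq_iff)
  \<comment> \<open>A monomial of minimal height; heights are nonnegative on the cone, so
    \<open>nat\<close> loses nothing.\<close>
  then obtain x0 where x0: "x0 \<in> supp X"
    and le: "\<And>x. x \<in> supp X \<Longrightarrow> nat (height N (fst x0)) \<le> nat (height N (fst x))"
    using ex_has_least_nat[of "\<lambda>x. x \<in> supp X" x "\<lambda>x. nat (height N (fst x))"] by blast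
  obtain m n0 k0 where x0_eq: "x0 = (m, n0, k0)" by (cases x0)
  have min: "height N m \<le> height N m'" if "(m', n, k) \<in> supp X" for m' n k
    using le[OF that] height_root_cone_nonneg[OF cone[OF that]] by (simp add: x0_eq)
  have m: "m \<in> root_cone N"
    using cone[OF x0] by (simp add: x0_eq)
  have m0: "m \<noteq> 0"
    using x0 zero by (auto simp: supp_def x0_eq)
  \<comment> \<open>By minimality, m is reached from an exponent of X by adding a cone element only
    if that element is 0. Hence only the constant term of \<Phi> enters on either side.\<close>
  have c0: "c = 0" if "(m', n, k) \<in> supp X" "c \<in> root_cone N" "c + m' = m" for c m' n k
  proof -
    have "height N c + height N m' = height N m"
      unfolding that(3)[symmetric] height_add ..
    then show ?thesis
      using min[OF that(1)] that(2) by (intro height_root_cone_eq_0[of c N]) auto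
  qed
  have "(\<Phi> \<otimes> X) (mon_mult (0, 0, 0) (m, n, k)) = \<kappa> (0, 0, 0) (m, n, k) * \<Phi> (0, 0, 0) * X (m, n, k)" for n k
  proof (rule mult_single)
    fix y z assume y: "y \<in> supp \<Phi>" and z: "z \<in> supp X" and yz: "mon_mult y z = mon_mult (0, 0, 0) (m, n, k)"
    obtain c where c: "y = (c, 0, 0)" "c \<in> root_cone N"
      using lam_onlyD[OF lam_only_ratio_prod y] by blast
    obtain m' n' k' where z': "z = (m', n', k')" by (cases z)
    have "c + m' = m"
      using yz unfolding c z' by (simp del: pointwise)
    then have "c = 0"
      using c0 z c unfolding z' by blast
    then show "y = (0, 0, 0) \<and> z = (m, n, k)"
      using yz unfolding c by (simp only: mon_mult_zero)
  qed
  then have 1: "(\<Phi> \<otimes> X) (m, n, k) = X (m, n, k)" for n k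
    by (simp only: mon_mult_zero mon_cocycle_zero \<Phi>_at_0 mult_1_left)
  have "((X \<otimes> \<Gamma>) \<otimes> \<Phi>) (mon_mult (m, n, k) (0, 0, 0)) = \<kappa> (m, n, k) (0, 0, 0) * (X \<otimes> \<Gamma>) (m, n, k) * \<Phi> (0, 0, 0)" for n k
  proof (rule mult_single)
    fix y z assume y: "y \<in> supp (X \<otimes> \<Gamma>)" and z: "z \<in> supp \<Phi>" and yz: "mon_mult y z = mon_mult (m, n, k) (0, 0, 0)"
    obtain c where c: "z = (c, 0, 0)" "c \<in> root_cone N"
      using lam_onlyD[OF lam_only_ratio_prod z] by blast
    obtain m' n' k' where y': "y = (m', n', k')" by (cases y)
    have "(m', n', k' - ones N) \<in> supp X"
      using y unfolding supp_def y' by (simp add: gau_right)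
    moreover have "c + m' = m"
      using yz unfolding c y' by (simp add: add.commute del: pointwise)
    ultimately have "c = 0"
      using c0 c by blast
    then show "y = (m, n, k) \<and> z = (0, 0, 0)"
      using yz unfolding c by (simp only: mon_mult_zero)
  qed
  then have 2: "((X \<otimes> \<Gamma>) \<otimes> \<Phi>) (m, n, k) = X (m, n, k - ones N)" for n k
    by (simp only: mon_mult_zero mon_cocycle_zero \<Phi>_at_0 mult_1_left mult_1_right gau_right)
  have "ones N * m = m"
  proof
    show "(ones N * m) i = m i" for i
      using root_cone_supported[OF m, of i] by (auto simp: ones_def)
  qed
  moreover have "\<Gamma> \<otimes> (\<Phi> \<otimes> X) = (X \<otimes> \<Gamma>) \<otimes> \<Phi>"
    using comm X unfolding g_eq by (simp add: m_assoc)
  then have "(\<Gamma> \<otimes> (\<Phi> \<otimes> X)) (m, n, k) = ((X \<otimes> \<Gamma>) \<otimes> \<Phi>) (m, n, k)" for n k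
    by simp
  ultimately have eq: "s powi (\<Sum>i=1..N. (m i)\<^sup>2) * X (m, n - m, k - ones N) = X (m, n, k - ones N)" for n k
    unfolding gau_left 1 2 by simp
  have step: "X (m, n - m, k0) \<noteq> 0" if "X (m, n, k0) \<noteq> 0" for n
    using eq[of n "k0 + ones N"] that by auto
  \<comment> \<open>Iteration yields nonzero coefficients at all T-exponents n0 - j m. For m
    \<noteq> 0 these are infinitely many monomials over the same \<Lambda>-exponent, against the
    finiteness condition of the carrier.\<close>
  have all: "X (m, (\<lambda>i. n0 i - int j * m i), k0) \<noteq> 0" for j
  proof (induction j)
    case 0
    then show ?case using x0 by (simp add: x0_eq supp_def)
  next
    case (Suc j)
    have "(\<lambda>i. n0 i - int j * m i) - m = (\<lambda>i. n0 i - int (Suc j) * m i)"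
      by (simp add: fun_eq_iff algebra_simps)
    then show ?case
      using step[OF Suc] by simp
  qed
  obtain i where i: "m i \<noteq> 0"
    using m0 by (auto simp: fun_eq_iff)
  let ?h = "\<lambda>j. (m, (\<lambda>i. n0 i - int j * m i), k0)"
  have "inj ?h"
  proof (rule injI)
    fix j j' assume "?h j = ?h j'"
    then have "(\<lambda>i. n0 i - int j * m i) = (\<lambda>i. n0 i - int j' * m i)"
      by (simp only: prod.inject)
    from fun_cong[OF this, of i] show "j = j'" using i by simp
  qed
  moreover have "range ?h \<subseteq> {x \<in> supp X. fst x = m}"
    using all by (auto simp: supp_def)
  moreover have "finite {x \<in> supp X. fst x = m}"
    using X unfolding carrier_eq series_carrier_iff by blast
  ultimately show False
    using finite_subset finite_imageD infinite_UNIV_nat by blast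
qed

lemma toda_H_commute:
  assumes "1 \<le> N"
  shows "toda_H q s N a \<otimes> toda_H q s N b = toda_H q s N b \<otimes> toda_H q s N a"
proof -
  let ?A = "toda_H q s N a" and ?B = "toda_H q s N b"
  let ?C = "?A \<otimes> ?B \<ominus> ?B \<otimes> ?A"
  note cone = cone_series_toda_H[OF assms]
  have A: "?A \<in> carrier R" "?B \<in> carrier R" using assms by simp_all
  have C: "?C x = (?A \<otimes> ?B) x - (?B \<otimes> ?A) x" for x
    using A by (simp add: diff_series_apply)
  have "?C = \<zero>"
  proof (rule commutant_eq_zero)
    show "?C \<in> carrier R" using A by simp
    show "fst x \<in> root_cone N" if "x \<in> supp ?C" for x
    proof -
      have "x \<in> supp (?A \<otimes> ?B) \<or> x \<in> supp (?B \<otimes> ?A)"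
        using that unfolding supp_def C by auto
      then show ?thesis
        using cone_series_mult[OF cone cone] unfolding cone_series_def by blast
    qed
    show "?C (0, n, k) = 0" for n k
      unfolding C using cone_series_commute_at_0[OF cone cone] by simp
    have gA: "g \<otimes> (X \<otimes> Y) = (X \<otimes> Y) \<otimes> g" if "g \<otimes> X = X \<otimes> g" "g \<otimes> Y = Y \<otimes> g" "X \<in> carrier R" "Y \<in> carrier R" for X Y
    proof -
      have "g \<otimes> (X \<otimes> Y) = g \<otimes> X \<otimes> Y"
        using that(3,4) by (simp add: m_assoc)
      also have "\<dots> = X \<otimes> (g \<otimes> Y)"
        unfolding that(1) using that(3,4) by (simp add: m_assoc)
      also have "\<dots> = (X \<otimes> Y) \<otimes> g"
        unfolding that(2) using that(3,4) by (simp add: m_assoc)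
      finally show ?thesis .
    qed
    show "g \<otimes> ?C = ?C \<otimes> g"
      using A gA[OF g_toda_H[OF assms] g_toda_H[OF assms] A] gA[OF g_toda_H[OF assms] g_toda_H[OF assms] A(2,1)]
      by (simp add: a_minus_def l_distr r_distr l_minus r_minus)
  qed
  then have "(?A \<otimes> ?B) x = (?B \<otimes> ?A) x" for x
    using C[of x] by (simp add: zero_apply)
  then show ?thesis ..
qed

lemma toda_H_quantum_torus:
  assumes "1 \<le> N"
  shows "toda_H q s N a \<in> quantum_torus N"
proof -
  have "supp (toda_H q s N a) \<subseteq> (\<lambda>(I, K). (root_sum K, indic I, 0)) ` (Pow {1..N} \<times> Pow {1..<N})"
  proof
    fix x assume "x \<in> supp (toda_H q s N a)"
    then show "x \<in> (\<lambda>(I, K). (root_sum K, indic I, 0)) ` (Pow {1..N} \<times> Pow {1..<N})"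
      by (rule supp_toda_H[OF assms]) auto
  qed
  then have "finite (supp (toda_H q s N a))"
    by (rule finite_subset) simp
  moreover have "\<forall>(m, n, k)\<in>supp (toda_H q s N a). k = 0"
    using cone_series_toda_H[OF assms, of a] by (auto simp: cone_series_def)
  ultimately show ?thesis
    using toda_H_closed[OF assms] by (simp add: quantum_torus_def carrier_eq)
qed

lemma sum_fst_toda_H:
  assumes "1 \<le> N" "x \<in> supp (toda_H q s N a)"
  shows "(\<Sum>i=1..N. fst x i) = 0"
  by (rule supp_toda_H[OF assms]) (simp only: fst_conv sum_root_sum)

subsection \<open>Laurent expansions in the initial data\<close>

text \<open>Monomials up to an unspecified nonzero scalar: the scalars from reordering are absorbed
  later into the coefficients of the Laurent polynomial.\<close>

definition scaled_monomial :: "expo \<Rightarrow> expo \<Rightarrow> (mon \<Rightarrow> complex) \<Rightarrow> bool" where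
  "scaled_monomial m n X \<longleftrightarrow> supported_on N (m, n, 0) \<and> (\<exists>c. c \<noteq> 0 \<and> X = c \<odot> basis (m, n, 0))"

lemma scaled_monomial_closed: "scaled_monomial m n X \<Longrightarrow> X \<in> carrier R"
  by (auto simp: scaled_monomial_def basis_closed)

lemma scaled_monomial_one: "scaled_monomial 0 0 \<one>"
  unfolding scaled_monomial_def one_eq by (auto intro!: exI[of _ 1])

lemma scaled_monomial_mult:
  assumes "scaled_monomial m n X" "scaled_monomial m' n' Y"
  shows "scaled_monomial (m + m') (n + n') (X \<otimes> Y)"
proof -
  obtain c where c: "c \<noteq> 0" "X = c \<odot> basis (m, n, 0)" "supported_on N (m, n, 0)"
    using assms(1) unfolding scaled_monomial_def by blast
  obtain d where d: "d \<noteq> 0" "Y = d \<odot> basis (m', n', 0)" "supported_on N (m', n', 0)"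
    using assms(2) unfolding scaled_monomial_def by blast
  have e: "mon_mult (m, n, 0) (m', n', 0) = (m + m', n + n', 0)"
    by (simp add: fun_eq_iff)
  have "X \<otimes> Y = (c * (d * \<kappa> (m, n, 0) (m', n', 0))) \<odot> basis (m + m', n + n', 0)"
    using c(3) d(3) unfolding c(2) d(2) e[symmetric]
    by (simp add: smult_mult_left smult_mult_right basis_closed basis_mult_basis mult.left_commute del: mon_mult.simps mon_cocycle.simps)
  moreover have "c * (d * \<kappa> (m, n, 0) (m', n', 0)) \<noteq> 0"
    using c(1) d(1) q_nonzero s_nonzero by (simp add: mon_cocycle_nonzero)
  moreover have "supported_on N (m + m', n + n', 0)"
    using supported_on_mult[OF c(3) d(3)] unfolding e .
  ultimately show ?thesis
    unfolding scaled_monomial_def by blast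
qed

lemma scaled_monomial_Units:
  assumes "scaled_monomial m n X"
  shows "X \<in> Units R"
  using assms unfolding scaled_monomial_def by (auto intro!: smult_Units basis_Units)

lemma scaled_monomial_inv:
  assumes "scaled_monomial m n X"
  shows "scaled_monomial (- m) (- n) (inv X)"
proof -
  have supp: "supported_on N (- m, - n, 0)"
    using assms unfolding scaled_monomial_def supported_on_def by auto
  have "scaled_monomial (- m) (- n) (basis (- m, - n, 0))"
    unfolding scaled_monomial_def using supp by (auto intro!: exI[of _ 1])
  note inv1 = this
  from scaled_monomial_mult[OF assms this]
  obtain c where c: "c \<noteq> 0" "X \<otimes> basis (- m, - n, 0) = c \<odot> \<one>"
    unfolding scaled_monomial_def one_eq right_minus by blast
  have cl: "basis (- m, - n, 0) \<in> carrier R" "X \<in> carrier R"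
    using supp basis_closed assms scaled_monomial_closed by blast+
  have "inv X \<otimes> (X \<otimes> basis (- m, - n, 0)) = basis (- m, - n, 0)"
    using cl scaled_monomial_Units[OF assms] by (simp add: m_assoc[symmetric])
  then have "c \<odot> inv X = basis (- m, - n, 0)"
    unfolding c(2) using scaled_monomial_Units[OF assms] by (simp add: smult_mult_right)
  then have "inv X = inverse c \<odot> basis (- m, - n, 0)"
    using c(1) by (metis left_inverse smult_1 smult_smult)
  then show ?thesis
    using supp c(1) unfolding scaled_monomial_def by (auto intro!: exI[of _ "inverse c"])
qed

lemma scaled_monomial_int_pow:
  assumes "scaled_monomial m n X"
  shows "scaled_monomial (\<lambda>i. z * m i) (\<lambda>i. z * n i) (X [^] (z::int))"
proof -
  have nat: "scaled_monomial (\<lambda>i. int l * m i) (\<lambda>i. int l * n i) (X [^] l)" for l :: nat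
  proof (induction l)
    case 0
    have "(\<lambda>i. int 0 * m i) = 0" "(\<lambda>i. int 0 * n i) = 0"
      by (auto simp: fun_eq_iff)
    then show ?case
      using scaled_monomial_one by (simp only: nat_pow_0)
  next
    case (Suc l)
    have "(\<lambda>i. int l * m i) + m = (\<lambda>i. int (Suc l) * m i)" "(\<lambda>i. int l * n i) + n = (\<lambda>i. int (Suc l) * n i)"
      by (auto simp: fun_eq_iff algebra_simps)
    then show ?case
      using scaled_monomial_mult[OF Suc assms] by (simp only: nat_pow_Suc)
  qed
  show ?thesis
  proof (cases "z < 0")
    case False
    then have "int (nat z) = z" "X [^] z = X [^] nat z"
      using int_pow_int[of R X "nat z"] by simp_all
    then show ?thesis
      using nat[of "nat z"] by (simp only:)
  next
    case True
    then have "- (\<lambda>i. int (nat (- z)) * m i) = (\<lambda>i. z * m i)" "- (\<lambda>i. int (nat (- z)) * n i) = (\<lambda>i. z * n i)"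
      "X [^] z = inv (X [^] nat (- z))"
      unfolding int_pow_def2[of R X z] by (auto simp: fun_eq_iff)
    then show ?thesis
      using scaled_monomial_inv[OF nat[of "nat (- z)"]] by (simp only:)
  qed
qed

lemma scaled_monomial_ord_prod:
  assumes "\<And>i. i \<in> {1..l} \<Longrightarrow> scaled_monomial (m i) (n i) (f i)"
  shows "scaled_monomial (\<lambda>j. \<Sum>i=1..l. m i j) (\<lambda>j. \<Sum>i=1..l. n i j) (ord_prod R l f)"
  using assms
proof (induction l)
  case 0
  have "(\<lambda>j. \<Sum>i=1..0. m i j) = 0" "(\<lambda>j. \<Sum>i=1..0. n i j) = 0"
    by (auto simp: fun_eq_iff)
  then show ?case
    using scaled_monomial_one by (simp only: ord_prod_0)
next
  case (Suc l)
  have "ord_prod R (Suc l) f = ord_prod R l f \<otimes> f (Suc l)"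
    using Suc.prems by (intro ord_prod_Suc scaled_monomial_closed)
  moreover have "scaled_monomial ((\<lambda>j. \<Sum>i=1..l. m i j) + m (Suc l)) ((\<lambda>j. \<Sum>i=1..l. n i j) + n (Suc l))
      (ord_prod R l f \<otimes> f (Suc l))"
    using Suc by (intro scaled_monomial_mult) simp_all
  moreover have "(\<lambda>j. \<Sum>i=1..l. m i j) + m (Suc l) = (\<lambda>j. \<Sum>i=1..Suc l. m i j)"
    "(\<lambda>j. \<Sum>i=1..l. n i j) + n (Suc l) = (\<lambda>j. \<Sum>i=1..Suc l. n i j)"
    by (auto simp: fun_eq_iff)
  ultimately show ?case
    by (simp only:)
qed

definition laurent_mon :: "int \<Rightarrow> expo \<times> expo \<Rightarrow> (mon \<Rightarrow> complex)" where
  "laurent_mon k e = ord_prod R N (\<lambda>i. D i k [^] fst e i) \<otimes> ord_prod R N (\<lambda>i. D i (k + 1) [^] snd e i)"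

lemma D_pow_closed: "i \<in> {1..N} \<Longrightarrow> D i k [^] (z::int) \<in> carrier R"
  by (intro Units_closed Units_int_pow_Units D_Units) simp

lemma laurent_mon_closed [simp]: "laurent_mon k e \<in> carrier R"
  unfolding laurent_mon_def by (intro m_closed ord_prod_closed D_pow_closed)

lemma laurent_eval_apply:
  assumes "finite S" "Poly_Mapping.keys p \<subseteq> S"
  shows "laurent_eval R N p (\<lambda>i. D i k) (\<lambda>i. D i (k + 1)) x =
    (\<Sum>e\<in>S. Poly_Mapping.lookup p e * laurent_mon k e x)"
proof -
  have "laurent_eval R N p (\<lambda>i. D i k) (\<lambda>i. D i (k + 1)) x =
      (\<Sum>e\<in>Poly_Mapping.keys p. Poly_Mapping.lookup p e * laurent_mon k e x)"
    unfolding laurent_eval_def laurent_mon_def[symmetric]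
    by (subst finsum_apply) (simp_all add: smult_apply)
  also have "\<dots> = (\<Sum>e\<in>S. Poly_Mapping.lookup p e * laurent_mon k e x)"
    using assms by (intro sum.mono_neutral_left) (auto simp: in_keys_iff)
  finally show ?thesis .
qed

lemma inv_smult:
  assumes "X \<in> Units R" "c \<noteq> 0"
  shows "inv (c \<odot> X) = inverse c \<odot> inv X"
  using assms by (intro inv_unique'[symmetric]) (auto simp: smult_mult_left smult_mult_right Units_closed)

lemma g_conj_inv:
  assumes "X \<in> Units R"
  shows "inv (g_conj k X) = g_conj k (inv X)"
  using assms by (intro inv_unique'[symmetric]) (auto simp: g_conj_mult[symmetric] Units_closed)

lemma scaled_g_conj_pow:
  assumes "X \<in> Units R" "c \<noteq> 0"
  shows "(c \<odot> g_conj k X) [^] (z::int) = c powi z \<odot> g_conj k (X [^] z)"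
proof -
  have [simp]: "X \<in> carrier R" using assms Units_closed by blast
  have nat: "(c \<odot> g_conj k X) [^] l = c ^ l \<odot> g_conj k (X [^] l)" for l :: nat
    by (induction l) (simp_all add: smult_mult_left smult_mult_right g_conj_mult mult.commute)
  have U: "X [^] l \<in> Units R" for l :: nat
    by (induction l) (use assms in auto)
  show ?thesis
  proof (cases "z < 0")
    case True
    have "inv (c ^ l \<odot> g_conj k (X [^] l)) = inverse c ^ l \<odot> g_conj k (inv (X [^] l))" for l :: nat
    proof -
      have "c ^ l \<noteq> 0" using assms(2) by simp
      from inv_smult[OF g_conj_Units[OF U] this] show ?thesis
        by (simp only: g_conj_inv[OF U] power_inverse)
    qed
    with True show ?thesis
      by (simp only: int_pow_def2 nat power_int_def if_True) (simp del: inverse_eq_divide)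
  next
    case False
    then show ?thesis
      unfolding int_pow_def2 by (simp add: nat power_int_def)
  qed
qed

lemma ord_prod_scaled_g_conj:
  assumes "\<And>i. i \<in> {1..l} \<Longrightarrow> f i = c i \<odot> g_conj k (h i)" "\<And>i. i \<in> {1..l} \<Longrightarrow> h i \<in> carrier R"
  shows "ord_prod R l f = (\<Prod>i=1..l. c i) \<odot> g_conj k (ord_prod R l h)"
  using assms
proof (induction l)
  case (Suc l)
  have "ord_prod R (Suc l) f = ord_prod R l f \<otimes> f (Suc l)"
    using Suc.prems by (intro ord_prod_Suc) simp
  moreover have "ord_prod R (Suc l) h = ord_prod R l h \<otimes> h (Suc l)"
    using Suc.prems by (intro ord_prod_Suc) simp
  moreover have "ord_prod R l h \<in> carrier R" "h (Suc l) \<in> carrier R"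
    using Suc.prems by auto
  ultimately show ?case
    using Suc by (simp add: smult_mult_left smult_mult_right g_conj_mult mult.commute)
qed simp

text \<open>Relative to the conjugates of \<open>D i 0\<close> and \<open>D i 1\<close>, both
  \<open>D i k\<close> and \<open>D i (k + 1)\<close> carry s^(-ik), so a monomial collects s^(-kd)
  with d its degree when index i has weight i.\<close>

lemma laurent_mon_shift:
  "laurent_mon k e = s powi (- k * (\<Sum>i=1..N. int i * (fst e i + snd e i))) \<odot> g_conj k (laurent_mon 0 e)"
proof -
  have pow: "D i (k + j) [^] z = s powi (- (k * (int i * z))) \<odot> g_conj k (D i j [^] z)" if "i \<in> {1..N}" for i j and z :: int
  proof -
    have "(s powi (- (int i * k)) \<odot> g_conj k (D i j)) [^] z = (s powi (- (int i * k))) powi z \<odot> g_conj k (D i j [^] z)"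
      using that s_nonzero by (intro scaled_g_conj_pow D_Units) auto
    also have "(s powi (- (int i * k))) powi z = s powi (- (k * (int i * z)))"
      by (simp add: power_int_mult[symmetric] mult_ac)
    finally show ?thesis
      by (simp only: D_shift)
  qed
  have prod: "(\<Prod>i=1..N. s powi (- (k * (int i * z i)))) = s powi (- (k * (\<Sum>i=1..N. int i * z i)))" for z
  proof -
    have "(\<Prod>i=1..l. s powi (- (k * (int i * z i)))) = s powi (- (k * (\<Sum>i=1..l. int i * z i)))" for l
      by (induction l) (simp_all add: s_nonzero power_int_add[symmetric] algebra_simps)
    then show ?thesis .
  qed
  have 1: "ord_prod R N (\<lambda>i. D i k [^] fst e i) =
      s powi (- (k * (\<Sum>i=1..N. int i * fst e i))) \<odot> g_conj k (ord_prod R N (\<lambda>i. D i 0 [^] fst e i))"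
    unfolding prod[symmetric]
    by (rule ord_prod_scaled_g_conj) (use pow[of _ 0] D_pow_closed in simp_all)
  have 2: "ord_prod R N (\<lambda>i. D i (k + 1) [^] snd e i) =
      s powi (- (k * (\<Sum>i=1..N. int i * snd e i))) \<odot> g_conj k (ord_prod R N (\<lambda>i. D i (0 + 1) [^] snd e i))"
    unfolding prod[symmetric]
    by (rule ord_prod_scaled_g_conj) (use pow[of _ 1] D_pow_closed in simp_all)
  have c: "ord_prod R N (\<lambda>i. D i 0 [^] fst e i) \<in> carrier R" "ord_prod R N (\<lambda>i. D i (0 + 1) [^] snd e i) \<in> carrier R"
    by (intro ord_prod_closed D_pow_closed; assumption)+
  have "s powi (- (k * (\<Sum>i=1..N. int i * fst e i))) * s powi (- (k * (\<Sum>i=1..N. int i * snd e i))) =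
      s powi (- k * (\<Sum>i=1..N. int i * (fst e i + snd e i)))"
    using s_nonzero by (simp add: power_int_add[symmetric] distrib_left sum.distrib)
  then show ?thesis
    using c unfolding laurent_mon_def 1 2
    by (simp add: smult_mult_left smult_mult_right g_conj_mult mult.commute)
qed

text \<open>The exponents that express \<Lambda>^m T^n in the initial data. The T-part fixes the
  powers of \<open>D i 1\<close> as consecutive differences of n; these powers also supply
  \<Lambda>^n, so \<open>D i 0\<close> only has to supply \<Lambda>^(m-n).\<close>

definition laurent_expo :: "mon \<Rightarrow> expo \<times> expo" where
  "laurent_expo = (\<lambda>(m, n, k). (\<lambda>i. (m i - m (i + 1)) - (n i - n (i + 1)), \<lambda>i. n i - n (i + 1)))"

text \<open>Expansion in the basis of fundamental weights; the value 0 at N + 1 closes the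
  telescope.\<close>

lemma telescope:
  fixes m :: expo
  assumes "\<And>i. i \<notin> {1..N} \<Longrightarrow> m i = 0"
  shows "(\<lambda>j. \<Sum>i=1..N. (m i - m (i + 1)) * ones i j) = m"
proof
  fix j
  show "(\<Sum>i=1..N. (m i - m (i + 1)) * ones i j) = m j"
  proof (cases "j \<in> {1..N}")
    case True
    have "(\<Sum>i=1..N. (m i - m (i + 1)) * ones i j) = (\<Sum>i=j..N. m i - m (Suc i))"
      using True by (intro sum.mono_neutral_cong_right) (auto simp: ones_def)
    also have "\<dots> = m j - m (Suc N)"
      using True sum_Suc_diff'[of j "Suc N" "\<lambda>i. - m i"]
      by (simp add: atLeastLessThanSuc_atLeastAtMost)
    finally show ?thesis
      using assms[of "Suc N"] by simp
  next
    case False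
    then have "(\<Sum>i=1..N. (m i - m (i + 1)) * ones i j) = 0"
      by (intro sum.neutral) (auto simp: ones_def)
    with False show ?thesis using assms by simp
  qed
qed

lemma sum_telescope:
  fixes m :: expo
  assumes "\<And>i. i \<notin> {1..N} \<Longrightarrow> m i = 0"
  shows "(\<Sum>i=1..N. int i * (m i - m (i + 1))) = (\<Sum>i=1..N. m i)"
proof -
  have "(\<Sum>j=1..N. m j) = (\<Sum>j=1..N. \<Sum>i=1..N. (m i - m (i + 1)) * ones i j)"
    using fun_cong[OF telescope[of m, OF assms]] by simp
  also have "\<dots> = (\<Sum>i=1..N. (m i - m (i + 1)) * (\<Sum>j=1..N. ones i j))"
    by (subst sum.swap) (simp add: sum_distrib_left)
  also have "\<dots> = (\<Sum>i=1..N. int i * (m i - m (i + 1)))"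
  proof (intro sum.cong refl)
    fix i assume i: "i \<in> {1..N}"
    have "(\<Sum>j=1..N. ones i j) = (\<Sum>j\<in>{1..i}. 1)"
      using i by (intro sum.mono_neutral_cong_right) (auto simp: ones_def)
    then show "(m i - m (i + 1)) * (\<Sum>j=1..N. ones i j) = int i * (m i - m (i + 1))"
      by simp
  qed
  finally show ?thesis ..
qed

lemma laurent_mon_0:
  assumes "supported_on N (m, n, 0)"
  shows "scaled_monomial m n (laurent_mon 0 (laurent_expo (m, n, 0)))"
proof -
  have m: "\<And>i. i \<notin> {1..N} \<Longrightarrow> m i = 0" and n: "\<And>i. i \<notin> {1..N} \<Longrightarrow> n i = 0"
    using assms by (auto simp: supported_on_def)
  have D0: "scaled_monomial (ones i) 0 (D i 0)" if "i \<in> {1..N}" for i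
    using that unfolding scaled_monomial_def
    by (auto simp: D_at_0 supported_on_def ones_def intro!: exI[of _ 1])
  have D1: "scaled_monomial (ones i) (ones i) (D i 1)" if "i \<in> {1..N}" for i
    using that unfolding scaled_monomial_def
    by (auto simp: D_at_1 supported_on_def ones_def intro!: exI[of _ 1])
  let ?u = "fst (laurent_expo (m, n, 0))" and ?v = "snd (laurent_expo (m, n, 0))"
  have 1: "scaled_monomial (\<lambda>j. \<Sum>i=1..N. ?u i * ones i j) (\<lambda>j. \<Sum>i=1..N. ?u i * 0 j)
      (ord_prod R N (\<lambda>i. D i 0 [^] ?u i))"
    by (rule scaled_monomial_ord_prod) (rule scaled_monomial_int_pow[OF D0])
  have 2: "scaled_monomial (\<lambda>j. \<Sum>i=1..N. ?v i * ones i j) (\<lambda>j. \<Sum>i=1..N. ?v i * ones i j)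
      (ord_prod R N (\<lambda>i. D i (0 + 1) [^] ?v i))"
    unfolding add_0 by (rule scaled_monomial_ord_prod) (rule scaled_monomial_int_pow[OF D1])
  have v: "(\<lambda>j. \<Sum>i=1..N. ?v i * ones i j) = n"
    unfolding laurent_expo_def prod.case snd_conv by (rule telescope[OF n])
  have "(\<lambda>j. \<Sum>i=1..N. ?u i * ones i j) + (\<lambda>j. \<Sum>i=1..N. ?v i * ones i j) =
      (\<lambda>j. \<Sum>i=1..N. (m i - m (i + 1)) * ones i j)"
    by (simp add: fun_eq_iff laurent_expo_def sum.distrib[symmetric] algebra_simps)
  also have "\<dots> = m"
    by (rule telescope[OF m])
  finally have u: "(\<lambda>j. \<Sum>i=1..N. ?u i * ones i j) + (\<lambda>j. \<Sum>i=1..N. ?v i * ones i j) = m" .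
  have w: "(\<lambda>j. \<Sum>i=1..N. ?u i * 0 j) + n = n"
    by (simp add: fun_eq_iff)
  show ?thesis
    using scaled_monomial_mult[OF 1 2] unfolding laurent_mon_def v u[unfolded v] w .
qed

text \<open>\<open>D i 0\<close> and \<open>D i 1\<close> both have degree i in the \<Lambda>'s, so
  the weighted degree is the total \<Lambda>-degree.\<close>

lemma degree_laurent_expo:
  assumes "supported_on N (m, n, k)"
  shows "(\<Sum>i=1..N. int i * (fst (laurent_expo (m, n, k)) i + snd (laurent_expo (m, n, k)) i)) = (\<Sum>i=1..N. m i)"
  using sum_telescope[of m] assms by (auto simp: laurent_expo_def supported_on_def)

text \<open>
  The scalars in \<open>D a k = s\<^bsup>-ak\<^esup> g\<^sup>k (D a 0) g\<^bsup>-k\<^esup>\<close> cancel in expressions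
  of total \<open>\<Lambda>\<close>-degree \<open>0\<close>, so that time translation acts on these as conjugation.
\<close>

lemma laurent_expansion:
  assumes X: "X \<in> quantum_torus N" and deg: "\<And>x. x \<in> supp X \<Longrightarrow> (\<Sum>i=1..N. fst x i) = 0"
    and comm: "g \<otimes> X = X \<otimes> g"
  shows "\<exists>p. \<forall>k. laurent_eval R N p (\<lambda>i. D i k) (\<lambda>i. D i (k + 1)) = X"
proof -
  have Xc: "X \<in> carrier R" and fin: "finite (supp X)"
    using X by (auto simp: quantum_torus_def carrier_eq)
  have sup: "supported_on N x" "snd (snd x) = 0" if "x \<in> supp X" for x
    using X that unfolding quantum_torus_def series_carrier_iff by auto
  have "\<exists>c. c \<noteq> 0 \<and> laurent_mon 0 (laurent_expo x) = c \<odot> basis x" if xX: "x \<in> supp X" for x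
  proof -
    obtain m n where x: "x = (m, n, 0)"
      using sup(2)[OF xX] by (cases x) auto
    show ?thesis
      using laurent_mon_0[of m n] sup(1)[OF xX] unfolding x scaled_monomial_def by blast
  qed
  then obtain c where c: "\<And>x. x \<in> supp X \<Longrightarrow> c x \<noteq> 0 \<and> laurent_mon 0 (laurent_expo x) = c x \<odot> basis x"
    by metis
  \<comment> \<open>Each coefficient is divided by the scalar of its ordered monomial; a sum of
    singletons adds up whatever falls on the same exponents.\<close>
  define p where "p = (\<Sum>x\<in>supp X. Poly_Mapping.single (laurent_expo x) (X x / c x))"
  have lookup: "Poly_Mapping.lookup p e = (\<Sum>x\<in>supp X. if laurent_expo x = e then X x / c x else 0)" for e
    unfolding p_def by (simp add: lookup_sum lookup_single when_def)
  have keys: "Poly_Mapping.keys p \<subseteq> laurent_expo ` supp X"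
  proof
    fix e assume "e \<in> Poly_Mapping.keys p"
    then have "(\<Sum>x\<in>supp X. if laurent_expo x = e then X x / c x else 0) \<noteq> 0"
      by (simp add: in_keys_iff lookup)
    then obtain x where "x \<in> supp X" "(if laurent_expo x = e then X x / c x else 0) \<noteq> 0"
      by (rule sum.not_neutral_contains_not_neutral)
    then show "e \<in> laurent_expo ` supp X"
      by (auto split: if_splits)
  qed
  have cl: "X x \<odot> basis x \<in> carrier R" if "x \<in> supp X" for x
    using sup(1)[OF that] basis_closed smult_closed by blast
  have X_sum: "X = finsum R (\<lambda>x. X x \<odot> basis x) (supp X)"
  proof
    fix w
    have "(\<Sum>x\<in>supp X. X x * basis x w) = X w"
    proof (cases "w \<in> supp X")
      case True
      have "(\<Sum>x\<in>supp X. X x * basis x w) = (\<Sum>x\<in>{w}. X x * basis x w)"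
        using True fin by (intro sum.mono_neutral_right) (auto simp: basis_def)
      then show ?thesis by (simp add: basis_def)
    next
      case False
      then have "(\<Sum>x\<in>supp X. X x * basis x w) = 0"
        by (intro sum.neutral) (auto simp: basis_def)
      with False show ?thesis by (simp add: supp_def)
    qed
    then show "X w = finsum R (\<lambda>x. X x \<odot> basis x) (supp X) w"
      using cl by (simp add: finsum_apply smult_apply)
  qed
  have "laurent_eval R N p (\<lambda>i. D i k) (\<lambda>i. D i (k + 1)) = X" for k
  proof
    fix w
    have mon: "(X x / c x) * laurent_mon k (laurent_expo x) w = (g_conj k (X x \<odot> basis x)) w" if x: "x \<in> supp X" for x
    proof -
      obtain m n l where mnl: "x = (m, n, l)" by (cases x)
      \<comment> \<open>Total \<Lambda>-degree 0 makes the power of s trivial and leaves pure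
        conjugation.\<close>
      have "laurent_mon k (laurent_expo x) = c x \<odot> g_conj k (basis x)"
        using laurent_mon_shift[of k "laurent_expo x"] degree_laurent_expo[of m n l] deg[OF x] sup(1)[OF x] c[OF x]
          basis_closed[OF sup(1)[OF x]]
        unfolding mnl by (simp add: g_conj_smult)
      then show ?thesis
        using c[OF x] basis_closed[OF sup(1)[OF x]] by (simp add: g_conj_smult smult_apply)
    qed
    have "laurent_eval R N p (\<lambda>i. D i k) (\<lambda>i. D i (k + 1)) w =
        (\<Sum>e\<in>laurent_expo ` supp X. (\<Sum>x\<in>supp X. if laurent_expo x = e then X x / c x else 0) * laurent_mon k e w)"
      using fin keys by (subst laurent_eval_apply[of "laurent_expo ` supp X"]) (simp_all add: lookup)
    also have "\<dots> = (\<Sum>x\<in>supp X. \<Sum>e\<in>laurent_expo ` supp X. (if laurent_expo x = e then (X x / c x) * laurent_mon k e w else 0))"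
      unfolding sum_distrib_right by (subst sum.swap) (intro sum.cong refl, simp)
    also have "\<dots> = (\<Sum>x\<in>supp X. (X x / c x) * laurent_mon k (laurent_expo x) w)"
      using fin by (intro sum.cong refl) (simp add: sum.delta')
    also have "\<dots> = (\<Sum>x\<in>supp X. (g_conj k (X x \<odot> basis x)) w)"
      by (intro sum.cong refl mon)
    also have "\<dots> = finsum R (\<lambda>x. g_conj k (X x \<odot> basis x)) (supp X) w"
      using cl by (simp add: finsum_apply)
    \<comment> \<open>Conjugation is additive on the finite sum; the sum is X, which is fixed
      because it commutes with g.\<close>
    also have "finsum R (\<lambda>x. g_conj k (X x \<odot> basis x)) (supp X) = g_conj k (finsum R (\<lambda>x. X x \<odot> basis x) (supp X))"
      unfolding g_conj_def using cl fin by (subst finsum_rdistr, auto, subst finsum_ldistr, auto)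
    also have "\<dots> = X"
      unfolding X_sum[symmetric] using g_conj_fixed[OF Xc comm] .
    finally show "laurent_eval R N p (\<lambda>i. D i k) (\<lambda>i. D i (k + 1)) w = X w" .
  qed
  then show ?thesis by blast
qed

lemma conserved_toda_H:
  assumes "1 \<le> N"
  shows "conserved_quantity q s N (toda_H q s N a)"
proof -
  obtain p where p: "\<And>k. laurent_eval R N p (\<lambda>i. D i k) (\<lambda>i. D i (k + 1)) = toda_H q s N a"
    using laurent_expansion[OF toda_H_quantum_torus[OF assms] _ g_toda_H[OF assms]] sum_fst_toda_H[OF assms]
    by blast
  have "laurent_eval R N p (\<lambda>i. D i 0) (\<lambda>i. D i 1) = toda_H q s N a"
    using p[of 0] by simp
  then show ?thesis
    unfolding conserved_quantity_def R_def[symmetric] Dbar_eq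
    using p toda_H_quantum_torus[OF assms] g_toda_H[OF assms] by (intro conjI exI[of _ p]) auto
qed

end

section \<open>Algebraic independence\<close>

text \<open>Comparing all partial sums is the dominance order.\<close>

definition partial_sum :: "expo \<Rightarrow> nat \<Rightarrow> int" where
  "partial_sum n j = (\<Sum>i=1..j. n i)"

lemma partial_sum_add: "partial_sum (n + n') j = partial_sum n j + partial_sum n' j"
  by (simp add: partial_sum_def sum.distrib)

text \<open>Partial sums start at index 1, hence the separate condition at 0.\<close>

lemma expo_eqI:
  assumes "n 0 = n' 0" "\<And>j. partial_sum n j = partial_sum n' j"
  shows "n = n'"
proof
  fix j
  show "n j = n' j"
  proof (cases j)
    case (Suc i)
    then show ?thesis
      using assms(2)[of "Suc i"] assms(2)[of i] by (simp add: partial_sum_def)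
  qed (simp add: assms(1))
qed

lemma partial_sum_indic:
  "partial_sum (indic I) j = int (card (I \<inter> {1..j}))"
proof -
  have "(\<Sum>i=1..j. indic I i) = (\<Sum>i\<in>I \<inter> {1..j}. 1)"
    by (intro sum.mono_neutral_cong_right) (auto simp: indic_def)
  then show ?thesis by (simp add: partial_sum_def)
qed

lemma ones_eq_indic: "ones a = indic {1..a}"
  by (simp add: ones_def indic_def)

context toda begin

text \<open>
  The leading monomial \<open>T\<^sup>\<nu>\<close> is taken with respect to the dominance order on the exponents.
\<close>

definition leading :: "expo \<Rightarrow> (mon \<Rightarrow> complex) \<Rightarrow> bool" where
  "leading \<nu> f \<longleftrightarrow> cone_series f \<and> f (0, \<nu>, 0) = 1 \<and>
     (\<forall>m n k j. (m, n, k) \<in> supp f \<longrightarrow> partial_sum n j \<le> partial_sum \<nu> j)"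

lemma leading_closed: "leading \<nu> f \<Longrightarrow> f \<in> carrier R"
  by (simp add: leading_def)

lemma leading_le: "leading \<nu> f \<Longrightarrow> (m, n, k) \<in> supp f \<Longrightarrow> partial_sum n j \<le> partial_sum \<nu> j"
  unfolding leading_def by blast

text \<open>Dominance inequalities add, and equality of the sums forces equality in both. Together
  with pointedness for the \<Lambda>-part, only the two leading monomials produce the leading
  monomial of the product, and their cocycle is 1.\<close>

lemma leading_mult:
  assumes f: "leading \<nu> f" and h: "leading \<nu>' h"
  shows "leading (\<nu> + \<nu>') (f \<otimes> h)"
proof -
  have cone: "cone_series f" "cone_series h"
    using f h by (simp_all add: leading_def)
  have zero: "n 0 = 0" if "u \<in> carrier R" "(m, n, k) \<in> supp u" for u m n k
    using that unfolding carrier_eq series_carrier_iff by (auto simp: supported_on_def)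
  have nz: "(0, \<nu>, 0) \<in> supp f" "(0, \<nu>', 0) \<in> supp h"
    using f h by (simp_all add: leading_def supp_def)
  have "(f \<otimes> h) (mon_mult (0, \<nu>, 0) (0, \<nu>', 0)) = \<kappa> (0, \<nu>, 0) (0, \<nu>', 0) * f (0, \<nu>, 0) * h (0, \<nu>', 0)"
  proof (rule mult_single)
    fix y z assume y: "y \<in> supp f" and z: "z \<in> supp h"
      and yz: "mon_mult y z = mon_mult (0, \<nu>, 0) (0, \<nu>', 0)"
    obtain m n where y': "y = (m, n, 0)" "m \<in> root_cone N"
      using cone_seriesD[OF cone(1) y] .
    obtain m' n' where z': "z = (m', n', 0)" "m' \<in> root_cone N"
      using cone_seriesD[OF cone(2) z] .
    have e: "m + m' = 0" "n + n' + 0 * m' = \<nu> + \<nu>' + 0 * 0"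
      using yz unfolding y' z' mon_mult.simps by (simp_all only: prod.inject add_0_left)
    have m: "m = 0" "m' = 0"
      using root_cone_add_eq_0[OF y'(2) z'(2) e(1)] by blast+
    have nn: "n + n' = \<nu> + \<nu>'"
      using e(2) by (simp add: fun_eq_iff)
    have "partial_sum n j = partial_sum \<nu> j" "partial_sum n' j = partial_sum \<nu>' j" for j
    proof -
      have "partial_sum n j + partial_sum n' j = partial_sum \<nu> j + partial_sum \<nu>' j"
        unfolding partial_sum_add[symmetric] nn ..
      moreover have "partial_sum n j \<le> partial_sum \<nu> j"
        using leading_le[OF f] y unfolding y' by blast
      moreover have "partial_sum n' j \<le> partial_sum \<nu>' j"
        using leading_le[OF h] z unfolding z' by blast
      ultimately show "partial_sum n j = partial_sum \<nu> j" "partial_sum n' j = partial_sum \<nu>' j"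
        by linarith+
    qed
    moreover have "n 0 = \<nu> 0" "n' 0 = \<nu>' 0"
      using zero[OF leading_closed[OF f]] zero[OF leading_closed[OF h]] nz y z unfolding y' z' by metis+
    ultimately show "y = (0, \<nu>, 0) \<and> z = (0, \<nu>', 0)"
      unfolding y' z' m by (simp add: expo_eqI)
  qed
  moreover have "mon_mult (0, \<nu>, 0) (0, \<nu>', 0) = (0, \<nu> + \<nu>', 0)"
    by (simp add: fun_eq_iff)
  ultimately have "(f \<otimes> h) (0, \<nu> + \<nu>', 0) = 1"
    using f h by (simp add: leading_def)
  moreover have "partial_sum n j \<le> partial_sum (\<nu> + \<nu>') j" if x: "(m, n, k) \<in> supp (f \<otimes> h)" for m n k j
  proof -
    obtain y z where yz: "y \<in> supp f" "z \<in> supp h" "(m, n, k) = mon_mult y z"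
      using supp_mult[OF x] by blast
    obtain m1 n1 where y: "y = (m1, n1, 0)"
      using cone_seriesD[OF cone(1) yz(1)] by metis
    obtain m2 n2 where z: "z = (m2, n2, 0)"
      using cone_seriesD[OF cone(2) yz(2)] by metis
    have "n = n1 + n2 + 0 * m2"
      using yz(3) unfolding y z mon_mult.simps by (simp only: prod.inject)
    then have n: "n = n1 + n2"
      by (simp add: fun_eq_iff)
    have "partial_sum n1 j \<le> partial_sum \<nu> j" "partial_sum n2 j \<le> partial_sum \<nu>' j"
      using leading_le[OF f] leading_le[OF h] yz(1,2) unfolding y z by blast+
    then show ?thesis
      unfolding n partial_sum_add by linarith
  qed
  ultimately show ?thesis
    unfolding leading_def using cone_series_mult[OF cone] by blast
qed

lemma leading_one: "leading 0 \<one>"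
  by (simp add: leading_def cone_series_def) (simp add: one_eq basis_def)

lemma leading_nat_pow:
  assumes "leading \<nu> f"
  shows "leading (\<lambda>i. int l * \<nu> i) (f [^] (l::nat))"
proof (induction l)
  case 0
  have "(\<lambda>i. int 0 * \<nu> i) = 0"
    by (auto simp: fun_eq_iff)
  then show ?case
    using leading_one by (simp only: nat_pow_0)
next
  case (Suc l)
  have "(\<lambda>i. int l * \<nu> i) + \<nu> = (\<lambda>i. int (Suc l) * \<nu> i)"
    by (auto simp: fun_eq_iff algebra_simps)
  then show ?case
    using leading_mult[OF Suc assms] by (simp only: nat_pow_Suc)
qed

lemma leading_ord_prod:
  assumes "\<And>i. i \<in> {1..l} \<Longrightarrow> leading (\<nu> i) (f i)"
  shows "leading (\<lambda>j. \<Sum>i=1..l. \<nu> i j) (ord_prod R l f)"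
  using assms
proof (induction l)
  case 0
  have "(\<lambda>j. \<Sum>i=1..0. \<nu> i j) = 0"
    by (auto simp: fun_eq_iff)
  then show ?case
    using leading_one by (simp only: ord_prod_0)
next
  case (Suc l)
  have "ord_prod R (Suc l) f = ord_prod R l f \<otimes> f (Suc l)"
    using Suc.prems by (intro ord_prod_Suc leading_closed)
  moreover have "leading ((\<lambda>j. \<Sum>i=1..l. \<nu> i j) + \<nu> (Suc l)) (ord_prod R l f \<otimes> f (Suc l))"
    using Suc by (intro leading_mult) simp_all
  moreover have "(\<lambda>j. \<Sum>i=1..l. \<nu> i j) + \<nu> (Suc l) = (\<lambda>j. \<Sum>i=1..Suc l. \<nu> i j)"
    by (auto simp: fun_eq_iff)
  ultimately show ?case
    by (simp only:)
qed

text \<open>The partial sum |I \<inter> [1,j]| is at most min(a, j), its value for I = [1,a]. This I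
  has no ascents, so its only term has K empty and coefficient 1.\<close>

lemma leading_toda_H:
  assumes "1 \<le> N" "a \<le> N"
  shows "leading (ones a) (toda_H q s N a)"
proof -
  have "partial_sum n j \<le> partial_sum (ones a) j" if x: "(m, n, k) \<in> supp (toda_H q s N a)" for m n k j
  proof (rule supp_toda_H[OF assms(1) x])
    fix I K assume I: "I \<subseteq> {1..N}" "card I = a" and "(m, n, k) = (root_sum K, indic I, 0)"
    then have n: "n = indic I" by simp
    have "finite I" using I(1) by (rule finite_subset) simp
    then have "card (I \<inter> {1..j}) \<le> a" "card (I \<inter> {1..j}) \<le> j"
      using card_mono[of I "I \<inter> {1..j}"] card_mono[of "{1..j}" "I \<inter> {1..j}"] I(2) by auto
    moreover have "{1..a} \<inter> {1..j} = {1..min a j}" by auto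
    ultimately show "partial_sum n j \<le> partial_sum (ones a) j"
      unfolding n ones_eq_indic partial_sum_indic by simp
  qed
  moreover have "toda_H q s N a (0, ones a, 0) = 1"
  proof -
    let ?S = "Sigma (subsets a) (\<lambda>I. Pow (ascents I))"
    let ?f = "\<lambda>(I, K). (- 1) ^ card K * basis (root_sum K, indic I, 0) (0, ones a, 0)"
    have asc: "ascents {1..a} = {}"
      by (auto simp: ascents_def)
    have "sum ?f ?S = sum ?f {({1..a}, {})}"
    proof (rule sum.mono_neutral_right)
      show "finite ?S"
        by (intro finite_SigmaI finite_subsets) (auto intro: finite_subset[OF ascents_subset])
      show "{({1..a}, {})} \<subseteq> ?S"
        using assms(2) by auto
      show "\<forall>p\<in>?S - {({1..a}, {})}. ?f p = 0"
      proof
        fix p assume p: "p \<in> ?S - {({1..a}, {})}"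
        obtain I K where IK: "p = (I, K)" by (cases p)
        have "indic I \<noteq> ones a"
        proof
          assume e: "indic I = ones a"
          have "i \<in> I \<longleftrightarrow> i \<in> {1..a}" for i
            using fun_cong[OF e, of i] by (auto simp: ones_def indic_def split: if_splits)
          then have "I = {1..a}" by blast
          then show False
            using p asc unfolding IK by auto
        qed
        then show "?f p = 0"
          unfolding IK by (simp add: basis_def)
      qed
    qed
    also have "\<dots> = 1"
      by (simp add: ones_eq_indic del: pointwise) (simp add: basis_def)
    finally show ?thesis
      unfolding toda_H_apply[OF assms(1)] .
  qed
  ultimately show ?thesis
    unfolding leading_def using cone_series_toda_H[OF assms(1)] by blast
qed

definition lead_expo :: "(nat \<Rightarrow>\<^sub>0 nat) \<Rightarrow> expo" where
  "lead_expo e = (\<lambda>j. \<Sum>i=1..N. int (Poly_Mapping.lookup e i) * ones i j)"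

lemma lead_expo_outside: "j \<notin> {1..N} \<Longrightarrow> lead_expo e j = 0"
  unfolding lead_expo_def by (intro sum.neutral) (auto simp: ones_def)

text \<open>Consecutive differences recover the powers, so distinct monomials in the Hamiltonians
  have distinct leading exponents.\<close>

lemma lead_expo_diff:
  assumes "j \<in> {1..N}"
  shows "lead_expo e j - lead_expo e (Suc j) = int (Poly_Mapping.lookup e j)"
proof -
  have "lead_expo e j - lead_expo e (Suc j) =
      (\<Sum>i=1..N. int (Poly_Mapping.lookup e i) * (ones i j - ones i (Suc j)))"
    by (simp add: lead_expo_def sum_subtractf right_diff_distrib)
  also have "\<dots> = (\<Sum>i\<in>{j}. int (Poly_Mapping.lookup e i))"
    using assms by (intro sum.mono_neutral_cong_right) (auto simp: ones_def)
  finally show ?thesis by simp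
qed

lemma lead_expo_inject:
  assumes "Poly_Mapping.keys e \<subseteq> {1..N}" "Poly_Mapping.keys e' \<subseteq> {1..N}" "lead_expo e = lead_expo e'"
  shows "e = e'"
proof (rule poly_mapping_eqI)
  fix j
  show "Poly_Mapping.lookup e j = Poly_Mapping.lookup e' j"
  proof (cases "j \<in> {1..N}")
    case True
    then show ?thesis
      using lead_expo_diff[OF True, of e] lead_expo_diff[OF True, of e'] assms(3) by simp
  next
    case False
    then show ?thesis
      using assms(1,2) by (metis in_keys_iff subsetD)
  qed
qed

lemma toda_H_algebraically_independent:
  assumes "1 \<le> N"
  shows "algebraically_independent R N (toda_H q s N)"
  unfolding algebraically_independent_def
proof (intro conjI ballI allI impI)
  show "toda_H q s N a \<otimes> toda_H q s N b = toda_H q s N b \<otimes> toda_H q s N a" for a b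
    by (rule toda_H_commute[OF assms])
next
  fix p :: "(nat \<Rightarrow>\<^sub>0 nat) \<Rightarrow>\<^sub>0 complex"
  assume keys: "\<forall>e\<in>Poly_Mapping.keys p. Poly_Mapping.keys e \<subseteq> {1..N}"
    and zero: "poly_eval R N p (toda_H q s N) = \<zero>"
  define M where "M = (\<lambda>e :: nat \<Rightarrow>\<^sub>0 nat. ord_prod R N (\<lambda>i. toda_H q s N i [^] Poly_Mapping.lookup e i))"
  have M_eq: "ord_prod R N (\<lambda>i. toda_H q s N i [^] Poly_Mapping.lookup e i) = M e" for e
    by (simp add: M_def)
  have lead: "leading (lead_expo e) (M e)" for e
    unfolding M_def lead_expo_def
    by (intro leading_ord_prod leading_nat_pow leading_toda_H assms) simp
  have M_closed: "M e \<in> carrier R" for e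
    using lead leading_closed by blast
  show "p = 0"
  proof (rule ccontr)
    assume "p \<noteq> 0"
    then have ne: "Poly_Mapping.keys p \<noteq> {}" by simp
    \<comment> \<open>A linear functional that increases along the dominance order: the leading
      monomial of a maximizing e0 occurs in no other monomial of p, so its coefficient cannot
      cancel.\<close>
    define \<phi> where "\<phi> = (\<lambda>e. \<Sum>j=1..N. partial_sum (lead_expo e) j)"
    have "Max (\<phi> ` Poly_Mapping.keys p) \<in> \<phi> ` Poly_Mapping.keys p"
      using ne by (intro Max_in) auto
    then obtain e0 where e0: "e0 \<in> Poly_Mapping.keys p" "\<phi> e0 = Max (\<phi> ` Poly_Mapping.keys p)"
      by auto
    have max: "\<phi> e \<le> \<phi> e0" if "e \<in> Poly_Mapping.keys p" for e
      unfolding e0(2) using that by (intro Max_ge) auto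
    have other: "M e (0, lead_expo e0, 0) = 0" if e: "e \<in> Poly_Mapping.keys p" "e \<noteq> e0" for e
    proof (rule ccontr)
      assume "M e (0, lead_expo e0, 0) \<noteq> 0"
      then have le: "partial_sum (lead_expo e0) j \<le> partial_sum (lead_expo e) j" for j
        using leading_le[OF lead] by (simp add: supp_def)
      have "\<phi> e0 \<le> \<phi> e"
        unfolding \<phi>_def by (intro sum_mono le)
      then have eq: "(\<Sum>j=1..N. partial_sum (lead_expo e0) j) = (\<Sum>j=1..N. partial_sum (lead_expo e) j)"
        using max[OF e(1)] by (simp add: \<phi>_def)
      \<comment> \<open>Termwise inequalities whose sums agree are equalities.\<close>
      have ps: "partial_sum (lead_expo e0) j = partial_sum (lead_expo e) j" if "j \<le> N" for j
      proof (cases "j = 0")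
        case False
        then show ?thesis
          using that by (intro sum_mono_inv[OF eq le]) auto
      qed (simp add: partial_sum_def)
      have "lead_expo e0 j = lead_expo e j" for j
      proof (cases "j \<in> {1..N}")
        case True
        then obtain i where "j = Suc i" by (cases j) auto
        then show ?thesis
          using ps[of j] ps[of i] True by (simp add: partial_sum_def)
      qed (simp add: lead_expo_outside)
      then have "lead_expo e0 = lead_expo e" ..
      then show False
        using lead_expo_inject keys e e0(1) by metis
    qed
    have "poly_eval R N p (toda_H q s N) (0, lead_expo e0, 0) =
        (\<Sum>e\<in>Poly_Mapping.keys p. Poly_Mapping.lookup p e * M e (0, lead_expo e0, 0))"
      unfolding poly_eval_def M_eq
      by (subst finsum_apply) (simp_all add: M_closed smult_apply)
    also have "\<dots> = (\<Sum>e\<in>{e0}. Poly_Mapping.lookup p e * M e (0, lead_expo e0, 0))"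
      using e0(1) other by (intro sum.mono_neutral_right) auto
    also have "\<dots> = Poly_Mapping.lookup p e0"
      using lead[of e0] by (simp add: leading_def)
    finally show False
      using zero e0(1) by (simp add: zero_apply in_keys_iff)
  qed
qed

end

theorem corollary2p13:
  fixes q s :: complex and N :: nat
  assumes "q \<noteq> 0" and "norm q < 1" and "s\<^sup>2 = q" and "1 \<le> N"
  shows "(\<forall>a\<in>{1..N}. conserved_quantity q s N (toda_H q s N a)) \<and>
         algebraically_independent (series_alg q s N) N (toda_H q s N)"
proof -
  interpret toda q s N "series_alg q s N"
    by unfold_locales (use assms in auto)
  show ?thesis
    using conserved_toda_H[OF assms(4)] toda_H_algebraically_independent[OF assms(4)] by blast
qed

end
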